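(* Let $f:X\to X$ be a bi-Lipschitz homeomorphism of a compact metric space $(X,d)$, let $\mu$ be an $f$-invariant ergodic Borel probability measure on $X$, let $\mathcal{B}$ be an infinite-dimensional Banach space, and let $\mathcal{A}$ be the linear cocycle over $f$ generated by a quasi-compact, $\nu$-Hölder continuous map $A:X\to GL(\mathcal{B})$, $\nu>0$. Let $\lambda_1>\lambda_2>\cdots>\lambda_k>\lambda_{k+1}$ be the distinct $k+1$ Lyapunov exponents, with corresponding Oseledets splitting $\mathcal{B}=E_1(x)\oplus\cdots\oplus E_k(x)\oplus F_{k+1}(x)$ defined for $\mu$-almost every $x\in X$. (In Case (1) of the context, $k$ is the number of finite-dimensional Oseledets subspaces, $\lambda_{k+1}:=\alpha(A,\mu)$ and $F_{k+1}(x):=F(x)$; in Case (2), $k$ is any given positive integer.) Then for every $\gamma>0$ there exist a compact subset $\Lambda_\gamma\subset X$ with $\mu(\Lambda_\gamma)>1-\gamma$ and constants $C=C(\Lambda_\gamma)>0$, $\omega_i=\omega_i(\lambda_1,\dots,\lambda_{k+1})\in(0,1)$ for $i=1,\dots,k+1$, and $\delta=\delta(\gamma,\Lambda_\gamma,\lambda_1,\dots,\lambda_{k+1})>0$ such that for all $x,y\in\Lambda_\gamma$ with $d(x,y)<\delta$, $$\hat d(E_i(x),E_i(y))\le C\,d(x,y)^{\nu\omega_i}\quad (i=1,\dots,k)\qquad\text{and}\qquad \hat d(F_{k+1}(x),F_{k+1}(y))\le C\,d(x,y)^{\nu\omega_{k+1}}.$$ Here the arguments in parentheses indicate dependence for fixed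 data $(X,f,\mu,\mathcal{B},A,\nu)$; in particular the $\omega_i$ do not depend on $\gamma$.
   Context: $GL(\mathcal{B})$ is the group of invertible bounded linear operators on $\mathcal{B}$ with the metric $\rho(S,T)=\|S-T\|+\|S^{-1}-T^{-1}\|$; Hölder continuity of $A$ is with respect to $\rho$. The linear cocycle generated by $A$ over $f$ is $\mathcal{A}(x,n)=A(f^{n-1}(x))\circ\cdots\circ A(x)$ for $n>0$, $\mathcal{A}(x,0)=\mathrm{Id}$, and $\mathcal{A}(x,n)=A(f^{n}(x))^{-1}\circ\cdots\circ A(f^{-1}(x))^{-1}$ for $n<0$. For a bounded operator $T$, $\|T\|_\alpha$ is the infimum of $r>0$ such that the image under $T$ of the unit ball of $\mathcal{B}$ can be covered by finitely many balls of radius $r$. The limits $\lambda(A,\mu)=\lim_n\frac1n\log\|\mathcal{A}(x,n)\|$ and $\alpha(A,\mu)=\lim_n\frac1n\log\|\mathcal{A}(x,n)\|_\alpha$ exist and are constant for $\mu$-a.e. $x$; $A$ is quasi-compact if $\alpha(A,\mu)<\lambda(A,\mu)$. Multiplicative ergodic theorem (Thieullen), which defines the exponents and the splitting: there is an $f$-invariant set $X_0$ of full $\mu$-measure such that one of the following holds. Case (1): there are finitely many numbers $\lambda_1>\cdots>\lambda_k>\alpha(A,\mu)$ with $\lambda_1=\lambda(A,\mu)$, and for every $x\in X_0$ a splitting $\mathcal{B}=E_1(x)\oplus\cdots\oplus E_k(x)\oplus F(x)$ such that: $\dim E_i(x)=m_i$ is finite and constant, $A(x)E_i(x)=E_i(f(x))$,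 and $\lim_{n\to\infty}\frac1n\log\|\mathcal{A}(x,n)v\|=-\lim_{n\to\infty}\frac1n\log\|\mathcal{A}(x,-n)v\|=\lambda_i$ for $v\in E_i(x)\setminus\{0\}$; $F(x)$ is closed of finite codimension, $A(x)F(x)=F(f(x))$ and $\limsup_{n\to\infty}\frac1n\log\|\mathcal{A}(x,n)|_{F(x)}\|\le\alpha(A,\mu)$; $x\mapsto E_i(x)$ and $x\mapsto F(x)$ are measurable; and the projections $\pi_i(x)$ of $\mathcal{B}$ onto $E_i(x)$ along the splitting satisfy $\lim_{n\to\pm\infty}\frac1n\log\|\pi_i(f^n(x))\|=0$. Case (2): there are infinitely many numbers $\lambda_1>\lambda_2>\cdots>\alpha(A,\mu)$ with $\lambda_1=\lambda(A,\mu)$, and for every $x\in X_0$ and every $k\in\mathbb{N}$ a splitting $\mathcal{B}=E_1(x)\oplus\cdots\oplus E_k(x)\oplus F_{k+1}(x)$ with the same properties, where $F(x)$ is replaced by $F_{k+1}(x)$ and the growth bound on it is $\limsup_{n\to\infty}\frac1n\log\|\mathcal{A}(x,n)|_{F_{k+1}(x)}\|\le\lambda_{k+1}$. For non-trivial closed subspaces $E,F$ of $\mathcal{B}$ with unit spheres $S_E,S_F$, $\hat d(E,F)=\max\{\sup_{v\in S_E}\operatorname{dist}(v,S_F),\ \sup_{v\in S_F}\operatorname{dist}(v,S_E)\}$, where $\operatorname{dist}(v,S)=\inf_{u\in S}\|v-u\|$ (the Hausdorff distance between unit spheres). *)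

theory Defs
  imports "HOL-Probability.Probability"
begin

definition bi_lipschitz_homeo :: "('x::metric_space \<Rightarrow> 'x) \<Rightarrow> bool" where
  "bi_lipschitz_homeo f \<longleftrightarrow>
     bij f \<and> (\<exists>L. L-lipschitz_on UNIV f) \<and> (\<exists>L. L-lipschitz_on UNIV (inv f))"

definition invariant_measure :: "'x measure \<Rightarrow> ('x \<Rightarrow> 'x) \<Rightarrow> bool" where
  "invariant_measure M f \<longleftrightarrow> f \<in> M \<rightarrow>\<^sub>M M \<and> distr M M f = M"

definition ergodic_measure :: "'x measure \<Rightarrow> ('x \<Rightarrow> 'x) \<Rightarrow> bool" where
  "ergodic_measure M f \<longleftrightarrow>
     (\<forall>S\<in>sets M. f -` S \<inter> space M = S \<longrightarrow> measure M S = 0 \<or> measure M S = 1)"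

definition int_iterate :: "('x \<Rightarrow> 'x) \<Rightarrow> int \<Rightarrow> 'x \<Rightarrow> 'x" where
  "int_iterate f n = (if n \<ge> 0 then f ^^ nat n else inv f ^^ nat (- n))"

definition GL :: "('b::real_normed_vector \<Rightarrow>\<^sub>L 'b) set" where
  "GL = {T. \<exists>S. S o\<^sub>L T = id_blinfun \<and> T o\<^sub>L S = id_blinfun}"

definition op_inv :: "('b::real_normed_vector \<Rightarrow>\<^sub>L 'b) \<Rightarrow> ('b \<Rightarrow>\<^sub>L 'b)" where
  "op_inv T = (THE S. S o\<^sub>L T = id_blinfun \<and> T o\<^sub>L S = id_blinfun)"

definition GL_dist :: "('b::real_normed_vector \<Rightarrow>\<^sub>L 'b) \<Rightarrow> ('b \<Rightarrow>\<^sub>L 'b) \<Rightarrow> real" where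
  "GL_dist S T = norm (S - T) + norm (op_inv S - op_inv T)"

definition GL_holder ::
    "real \<Rightarrow> ('x::metric_space \<Rightarrow> ('b::real_normed_vector \<Rightarrow>\<^sub>L 'b)) \<Rightarrow> bool" where
  "GL_holder \<nu> A \<longleftrightarrow>
     range A \<subseteq> GL \<and> (\<exists>K. \<forall>x y. GL_dist (A x) (A y) \<le> K * dist x y powr \<nu>)"

primrec cocycle_fwd ::
    "('x \<Rightarrow> 'x) \<Rightarrow> ('x \<Rightarrow> ('b::real_normed_vector \<Rightarrow>\<^sub>L 'b)) \<Rightarrow> 'x \<Rightarrow> nat \<Rightarrow> ('b \<Rightarrow>\<^sub>L 'b)" where
  "cocycle_fwd f A x 0 = id_blinfun"
| "cocycle_fwd f A x (Suc n) = A (int_iterate f (int n) x) o\<^sub>L cocycle_fwd f A x n"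

primrec cocycle_bwd ::
    "('x \<Rightarrow> 'x) \<Rightarrow> ('x \<Rightarrow> ('b::real_normed_vector \<Rightarrow>\<^sub>L 'b)) \<Rightarrow> 'x \<Rightarrow> nat \<Rightarrow> ('b \<Rightarrow>\<^sub>L 'b)" where
  "cocycle_bwd f A x 0 = id_blinfun"
| "cocycle_bwd f A x (Suc n) =
     op_inv (A (int_iterate f (- int (Suc n)) x)) o\<^sub>L cocycle_bwd f A x n"

definition cocycle ::
    "('x \<Rightarrow> 'x) \<Rightarrow> ('x \<Rightarrow> ('b::real_normed_vector \<Rightarrow>\<^sub>L 'b)) \<Rightarrow> 'x \<Rightarrow> int \<Rightarrow> ('b \<Rightarrow>\<^sub>L 'b)" where
  "cocycle f A x n = (if n \<ge> 0 then cocycle_fwd f A x (nat n) else cocycle_bwd f A x (nat (- n)))"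

definition alpha_norm :: "('b::real_normed_vector \<Rightarrow>\<^sub>L 'b) \<Rightarrow> real" where
  "alpha_norm T = Inf {r. r > 0 \<and>
     (\<exists>S. finite S \<and> blinfun_apply T ` cball 0 1 \<subseteq> (\<Union>c\<in>S. cball c r))}"

text \<open>The limits in the next two definitions exist and are constant almost everywhere by the
  subadditive ergodic theorem, when the measure is invariant and ergodic.\<close>

definition top_exponent ::
    "'x measure \<Rightarrow> ('x \<Rightarrow> 'x) \<Rightarrow> ('x \<Rightarrow> ('b::real_normed_vector \<Rightarrow>\<^sub>L 'b)) \<Rightarrow> real" where
  "top_exponent M f A =
     (THE l. AE x in M. (\<lambda>n. ln (norm (cocycle f A x (int n))) / real n) \<longlonglongrightarrow> l)"

definition alpha_exponent ::
    "'x measure \<Rightarrow> ('x \<Rightarrow> 'x) \<Rightarrow> ('x \<Rightarrow> ('b::real_normed_vector \<Rightarrow>\<^sub>L 'b)) \<Rightarrow> real" where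
  "alpha_exponent M f A =
     (THE l. AE x in M. (\<lambda>n. ln (alpha_norm (cocycle f A x (int n))) / real n) \<longlonglongrightarrow> l)"

definition quasi_compact ::
    "'x measure \<Rightarrow> ('x \<Rightarrow> 'x) \<Rightarrow> ('x \<Rightarrow> ('b::real_normed_vector \<Rightarrow>\<^sub>L 'b)) \<Rightarrow> bool" where
  "quasi_compact M f A \<longleftrightarrow> alpha_exponent M f A < top_exponent M f A"

definition finite_dim :: "'b::real_vector set \<Rightarrow> bool" where
  "finite_dim V \<longleftrightarrow> (\<exists>S. finite S \<and> V \<subseteq> span S)"

definition finite_codim :: "'b::real_vector set \<Rightarrow> bool" where
  "finite_codim V \<longleftrightarrow> (\<exists>S. finite S \<and> span (V \<union> S) = UNIV)"

definition unit_sphere :: "'b::real_normed_vector set \<Rightarrow> 'b set" where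
  "unit_sphere V = V \<inter> sphere 0 1"

definition hat_d :: "'b::real_normed_vector set \<Rightarrow> 'b set \<Rightarrow> real" where
  "hat_d V W = max (SUP v\<in>unit_sphere V. infdist v (unit_sphere W))
                   (SUP w\<in>unit_sphere W. infdist w (unit_sphere V))"

definition grassmannian :: "'b::real_normed_vector set set" where
  "grassmannian = {V. subspace V \<and> closed V \<and> V \<noteq> {0}}"

definition grassmannian_open :: "'b::real_normed_vector set set \<Rightarrow> bool" where
  "grassmannian_open U \<longleftrightarrow> U \<subseteq> grassmannian \<and>
     (\<forall>V\<in>U. \<exists>e>0. \<forall>W\<in>grassmannian. hat_d V W < e \<longrightarrow> W \<in> U)"

definition grassmannian_borel :: "'b::real_normed_vector set measure" where
  "grassmannian_borel = sigma grassmannian {U. grassmannian_open U}"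

definition restricted_norm :: "('b::real_normed_vector \<Rightarrow>\<^sub>L 'b) \<Rightarrow> 'b set \<Rightarrow> real" where
  "restricted_norm T V = (SUP v\<in>V \<inter> cball 0 1. norm (blinfun_apply T v))"

text \<open>\<open>u \<in> Pi\<^sub>E I V\<close> is a choice of components \<open>u i \<in> V i\<close>, made unique by extensionality off \<open>I\<close>.\<close>

definition direct_splitting :: "'i set \<Rightarrow> ('i \<Rightarrow> 'b::real_vector set) \<Rightarrow> bool" where
  "direct_splitting I V \<longleftrightarrow> (\<forall>i\<in>I. subspace (V i)) \<and> (\<forall>v. \<exists>!u. u \<in> Pi\<^sub>E I V \<and> sum u I = v)"

definition splitting_proj :: "'i set \<Rightarrow> ('i \<Rightarrow> 'b::real_vector set) \<Rightarrow> 'i \<Rightarrow> 'b \<Rightarrow> 'b" where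
  "splitting_proj I V i v = (THE u. u \<in> Pi\<^sub>E I V \<and> sum u I = v) i"

text \<open>The summands \<open>E 1 x, \<dots>, E k x, F x\<close> are collected into one family over \<open>{1..Suc k}\<close>.\<close>

definition summands :: "nat \<Rightarrow> (nat \<Rightarrow> 'x \<Rightarrow> 'b set) \<Rightarrow> ('x \<Rightarrow> 'b set) \<Rightarrow> 'x \<Rightarrow> nat \<Rightarrow> 'b set" where
  "summands k E F x i = (if i = Suc k then F x else E i x)"

text \<open>The properties asserted by the multiplicative ergodic theorem for a splitting with \<open>k\<close>
  finite-dimensional subspaces, where \<open>\<beta>\<close> is the growth bound on the complement \<open>F\<close>.
  The multiplicities are positive: \<open>lam i\<close> is an exponent only if \<open>E i x\<close> has nonzero vectors.\<close>

definition splitting_properties ::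
    "'x measure \<Rightarrow> ('x \<Rightarrow> 'x) \<Rightarrow> ('x \<Rightarrow> ('b::real_normed_vector \<Rightarrow>\<^sub>L 'b)) \<Rightarrow> 'x set \<Rightarrow> nat \<Rightarrow>
     (nat \<Rightarrow> real) \<Rightarrow> (nat \<Rightarrow> 'x \<Rightarrow> 'b set) \<Rightarrow> ('x \<Rightarrow> 'b set) \<Rightarrow> real \<Rightarrow> bool" where
  "splitting_properties M f A X0 k lam E F \<beta> \<longleftrightarrow>
     (\<forall>x\<in>X0. direct_splitting {1..Suc k} (summands k E F x)) \<and>
     (\<forall>i\<in>{1..k}.
        (\<exists>m>0. \<forall>x\<in>X0. finite_dim (E i x) \<and> dim (E i x) = m) \<and>
        (\<forall>x\<in>X0. blinfun_apply (A x) ` E i x = E i (f x)) \<and>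
        (\<forall>x\<in>X0. \<forall>v\<in>E i x - {0}.
           (\<lambda>n. ln (norm (blinfun_apply (cocycle f A x (int n)) v)) / real n) \<longlonglongrightarrow> lam i \<and>
           (\<lambda>n. ln (norm (blinfun_apply (cocycle f A x (- int n)) v)) / real n) \<longlonglongrightarrow> - lam i) \<and>
        E i \<in> restrict_space M X0 \<rightarrow>\<^sub>M grassmannian_borel \<and>
        (\<forall>x\<in>X0. \<forall>\<F>\<in>{at_top, at_bot}.
           ((\<lambda>n::int. ln (onorm (splitting_proj {1..Suc k} (summands k E F (int_iterate f n x)) i))
                        / real_of_int n) \<longlongrightarrow> 0) \<F>)) \<and>
     (\<forall>x\<in>X0. closed (F x) \<and> finite_codim (F x) \<and> blinfun_apply (A x) ` F x = F (f x) \<and>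
        limsup (\<lambda>n. ereal (ln (restricted_norm (cocycle f A x (int n)) (F x)) / real n)) \<le> ereal \<beta>) \<and>
     F \<in> restrict_space M X0 \<rightarrow>\<^sub>M grassmannian_borel"

definition invariant_full_set :: "'x measure \<Rightarrow> ('x \<Rightarrow> 'x) \<Rightarrow> 'x set \<Rightarrow> bool" where
  "invariant_full_set M f X0 \<longleftrightarrow> X0 \<in> sets M \<and> measure M X0 = 1 \<and> f ` X0 = X0"

definition oseledets_case1 ::
    "'x measure \<Rightarrow> ('x \<Rightarrow> 'x) \<Rightarrow> ('x \<Rightarrow> ('b::real_normed_vector \<Rightarrow>\<^sub>L 'b)) \<Rightarrow> 'x set \<Rightarrow> nat \<Rightarrow>
     (nat \<Rightarrow> real) \<Rightarrow> (nat \<Rightarrow> 'x \<Rightarrow> 'b set) \<Rightarrow> ('x \<Rightarrow> 'b set) \<Rightarrow> bool" where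
  "oseledets_case1 M f A X0 k lam E F \<longleftrightarrow>
     invariant_full_set M f X0 \<and> k \<ge> 1 \<and> lam 1 = top_exponent M f A \<and>
     (\<forall>i\<in>{1..<k}. lam i > lam (Suc i)) \<and> lam k > alpha_exponent M f A \<and>
     splitting_properties M f A X0 k lam E F (alpha_exponent M f A)"

text \<open>In the second case \<open>Fs (Suc k)\<close> is the complement of the first \<open>k\<close> subspaces.\<close>

definition oseledets_case2 ::
    "'x measure \<Rightarrow> ('x \<Rightarrow> 'x) \<Rightarrow> ('x \<Rightarrow> ('b::real_normed_vector \<Rightarrow>\<^sub>L 'b)) \<Rightarrow> 'x set \<Rightarrow>
     (nat \<Rightarrow> real) \<Rightarrow> (nat \<Rightarrow> 'x \<Rightarrow> 'b set) \<Rightarrow> (nat \<Rightarrow> 'x \<Rightarrow> 'b set) \<Rightarrow> bool" where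
  "oseledets_case2 M f A X0 lam E Fs \<longleftrightarrow>
     invariant_full_set M f X0 \<and> lam 1 = top_exponent M f A \<and>
     (\<forall>i\<ge>1. lam i > lam (Suc i) \<and> lam i > alpha_exponent M f A) \<and>
     (\<forall>k\<ge>1. splitting_properties M f A X0 k lam E (Fs (Suc k)) (lam (Suc k)))"

definition oseledets_splitting ::
    "'x measure \<Rightarrow> ('x \<Rightarrow> 'x) \<Rightarrow> ('x \<Rightarrow> ('b::real_normed_vector \<Rightarrow>\<^sub>L 'b)) \<Rightarrow> 'x set \<Rightarrow> nat \<Rightarrow>
     (nat \<Rightarrow> real) \<Rightarrow> (nat \<Rightarrow> 'x \<Rightarrow> 'b set) \<Rightarrow> ('x \<Rightarrow> 'b set) \<Rightarrow> bool" where
  "oseledets_splitting M f A X0 k lam E F \<longleftrightarrow>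
     (oseledets_case1 M f A X0 k lam E F \<and> lam (Suc k) = alpha_exponent M f A) \<or>
     (k \<ge> 1 \<and> (\<exists>Fs. oseledets_case2 M f A X0 lam E Fs \<and> F = Fs (Suc k)))"

end

theory Submission
  imports Defs
begin

text \<open>Write \<open>p\<^sub>l(x)\<close> for the projections of the splitting at \<open>x\<close> and fix a small \<open>\<epsilon>\<close>. For almost every \<open>x\<close>
  there is a \<open>C\<close> such that, up to factors \<open>C exp(\<epsilon> n)\<close>, a vector \<open>p\<^sub>l(x) v\<close> grows at most like
  \<open>exp(\<lambda>\<^sub>l n)\<close> under the forward cocycle and like \<open>exp(-\<lambda>\<^sub>l n)\<close> under the backward one, while
  \<open>\<parallel>p\<^sub>l(x) v\<parallel>\<close> is at most the inverse of this rate times the norm of the image of \<open>v\<close>.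
  The upper bounds are pointwise consequences of the Lyapunov exponents. The lower bounds are upper bounds for the inverse cocycle, started at the other end
  of the orbit segment; a maximal inequality for visit frequencies moves them there, which
  replaces the subadditive ergodic theorem.

  If \<open>x\<close> and \<open>y\<close> both satisfy these estimates with the same \<open>C\<close>, comparing the cocycles at \<open>x\<close> and \<open>y\<close>,
  which differ by at most \<open>a\<^sup>n d(x,y)\<^sup>\<nu>\<close>, and optimising over \<open>n\<close> shows that \<open>p\<^sub>l(x) p\<^sub>i(y)\<close> is
  Hoelder small in \<open>d(x,y)\<close> for \<open>l \<noteq> i\<close>. This gives the Hoelder estimate for the subspaces. It also shows that the
  set of good points for a given \<open>C\<close> is relatively closed in a set of full measure, so no separability
  of \<open>B\<close> is needed to find a compact set of good points.\<close>

section \<open>A maximal inequality and submultiplicative cocycles\<close>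

text \<open>On the infinite-dimensional summand F only forward growth is known, so no upper bound
  for the backward cocycle is available there. This dictates the time direction:
  \<open>p x l (p y i v)\<close> is treated forward in time if l < i and backward if l > i, and F
  never needs the missing bound.

  The lower bounds ask for norms over a segment starting at a point that moves with n, where the
  pointwise constant is out of control. What is controlled is the measure of the set where the
  N-step norm exceeds the expected rate: it tends to 0 as N grows. Off a small exceptional set the
  orbit visits that set with small frequency, uniformly in the length of the segment, and each visit
  costs a bounded factor, so the total loss is \<open>exp (\<epsilon> n)\<close>.

  Comparing two regular points leaves q^n + Q^n d^\<nu>. Here q = exp (-\<Delta>/2) comes from the
  smallest gap \<Delta>, after a quarter of it is given up at each of the two points, and Q bounds
  the cocycle difference times the largest rate. Balancing the terms gives \<omega>, so only the
  exponents and the fixed data enter it; \<gamma> affects C and \<delta> alone.\<close>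

primrec max_excess :: "('x \<Rightarrow> 'x) \<Rightarrow> ('x \<Rightarrow> real) \<Rightarrow> nat \<Rightarrow> 'x \<Rightarrow> real" where
  "max_excess S g 0 x = 0"
| "max_excess S g (Suc n) x = max 0 (g x + max_excess S g n (S x))"

lemma max_excess_nonneg: "0 \<le> max_excess S g n x"
  by (cases n) auto

text \<open>\<open>max_excess S g n\<close> is the maximum of the Birkhoff sums of g of lengths 0 to
  n. The recursive form is what Garsia's proof of the maximal ergodic theorem integrates.\<close>

lemma sum_le_max_excess: "m \<le> n \<Longrightarrow> (\<Sum>i<m. g ((S ^^ i) x)) \<le> max_excess S g n x"
proof (induction n arbitrary: m x)
  case (Suc n)
  show ?case
  proof (cases m)
    case 0
    then show ?thesis using max_excess_nonneg[of S g "Suc n" x] by simp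
  next
    case (Suc m')
    then have "(\<Sum>i<m. g ((S ^^ i) x)) = g x + (\<Sum>i<m'. g ((S ^^ i) (S x)))"
      unfolding Suc sum.lessThan_Suc_shift by (simp add: funpow_swap1)
    also have "\<dots> \<le> g x + max_excess S g n (S x)"
      using Suc Suc.prems Suc.IH[of m' "S x"] by simp
    finally show ?thesis by simp
  qed
qed simp

lemma max_excess_mono: "max_excess S g n x \<le> max_excess S g (Suc n) x"
proof (induction n arbitrary: x)
  case (Suc n)
  show ?case using Suc[of "S x"] by (simp add: max_def)
qed simp

lemma max_excess_le: "(\<And>x. g x \<le> 1) \<Longrightarrow> max_excess S g n x \<le> real n"
proof (induction n arbitrary: x)
  case (Suc n)
  have "g x + max_excess S g n (S x) \<le> 1 + real n"
    using Suc.IH[of "S x"] Suc.prems by (intro add_mono) auto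
  then show ?case by simp
qed simp

text \<open>Garsia's argument for the function \<open>indicator B (S x) - c\<close>: where some
  Birkhoff sum is positive, the maximal excess drops by at most g in one step, and invariance
  cancels the two integrals of the excess. Visits are counted at times 1 to n, the times that occur
  when an orbit segment is read backward from its end.\<close>

lemma (in prob_space) maximal_frequency:
  fixes c :: real
  assumes S: "S \<in> M \<rightarrow>\<^sub>M M" "distr M M S = M" and B: "B \<in> sets M" and c: "c > 0"
  shows "\<exists>D\<in>sets M. prob D \<le> prob B / c \<and>
    (\<forall>x\<in>space M - D. \<forall>n. (\<Sum>i<n. indicator B ((S ^^ Suc i) x)) \<le> c * real n)"
proof -
  define g :: "'a \<Rightarrow> real" where "g x = indicator B (S x) - c" for x
  define W where "W = max_excess S g"
  define D where "D n = {x\<in>space M. W n x > 0}" for n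
  have g1: "g x \<le> 1" for x using c by (auto simp: g_def indicator_def)
  have gm[measurable]: "g \<in> borel_measurable M" unfolding g_def using S(1) B by measurable
  have Wm[measurable]: "W n \<in> borel_measurable M" for n
  proof (induction n)
    case (Suc n)
    have [measurable]: "(\<lambda>x. W n (S x)) \<in> borel_measurable M"
      using measurable_compose[OF S(1) Suc] .
    show ?case unfolding W_def by simp (use Suc in \<open>simp add: W_def[symmetric]\<close>)
  qed (simp add: W_def)
  have W0: "0 \<le> W n x" for n x by (simp add: W_def max_excess_nonneg)
  have Wle: "W n x \<le> real n" for n x by (simp add: W_def max_excess_le g1)
  have WI: "integrable M (W n)" for n
    by (rule integrable_const_bound[where B="real n"]) (use W0 Wle in auto)
  have Dm[measurable]: "D n \<in> sets M" for n unfolding D_def by measurable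
  \<comment> \<open>Raising the index on the right by \<open>max_excess_mono\<close> puts the same
    function W on both sides, so that it cancels after integration.\<close>
  have step: "W (Suc n) x \<le> indicator (D (Suc n)) x * g x + W (Suc n) (S x)" if "x \<in> space M" for n x
  proof (cases "W (Suc n) x > 0")
    case True
    then have "W (Suc n) x = g x + W n (S x)" by (simp add: W_def max_def split: if_splits)
    also have "\<dots> \<le> g x + W (Suc n) (S x)" by (simp add: W_def max_excess_mono del: max_excess.simps)
    finally show ?thesis using True that by (simp add: D_def)
  next
    case False
    then show ?thesis using W0[of "Suc n" "S x"] by (simp add: D_def)
  qed
  have meas: "prob (D n) \<le> prob B / c" for n
  proof (cases n)
    case 0 then show ?thesis using c by (simp add: D_def W_def)
  next
    case (Suc m)
    have inv: "(\<integral>x. h (S x) \<partial>M) = (\<integral>x. h x \<partial>M)" if "h \<in> borel_measurable M" for h :: "'a \<Rightarrow> real"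
      using integral_distr[OF S(1) that] S(2) by simp
    have iS: "integrable M (\<lambda>x. W n (S x))"
      using integrable_distr[OF S(1), of "W n"] S(2) WI by simp
    have iB: "integrable M (\<lambda>x. indicator (D n) x * indicator B (S x) :: real)"
      by (rule integrable_const_bound[where B=1]) (use S(1) B in \<open>auto simp: indicator_def\<close>)
    have iD: "integrable M (\<lambda>x. c * indicator (D n) x)"
      by (rule integrable_const_bound[where B=c]) (use c in \<open>auto simp: indicator_def\<close>)
    have "(\<integral>x. W n x \<partial>M) \<le> (\<integral>x. (indicator (D n) x * indicator B (S x) - c * indicator (D n) x) + W n (S x) \<partial>M)"
    proof (rule integral_mono)
      show "integrable M (\<lambda>x. (indicator (D n) x * indicator B (S x) - c * indicator (D n) x) + W n (S x))"
        by (intro Bochner_Integration.integrable_add Bochner_Integration.integrable_diff iB iD iS)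
      show "W n x \<le> (indicator (D n) x * indicator B (S x) - c * indicator (D n) x) + W n (S x)"
        if "x \<in> space M" for x
        using step[OF that, of m] by (simp add: Suc g_def algebra_simps)
    qed (rule WI)
    also have "\<dots> = (\<integral>x. indicator (D n) x * indicator B (S x) \<partial>M) - c * prob (D n) + (\<integral>x. W n x \<partial>M)"
      using iB iD iS inv[of "W n"] by simp
    finally have "c * prob (D n) \<le> (\<integral>x. indicator (D n) x * indicator B (S x) \<partial>M)" by simp
    also have "\<dots> \<le> (\<integral>x. indicator B (S x) \<partial>M)"
      by (rule integral_mono[OF iB]) (use S(1) B in \<open>auto simp: indicator_def intro!: integrable_const_bound[where B=1]\<close>)
    also have "\<dots> = prob B" using inv[of "indicator B"] B by simp
    finally show ?thesis using c by (simp add: field_simps)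
  qed
  show ?thesis
  proof (intro bexI conjI ballI allI)
    have "incseq D" unfolding D_def incseq_Suc_iff W_def
      using max_excess_mono[of S g] by (auto intro: less_le_trans simp del: max_excess.simps)
    then have "(\<lambda>n. prob (D n)) \<longlonglongrightarrow> prob (\<Union>n. D n)"
      by (intro finite_Lim_measure_incseq) auto
    then show "prob (\<Union>n. D n) \<le> prob B / c"
      by (rule LIMSEQ_le_const2) (use meas in auto)
    fix x n assume x: "x \<in> space M - (\<Union>n. D n)"
    then have "W n x \<le> 0" by (auto simp: D_def not_less)
    with sum_le_max_excess[of n n g S x] have "(\<Sum>i<n. g ((S ^^ i) x)) \<le> 0"
      by (simp add: W_def)
    then show "(\<Sum>i<n. indicator B ((S ^^ Suc i) x)) \<le> c * real n"
      by (simp add: g_def sum_subtractf mult.commute)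
  qed auto
qed

text \<open>Greedy block decomposition of an orbit segment: from a point outside \<open>B\<close> jump \<open>N\<close> steps,
  from a point of \<open>B\<close> jump one step.\<close>

lemma submultiplicative_block_bound:
  fixes r :: "nat \<Rightarrow> 'x \<Rightarrow> real"
  assumes nonneg: "\<And>n x. 0 \<le> r n x"
    and sub: "\<And>m n x. r (m + n) x \<le> r n ((T ^^ m) x) * r m x"
    and bnd: "\<And>n x. r n x \<le> a ^ n" and a: "1 \<le> a"
    and N: "N \<ge> 1" and good: "\<And>x. x \<notin> B \<Longrightarrow> r N x \<le> exp (real N * b)"
  defines "D \<equiv> a * exp \<bar>b\<bar>"
  shows "r n x \<le> D ^ N * exp (real n * b) * D powr (\<Sum>i<n. indicator B ((T ^^ i) x))"
proof (induction n arbitrary: x rule: less_induct)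
  case (less n)
  have D1: "1 \<le> D" using a mult_mono[of 1 a 1 "exp \<bar>b\<bar>"] by (simp add: D_def)
  have cnt0: "0 \<le> (\<Sum>i<m. indicator B ((T ^^ i) y) :: real)" for m y
    by (intro sum_nonneg) auto
  \<comment> \<open>D absorbs both losses against the ideal rate exp b: a final piece shorter than N
    costs at most \<open>D ^ N\<close>, and each one-step jump from a point of B at most one factor
    D.\<close>
  consider "n < N" | "n \<ge> N" "x \<in> B" | "n \<ge> N" "x \<notin> B" by linarith
  then show ?case
  proof cases
    case 1
    have "r n x \<le> a ^ n" by (rule bnd)
    also have "\<dots> = D ^ n * exp (- (real n * \<bar>b\<bar>))"
      by (simp add: D_def power_mult_distrib exp_of_nat_mult[symmetric] exp_minus)
    also have "\<dots> \<le> D ^ N * exp (real n * b)"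
    proof (intro mult_mono)
      show "D ^ n \<le> D ^ N" using D1 1 by (intro power_increasing) auto
      have "real n * (- \<bar>b\<bar>) \<le> real n * b" by (intro mult_left_mono) auto
      then show "exp (- (real n * \<bar>b\<bar>)) \<le> exp (real n * b)" by simp
    qed (use D1 in auto)
    also have "\<dots> * 1 \<le> D ^ N * exp (real n * b) * D powr (\<Sum>i<n. indicator B ((T ^^ i) x))"
      using D1 cnt0[where m=n and y=x] by (intro mult_left_mono) (auto intro: ge_one_powr_ge_zero)
    finally show ?thesis by simp
  next
    case 2
    then obtain m where m: "n = Suc m" using N by (cases n) auto
    let ?s = "\<Sum>i<m. indicator B ((T ^^ i) (T x)) :: real"
    have "r n x \<le> r m (T x) * r 1 x" using sub[of 1 m x] m by simp
    also have "\<dots> \<le> (D ^ N * exp (real m * b) * D powr ?s) * a"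
      using less[of m "T x"] m bnd[of 1 x] D1
      by (intro mult_mono) (auto intro!: nonneg mult_nonneg_nonneg)
    also have "\<dots> \<le> (D ^ N * exp (real m * b) * D powr ?s) * (exp b * D)"
    proof (intro mult_left_mono)
      have "a * 1 \<le> a * exp (b + \<bar>b\<bar>)" using a by (intro mult_left_mono) auto
      then show "a \<le> exp b * D" by (simp add: D_def exp_add mult_ac)
    qed (use D1 in auto)
    also have "\<dots> = D ^ N * exp (real n * b) * D powr (?s + 1)"
      using D1 by (simp add: m powr_add exp_add algebra_simps)
    also have "?s + 1 = (\<Sum>i<n. indicator B ((T ^^ i) x))"
      unfolding m sum.lessThan_Suc_shift using 2 by (simp add: funpow_swap1)
    finally show ?thesis .
  next
    case 3
    let ?s = "\<Sum>i<n-N. indicator B ((T ^^ i) ((T ^^ N) x)) :: real"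
    have "r n x \<le> r (n - N) ((T ^^ N) x) * r N x" using sub[of N "n - N" x] 3 by simp
    also have "\<dots> \<le> (D ^ N * exp (real (n - N) * b) * D powr ?s) * exp (real N * b)"
      using less[of "n - N" "(T ^^ N) x"] N 3 good[of x] D1
      by (intro mult_mono) (auto intro!: nonneg mult_nonneg_nonneg)
    also have "\<dots> = D ^ N * exp (real n * b) * D powr ?s"
      using 3 by (simp add: exp_add[symmetric] of_nat_diff algebra_simps)
    also have "\<dots> \<le> D ^ N * exp (real n * b) * D powr (\<Sum>i<n. indicator B ((T ^^ i) x))"
    proof (intro mult_left_mono powr_mono)
      have "?s = (\<Sum>i\<in>{N..<n}. indicator B ((T ^^ i) x))"
        by (rule sum.reindex_bij_witness[of _ "\<lambda>i. i - N" "\<lambda>i. i + N"])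
           (auto simp: funpow_add)
      also have "\<dots> \<le> (\<Sum>i<n. indicator B ((T ^^ i) x))"
        by (intro sum_mono2) auto
      finally show "?s \<le> (\<Sum>i<n. indicator B ((T ^^ i) x))" .
    qed (use D1 in auto)
    finally show ?thesis .
  qed
qed

text \<open>Growth is known from a fixed starting point, but is wanted from
  \<open>(S ^^ n) x\<close>, whose constant may deteriorate with n. Every point eventually leaves
  the sets B n, so their measures tend to 0. Choose N with B N small, bound the visits by
  \<open>maximal_frequency\<close>, and feed the count into
  \<open>submultiplicative_block_bound\<close>.\<close>

lemma (in prob_space) submultiplicative_transfer:
  fixes r :: "nat \<Rightarrow> 'a \<Rightarrow> real"
  assumes S: "S \<in> M \<rightarrow>\<^sub>M M" "distr M M S = M" and TS: "\<And>x. T (S x) = x"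
    and space: "space M = UNIV"
    and rm[measurable]: "\<And>n. r n \<in> borel_measurable M"
    and nonneg: "\<And>n x. 0 \<le> r n x"
    and sub: "\<And>m n x. r (m + n) x \<le> r n ((T ^^ m) x) * r m x"
    and bnd: "\<And>n x. r n x \<le> a ^ n" and a: "1 \<le> a"
    and growth: "\<And>x. \<exists>C. \<forall>n. r n x \<le> C * exp (real n * b)" and \<epsilon>: "\<epsilon> > 0"
  shows "AE x in M. \<exists>C. \<forall>n. r n ((S ^^ n) x) \<le> C * exp (real n * (b + \<epsilon>))"
proof -
  \<comment> \<open>Half of \<epsilon> separates b1 from b, which forces the measure of B n to 0;
    the other half pays for the visits to B N.\<close>
  define b1 where "b1 = b + \<epsilon> / 2"
  define D where "D = a * exp \<bar>b1\<bar>"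
  have D1: "1 \<le> D" using a mult_mono[of 1 a 1 "exp \<bar>b1\<bar>"] by (simp add: D_def)
  \<comment> \<open>The admissible frequency of visits: c n visits cost
    \<open>D powr (c * n)\<close>, at most exp (n \<epsilon>/2). The summand 1 keeps the denominator
    positive when D = 1.\<close>
  define c where "c = (\<epsilon> / 2) / (ln D + 1)"
  have c: "c > 0" using \<epsilon> D1 by (simp add: c_def add_nonneg_pos)
  have cD: "c * ln D \<le> \<epsilon> / 2"
    using \<epsilon> D1 by (simp add: c_def divide_simps add_nonneg_pos)
  define B where "B n = {x\<in>space M. r n x > exp (real n * b1)}" for n
  have [measurable]: "B n \<in> sets M" for n unfolding B_def by measurable
  have "(\<lambda>n. \<integral>x. indicator (B n) x \<partial>M) \<longlonglongrightarrow> (\<integral>x. (0::real) \<partial>M)"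
  proof (rule integral_dominated_convergence[where w="\<lambda>_. 1"])
    show "AE x in M. (\<lambda>n. indicator (B n) x :: real) \<longlonglongrightarrow> 0"
    proof (rule AE_I2)
      fix x
      obtain C where C: "\<And>n. r n x \<le> C * exp (real n * b)" using growth by blast
      have "filterlim (\<lambda>n. exp (real n * (\<epsilon>/2))) at_top sequentially"
        using \<epsilon> by (intro filterlim_compose[OF exp_at_top]
          filterlim_at_top_mult_tendsto_pos[OF tendsto_const] filterlim_real_sequentially) auto
      then have "\<forall>\<^sub>F n in sequentially. C \<le> exp (real n * (\<epsilon>/2))"
        by (simp add: filterlim_at_top)
      then have "\<forall>\<^sub>F n in sequentially. x \<notin> B n"
      proof eventually_elim
        case (elim n)
        have "C * exp (real n * b) \<le> exp (real n * (\<epsilon>/2)) * exp (real n * b)"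
          using elim by (intro mult_right_mono) auto
        also have "\<dots> = exp (real n * b1)" by (simp add: b1_def exp_add[symmetric] algebra_simps)
        finally show ?case using C[of n] by (auto simp: B_def)
      qed
      then show "(\<lambda>n. indicator (B n) x :: real) \<longlonglongrightarrow> 0"
        by (intro tendsto_eventually) (auto elim: eventually_mono)
    qed
  qed (auto simp: indicator_def)
  then have Blim: "(\<lambda>n. prob (B n)) \<longlonglongrightarrow> 0" by simp
  have ex: "\<exists>D\<in>sets M. prob D \<le> \<eta> \<and>
      (\<forall>x\<in>space M - D. \<exists>C. \<forall>n. r n ((S ^^ n) x) \<le> C * exp (real n * (b + \<epsilon>)))"
    if \<eta>: "\<eta> > 0" for \<eta>
  proof -
    have "\<forall>\<^sub>F n in sequentially. prob (B n) < c * \<eta> \<and> n \<ge> 1"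
      using order_tendstoD(2)[OF Blim, of "c * \<eta>"] c \<eta> eventually_ge_at_top[of 1]
      by (auto simp: eventually_conj_iff)
    then obtain N where N: "prob (B N) < c * \<eta>" "N \<ge> 1"
      by (auto simp: eventually_sequentially)
    obtain Z where Z: "Z \<in> sets M" "prob Z \<le> prob (B N) / c"
      and freq: "\<And>x n. x \<in> space M - Z \<Longrightarrow>
        (\<Sum>i<n. indicator (B N) ((S ^^ Suc i) x)) \<le> c * real n"
      using maximal_frequency[OF S _ c, of "B N"] by auto
    have "\<exists>C. \<forall>n. r n ((S ^^ n) x) \<le> C * exp (real n * (b + \<epsilon>))" if x: "x \<in> space M - Z" for x
    proof (intro exI allI)
      fix n
      \<comment> \<open>T retraces the orbit of S, so the segment of length n starting at
        \<open>(S ^^ n) x\<close> passes through the S-iterates of x with indices n down to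
        1.\<close>
      have TSn: "(T ^^ i) ((S ^^ n) x) = (S ^^ (n - i)) x" if "i \<le> n" for i
        using that
      proof (induction i)
        case (Suc i)
        then have "(T ^^ Suc i) ((S ^^ n) x) = T ((S ^^ (n - i)) x)" by simp
        also have "n - i = Suc (n - Suc i)" using Suc by simp
        finally show ?case by (simp add: TS)
      qed simp
      have "(\<Sum>i<n. indicator (B N) ((T ^^ i) ((S ^^ n) x)) :: real)
          = (\<Sum>i<n. indicator (B N) ((S ^^ Suc (n - Suc i)) x))"
        by (intro sum.cong refl) (simp add: TSn Suc_diff_Suc del: funpow.simps)
      also have "\<dots> = (\<Sum>i<n. indicator (B N) ((S ^^ Suc i) x))"
        by (rule sum.nat_diff_reindex)
      also have "\<dots> \<le> c * real n" by (rule freq[OF x])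
      finally have cnt: "(\<Sum>i<n. indicator (B N) ((T ^^ i) ((S ^^ n) x)) :: real) \<le> c * real n" .
      have "r n ((S ^^ n) x) \<le> D ^ N * exp (real n * b1) *
          D powr (\<Sum>i<n. indicator (B N) ((T ^^ i) ((S ^^ n) x)))"
        unfolding D_def
        by (rule submultiplicative_block_bound[OF nonneg sub bnd a N(2)])
           (auto simp: B_def space not_less)
      also have "\<dots> \<le> D ^ N * exp (real n * b1) * exp (real n * (\<epsilon> / 2))"
      proof (intro mult_left_mono)
        have "D powr (\<Sum>i<n. indicator (B N) ((T ^^ i) ((S ^^ n) x))) \<le> D powr (c * real n)"
          using cnt D1 by (intro powr_mono) auto
        also have "\<dots> = exp (real n * (c * ln D))" using D1 by (simp add: powr_def mult_ac)
        also have "\<dots> \<le> exp (real n * (\<epsilon> / 2))" unfolding exp_le_cancel_iff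
          by (intro mult_left_mono cD) auto
        finally show "D powr (\<Sum>i<n. indicator (B N) ((T ^^ i) ((S ^^ n) x))) \<le> exp (real n * (\<epsilon> / 2))" .
      qed (use D1 in auto)
      also have "\<dots> = D ^ N * exp (real n * (b + \<epsilon>))"
        by (simp add: b1_def exp_add[symmetric] algebra_simps)
      finally show "r n ((S ^^ n) x) \<le> D ^ N * exp (real n * (b + \<epsilon>))" .
    qed
    moreover have "prob Z \<le> \<eta>" using Z(2) N(1) c by (intro order_trans[OF Z(2)]) (simp add: divide_le_eq mult.commute less_imp_le)
    ultimately show ?thesis using Z(1) by blast
  qed
  have "\<forall>j. \<exists>Z. Z \<in> sets M \<and> prob Z \<le> 1 / real (Suc j) \<and>
      (\<forall>x\<in>space M - Z. \<exists>C. \<forall>n. r n ((S ^^ n) x) \<le> C * exp (real n * (b + \<epsilon>)))"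
    using ex[of "1 / real (Suc _)"] by (metis of_nat_0_less_iff zero_less_Suc zero_less_divide_1_iff)
  then obtain Z where Z: "\<And>j. Z j \<in> sets M" "\<And>j. prob (Z j) \<le> 1 / real (Suc j)"
    "\<And>j x. x \<in> space M - Z j \<Longrightarrow> \<exists>C. \<forall>n. r n ((S ^^ n) x) \<le> C * exp (real n * (b + \<epsilon>))"
    by metis
  show ?thesis
  proof (rule AE_I')
    have "prob (\<Inter>j. Z j) \<le> 1 / real (Suc j)" for j
      using finite_measure_mono[of "\<Inter>j. Z j" "Z j"] Z(1) Z(2)[of j] by fastforce
    then have "prob (\<Inter>j. Z j) \<le> 0"
      by (intro LIMSEQ_le_const[OF LIMSEQ_Suc[OF lim_1_over_n]]) auto
    then have "prob (\<Inter>j. Z j) = 0" by (simp add: measure_le_0_iff)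
    then show "(\<Inter>j. Z j) \<in> null_sets M"
      using Z(1) by (auto simp: null_sets_def emeasure_eq_measure)
    show "{x\<in>space M. \<not> (\<exists>C. \<forall>n. r n ((S ^^ n) x) \<le> C * exp (real n * (b + \<epsilon>)))} \<subseteq> (\<Inter>j. Z j)"
      using Z(3) by blast
  qed
qed

section \<open>Measurability and regularity\<close>

lemma compact_imp_countable_dense:
  assumes "compact (UNIV :: 'x::metric_space set)"
  shows "\<exists>D::'x set. countable D \<and> (\<forall>x. \<forall>e>0. \<exists>q\<in>D. dist x q < e)"
proof -
  have "\<forall>n. \<exists>k. finite k \<and> (UNIV::'x set) \<subseteq> (\<Union>x\<in>k. ball x (1 / real (Suc n)))"
    using compact_imp_seq_compact[OF assms] seq_compact_imp_totally_bounded by fastforce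
  then obtain k where k: "\<And>n. finite (k n)" "\<And>n. (UNIV::'x set) \<subseteq> (\<Union>x\<in>k n. ball x (1 / real (Suc n)))"
    by metis
  show ?thesis
  proof (intro exI conjI allI impI)
    show "countable (\<Union>n. k n)" using k(1) by (auto intro: countable_finite)
    fix x :: 'x and e :: real assume "e > 0"
    then obtain n where n: "1 / real (Suc n) < e" using nat_approx_posE by auto
    have "x \<in> (\<Union>y\<in>k n. ball y (1 / real (Suc n)))" using k(2) by blast
    then obtain q where "q \<in> k n" "dist q x < 1 / real (Suc n)" by (auto simp del: of_nat_Suc)
    then show "\<exists>q\<in>\<Union>n. k n. dist x q < e" using n by (intro bexI[of _ q]) (auto simp: dist_commute)
  qed
qed

text \<open>Induction over the generated sigma-algebra. Approximating from inside and outside at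
  once makes the complement case a mere exchange of the two sets.\<close>

lemma borel_closed_open_approximation:
  fixes M :: "'x::metric_space measure"
  assumes "finite_measure M" and sM: "sets M = sets borel" and A: "A \<in> sets M" and "e > 0"
  shows "\<exists>K U. closed K \<and> open U \<and> K \<subseteq> A \<and> A \<subseteq> U \<and> measure M (U - K) < e"
proof -
  interpret finite_measure M by fact
  have meas[measurable, simp]: "open S \<Longrightarrow> S \<in> sets M" "closed S \<Longrightarrow> S \<in> sets M" for S by (auto simp: sM)
  have "A \<in> sigma_sets UNIV {S. open S}" using A sM by (simp add: borel_def)
  then show ?thesis using \<open>e > 0\<close>
  proof (induction arbitrary: e)
    case (Basic A)
    then have oA: "open A" by simp
    \<comment> \<open>The whole space is treated apart because \<open>infdist x {} = 0\<close> would
      make every K n below empty.\<close>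
    show ?case
    proof (cases "A = UNIV")
      case True then show ?thesis using Basic by (intro exI[of _ UNIV]) auto
    next
      case False
      define K where "K n = {x. 1 / real (Suc n) \<le> infdist x (- A)}" for n
      have cK: "closed (K n)" for n
        unfolding K_def by (intro closed_Collect_le continuous_intros)
      have KA: "K n \<subseteq> A" for n
      proof
        fix x assume "x \<in> K n"
        then have "infdist x (- A) > 0" by (auto simp: K_def intro: less_le_trans[rotated])
        then show "x \<in> A" by (metis ComplI infdist_zero less_irrefl)
      qed
      have "A \<subseteq> (\<Union>n. K n)"
      proof
        fix x assume "x \<in> A"
        then have "infdist x (- A) > 0"
          using in_closed_iff_infdist_zero[of "- A" x] oA False infdist_nonneg[of x "- A"]
          by (auto simp: less_le)
        then obtain n where "1 / real (Suc n) < infdist x (- A)" using nat_approx_posE by auto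
        then show "x \<in> (\<Union>n. K n)"  unfolding K_def using less_imp_le by blast
      qed
      then have un: "(\<Union>n. K n) = A" using KA by auto
      have "K m \<subseteq> K n" if "m \<le> n" for m n
      proof -
        have "1 / real (Suc n) \<le> 1 / real (Suc m)" using that by (simp add: frac_le)
        then show ?thesis unfolding K_def by (auto simp del: of_nat_Suc)
      qed
      then have "incseq K" by (simp add: incseq_def)
      then have "(\<lambda>n. measure M (K n)) \<longlonglongrightarrow> measure M A"
        unfolding un[symmetric] using cK by (intro finite_Lim_measure_incseq) auto
      then have "\<forall>\<^sub>F n in sequentially. measure M A - e < measure M (K n)"
        using Basic(2) by (intro order_tendstoD(1)) auto
      then obtain n where n: "measure M A - e < measure M (K n)"
        by (auto simp: eventually_sequentially)
      have "measure M (A - K n) = measure M A - measure M (K n)"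
        using KA oA cK by (intro finite_measure_Diff) auto
      with n show ?thesis using KA cK oA by - (rule exI[of _ "K n"], rule exI[of _ A], auto)
    qed
  next
    case Empty
    then show ?case by (intro exI[of _ "{}"]) auto
  next
    case (Compl A)
    obtain K U where *: "closed K" "open U" "K \<subseteq> A" "A \<subseteq> U" "measure M (U - K) < e"
      using Compl.IH[OF Compl.prems] by blast
    moreover have "- K - - U = U - K" by auto
    ultimately show ?case
      by - (rule exI[of _ "- U"], rule exI[of _ "- K"], auto)
  next
    case (Union A)
    have "\<forall>i. \<exists>K U. closed K \<and> open U \<and> K \<subseteq> A i \<and> A i \<subseteq> U \<and> measure M (U - K) < e / 2 * (1/2) ^ Suc i"
      using Union.prems by (intro allI Union.IH) simp
    then obtain K U where KU: "\<And>i. closed (K i)" "\<And>i. open (U i)" "\<And>i. K i \<subseteq> A i" "\<And>i. A i \<subseteq> U i"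
      "\<And>i. measure M (U i - K i) < e / 2 * (1/2) ^ Suc i" by metis
    have [measurable]: "K i \<in> sets M" "U i \<in> sets M" for i using KU by auto
    \<comment> \<open>Only finitely many of the closed sets can be united without losing closedness.
      Truncating the union costs half of e; the other half is shared geometrically among the
      individual approximations.\<close>
    have "(\<lambda>n. measure M (\<Union>i<n. K i)) \<longlonglongrightarrow> measure M (\<Union>n. \<Union>i<n. K i)"
    proof (rule finite_Lim_measure_incseq)
      show "incseq (\<lambda>n. \<Union>i<n. K i)" unfolding incseq_def by (intro allI impI UN_mono) auto
    qed auto
    moreover have "(\<Union>n. \<Union>i<n. K i) = (\<Union>i. K i)" by auto
    ultimately have "\<forall>\<^sub>F n in sequentially. measure M (\<Union>i. K i) - e / 2 < measure M (\<Union>i<n. K i)"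
      using Union.prems by (intro order_tendstoD(1)) auto
    then obtain n where n: "measure M (\<Union>i. K i) - e / 2 < measure M (\<Union>i<n. K i)"
      by (auto simp: eventually_sequentially)
    have sums: "(\<lambda>i. e / 2 * (1/2) ^ Suc i) sums (e / 2 * 1)"
      by (intro sums_mult power_half_series)
    have summ: "summable (\<lambda>i. measure M (U i - K i))"
    proof (rule summable_comparison_test'[OF sums_summable[OF sums], of 0])
      show "norm (measure M (U n - K n)) \<le> e / 2 * (1/2) ^ Suc n" for n
        using KU(5)[of n] by simp
    qed
    have "measure M ((\<Union>i. U i) - (\<Union>i. K i)) \<le> measure M (\<Union>i. U i - K i)"
      by (intro finite_measure_mono) auto
    also have "\<dots> \<le> (\<Sum>i. measure M (U i - K i))"
      using summ by (intro finite_measure_subadditive_countably) auto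
    also have "\<dots> \<le> (\<Sum>i. e / 2 * (1/2) ^ Suc i)"
      by (intro suminf_le summ sums_summable[OF sums] less_imp_le KU(5))
    also have "\<dots> = e / 2" using sums_unique[OF sums] by simp
    finally have 1: "measure M ((\<Union>i. U i) - (\<Union>i. K i)) \<le> e / 2" .
    have 2: "measure M ((\<Union>i. K i) - (\<Union>i<n. K i)) < e / 2"
      using n by (subst finite_measure_Diff) auto
    have "measure M ((\<Union>i. U i) - (\<Union>i<n. K i)) \<le>
        measure M (((\<Union>i. U i) - (\<Union>i. K i)) \<union> ((\<Union>i. K i) - (\<Union>i<n. K i)))"
      by (intro finite_measure_mono) auto
    also have "\<dots> \<le> measure M ((\<Union>i. U i) - (\<Union>i. K i)) + measure M ((\<Union>i. K i) - (\<Union>i<n. K i))"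
      by (intro measure_Un_le) auto
    also have "\<dots> < e" using 1 2 by simp
    finally have "measure M ((\<Union>i. U i) - (\<Union>i<n. K i)) < e" .
    moreover have "(\<Union>i<n. K i) \<subseteq> (\<Union>i. A i)" "(\<Union>i. A i) \<subseteq> (\<Union>i. U i)" using KU(3,4) by blast+
    moreover have "closed (\<Union>i<n. K i)" "open (\<Union>i. U i)" using KU(1,2) by auto
    ultimately show ?case
      by - (rule exI[of _ "\<Union>i<n. K i"], rule exI[of _ "\<Union>i. U i"], intro conjI, auto)
  qed
qed

section \<open>Restricted operator norms and their measurable dependence on the subspace\<close>

lemma restricted_norm_bdd: "bdd_above ((\<lambda>v. norm (blinfun_apply T v)) ` (V \<inter> cball 0 1))"
proof (rule bdd_aboveI2)
  fix v assume "v \<in> V \<inter> cball 0 1"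
  then have "norm T * norm v \<le> norm T * 1" by (intro mult_left_mono) auto
  then show "norm (blinfun_apply T v) \<le> norm T" using norm_blinfun[of T v] by simp
qed

lemma restricted_norm_nonneg: "0 \<in> V \<Longrightarrow> 0 \<le> restricted_norm T V"
  unfolding restricted_norm_def by (rule cSUP_upper2[OF restricted_norm_bdd, of 0]) auto

lemma restricted_norm_upper:
  assumes "subspace V" "v \<in> V"
  shows "norm (blinfun_apply T v) \<le> restricted_norm T V * norm v"
proof (cases "v = 0")
  case False
  have "norm (blinfun_apply T (v /\<^sub>R norm v)) \<le> restricted_norm T V"
    unfolding restricted_norm_def
    using assms False by (intro cSUP_upper restricted_norm_bdd) (auto intro: subspace_scale)
  then show ?thesis using False by (simp add: blinfun.scaleR_right divide_simps)
qed simp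

lemma restricted_norm_least:
  assumes "0 \<in> V" "\<And>v. v \<in> V \<Longrightarrow> norm (blinfun_apply T v) \<le> c * norm v" "0 \<le> c"
  shows "restricted_norm T V \<le> c"
  unfolding restricted_norm_def
proof (rule cSUP_least)
  fix v assume "v \<in> V \<inter> cball 0 1"
  then have "norm (blinfun_apply T v) \<le> c * norm v" "c * norm v \<le> c * 1"
    using assms by (auto intro!: mult_left_mono simp del: mult_1_right)
  then show "norm (blinfun_apply T v) \<le> c" by simp
qed (use assms in auto)

lemma restricted_norm_le_norm: "0 \<in> V \<Longrightarrow> restricted_norm T V \<le> norm T"
  by (intro restricted_norm_least norm_blinfun) auto

lemma restricted_norm_compose:
  assumes "subspace V" "subspace W" "blinfun_apply T ` V \<subseteq> W"
  shows "restricted_norm (S o\<^sub>L T) V \<le> restricted_norm S W * restricted_norm T V"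
proof (rule restricted_norm_least)
  fix v assume v: "v \<in> V"
  have "norm (blinfun_apply (S o\<^sub>L T) v) \<le> restricted_norm S W * norm (blinfun_apply T v)"
    using assms v restricted_norm_upper[of W "blinfun_apply T v" S] by (auto simp: image_subset_iff)
  also have "\<dots> \<le> restricted_norm S W * (restricted_norm T V * norm v)"
    using assms v by (intro mult_left_mono restricted_norm_upper restricted_norm_nonneg) (auto intro: subspace_0)
  finally show "norm (blinfun_apply (S o\<^sub>L T) v) \<le> restricted_norm S W * restricted_norm T V * norm v"
    by (simp add: mult_ac)
qed (use assms in \<open>auto intro!: mult_nonneg_nonneg restricted_norm_nonneg intro: subspace_0\<close>)

lemma restricted_norm_diff:
  assumes V: "subspace V"
  shows "restricted_norm T V \<le> restricted_norm S V + norm (T - S)"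
proof (rule restricted_norm_least)
  fix v assume v: "v \<in> V"
  have "blinfun_apply T v = blinfun_apply S v + blinfun_apply (T - S) v" by (simp add: blinfun.diff_left)
  then have "norm (blinfun_apply T v) \<le> norm (blinfun_apply S v) + norm (blinfun_apply (T - S) v)"
    by (metis norm_triangle_ineq)
  also have "\<dots> \<le> restricted_norm S V * norm v + norm (T - S) * norm v"
    using V v by (intro add_mono restricted_norm_upper norm_blinfun)
  finally show "norm (blinfun_apply T v) \<le> (restricted_norm S V + norm (T - S)) * norm v"
    by (simp add: algebra_simps)
qed (use V in \<open>auto intro!: add_nonneg_nonneg restricted_norm_nonneg intro: subspace_0\<close>)

lemma unit_sphere_nonempty:
  assumes "subspace V" "V \<noteq> {0}"
  shows "unit_sphere V \<noteq> {}"
proof -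
  obtain v where "v \<in> V" "v \<noteq> 0" using assms subspace_0 by blast
  then have "v /\<^sub>R norm v \<in> unit_sphere V" using assms by (auto simp: unit_sphere_def subspace_scale)
  then show ?thesis by auto
qed

lemma hat_d_less_imp_close:
  assumes W: "subspace W" "W \<noteq> {0}" and d: "hat_d V W < e" and v: "v \<in> unit_sphere V"
  shows "\<exists>w\<in>unit_sphere W. dist v w < e"
proof -
  obtain w0 where w0: "w0 \<in> unit_sphere W" using unit_sphere_nonempty[OF W] by auto
  have "bdd_above ((\<lambda>v. infdist v (unit_sphere W)) ` unit_sphere V)"
  proof (rule bdd_aboveI2)
    fix v assume "v \<in> unit_sphere V"
    then have "dist v w0 \<le> 2"
      using w0 norm_triangle_ineq4[of v w0] by (auto simp: unit_sphere_def dist_norm)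
    then show "infdist v (unit_sphere W) \<le> 2" using infdist_le2[OF w0] by auto
  qed
  then have "infdist v (unit_sphere W) \<le> (SUP v\<in>unit_sphere V. infdist v (unit_sphere W))"
    using v by (intro cSUP_upper)
  also have "\<dots> < e" using d by (simp add: hat_d_def)
  finally have "(INF w\<in>unit_sphere W. dist v w) < e" using w0 by (auto simp: infdist_def split: if_splits)
  then show ?thesis using w0 by (subst (asm) cINF_less_iff) auto
qed

lemma space_grassmannian_borel: "space grassmannian_borel = grassmannian"
  by (simp add: grassmannian_borel_def space_measure_of_conv)

lemma grassmannian_open_in_sets: "grassmannian_open U \<Longrightarrow> U \<in> sets grassmannian_borel"
  unfolding grassmannian_borel_def by (auto simp: grassmannian_open_def intro!: in_measure_of)

text \<open>Lower semicontinuity: a unit vector of V that T stretches beyond r has a unit vector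
  close to it in every W near V, so superlevel sets are open.\<close>

lemma restricted_norm_measurable: "restricted_norm T \<in> borel_measurable grassmannian_borel"
proof (rule borel_measurableI_greater)
  fix r
  have "grassmannian_open {V\<in>grassmannian. r < restricted_norm T V}"
    unfolding grassmannian_open_def
  proof (intro conjI ballI)
    fix V assume "V \<in> {V\<in>grassmannian. r < restricted_norm T V}"
    then have V: "subspace V" "r < restricted_norm T V" by (auto simp: grassmannian_def)
    show "\<exists>e>0. \<forall>W\<in>grassmannian. hat_d V W < e \<longrightarrow> W \<in> {V\<in>grassmannian. r < restricted_norm T V}"
    proof (cases "r < 0")
      case True
      then show ?thesis
        by (intro exI[of _ 1]) (auto simp: grassmannian_def intro!: less_le_trans[OF _ restricted_norm_nonneg] intro: subspace_0)
    next
      case False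
      obtain v where v: "v \<in> V" "norm v \<le> 1" "r < norm (blinfun_apply T v)"
        using V(2) V(1)[THEN subspace_0] unfolding restricted_norm_def
        by (subst (asm) less_cSUP_iff[OF _ restricted_norm_bdd]) auto
      define u where "u = v /\<^sub>R norm v"
      have v0: "v \<noteq> 0" using v False by auto
      have u: "u \<in> unit_sphere V" using V v v0 by (auto simp: u_def unit_sphere_def subspace_scale)
      have "norm (blinfun_apply T v) * 1 \<le> norm (blinfun_apply T v) * inverse (norm v)"
        using v v0 by (intro mult_left_mono) (auto simp: one_le_inverse)
      then have Tu: "r < norm (blinfun_apply T u)" using v by (simp add: u_def blinfun.scaleR_right mult.commute)
      \<comment> \<open>A radius for which the loss \<open>norm T * e\<close> stays below the slack
        of u; the summand 1 covers T = 0.\<close>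
      define e where "e = (norm (blinfun_apply T u) - r) / (norm T + 1)"
      have n1: "norm T + 1 > 0" using norm_ge_zero[of T] by linarith
      have e: "e > 0" using Tu n1 by (simp add: e_def)
      show ?thesis
      proof (intro exI[of _ e] conjI ballI impI e)
        fix W assume W: "W \<in> grassmannian" "hat_d V W < e"
        obtain w where w: "w \<in> unit_sphere W" "dist u w < e"
          using hat_d_less_imp_close[of W V e u] W u by (auto simp: grassmannian_def)
        have "norm (blinfun_apply T u) - norm (blinfun_apply T w) \<le> norm (blinfun_apply T (u - w))"
          using norm_triangle_ineq2 by (auto simp: blinfun.diff_right)
        also have "\<dots> \<le> norm T * norm (u - w)" by (rule norm_blinfun)
        also have "\<dots> \<le> norm T * e" using w by (intro mult_left_mono) (auto simp: dist_norm)
        also have "\<dots> < (norm T + 1) * e" using e by simp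
        also have "\<dots> = norm (blinfun_apply T u) - r" using n1 by (simp add: e_def)
        finally have "r < norm (blinfun_apply T w)" by simp
        also have "\<dots> \<le> restricted_norm T W"
          using restricted_norm_upper[of W w T] W w by (auto simp: grassmannian_def unit_sphere_def)
        finally show "W \<in> {V\<in>grassmannian. r < restricted_norm T V}" using W by auto
      qed
    qed
  qed auto
  then show "{V\<in>space grassmannian_borel. r < restricted_norm T V} \<in> sets grassmannian_borel"
    by (simp add: grassmannian_open_in_sets space_grassmannian_borel)
qed

text \<open>For a fixed operator this is \<open>restricted_norm_measurable\<close>. The varying
  operator is reduced to the countably many \<Phi> q with q in a dense subset of X, because the
  restricted norm is 1-Lipschitz in the operator. Thus separability is used on the base X and not in
  the operator space.\<close>

lemma restricted_norm_bundle_measurable: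
  fixes \<Phi> :: "'x::metric_space \<Rightarrow> ('b::real_normed_vector \<Rightarrow>\<^sub>L 'b)"
  assumes cpt: "compact (UNIV :: 'x set)" and sM: "sets M = sets borel"
    and X0: "X0 \<in> sets M" and G: "G \<in> restrict_space M X0 \<rightarrow>\<^sub>M grassmannian_borel"
    and \<Phi>: "continuous_on UNIV \<Phi>"
  shows "(\<lambda>x. indicator X0 x * restricted_norm (\<Phi> x) (G x)) \<in> borel_measurable M"
proof -
  let ?R = "restrict_space M X0"
  have sp: "space ?R = X0" using sets.sets_into_space[OF X0] by (auto simp: space_restrict_space)
  have sub: "subspace (G x)" if "x \<in> X0" for x
    using measurable_space[OF G, of x] that sp by (auto simp: space_grassmannian_borel grassmannian_def)
  obtain D :: "'x set" where D: "countable D" "\<And>x e. e > 0 \<Longrightarrow> \<exists>q\<in>D. dist x q < e"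
    using compact_imp_countable_dense[OF cpt] by blast
  have "(\<lambda>x. restricted_norm (\<Phi> x) (G x)) \<in> borel_measurable ?R"
  proof (rule borel_measurableI_greater)
    fix r
    \<comment> \<open>The rational s plays two roles: the allowed error in replacing \<Phi> x by
      \<Phi> q, and the surplus over r that makes up for this error.\<close>
    have "{x\<in>X0. r < restricted_norm (\<Phi> x) (G x)} = (\<Union>q\<in>D. \<Union>s\<in>\<rat> \<inter> {0<..}.
      {x\<in>X0. norm (\<Phi> x - \<Phi> q) < s} \<inter> {x\<in>X0. r + s < restricted_norm (\<Phi> q) (G x)})" (is "?L = ?U")
    proof
      show "?L \<subseteq> ?U"
      proof
        fix x assume x: "x \<in> ?L"
        then obtain s where s: "s \<in> \<rat>" "0 < s" "s < (restricted_norm (\<Phi> x) (G x) - r) / 2"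
          using Rats_dense_in_real[of 0 "(restricted_norm (\<Phi> x) (G x) - r) / 2"] by auto
        have "isCont \<Phi> x" using \<Phi> by (simp add: continuous_on_eq_continuous_at)
        then obtain d where "d > 0" and d: "\<And>q. dist q x < d \<Longrightarrow> dist (\<Phi> q) (\<Phi> x) < s"
          unfolding continuous_at_eps_delta using s by blast
        then obtain q where q: "q \<in> D" "dist x q < d" using D(2)[of d x] by auto
        then have 1: "norm (\<Phi> x - \<Phi> q) < s" using d[of q] by (simp add: dist_commute dist_norm norm_minus_commute)
        have "restricted_norm (\<Phi> x) (G x) \<le> restricted_norm (\<Phi> q) (G x) + norm (\<Phi> x - \<Phi> q)"
          using x sub by (intro restricted_norm_diff) auto
        then have "r + s < restricted_norm (\<Phi> q) (G x)" using 1 s(3) by (simp add: field_simps)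
        then show "x \<in> ?U" using q s 1 x by blast
      qed
      show "?U \<subseteq> ?L"
      proof
        fix x assume "x \<in> ?U"
        then obtain q s where *: "x \<in> X0" "norm (\<Phi> x - \<Phi> q) < s" "r + s < restricted_norm (\<Phi> q) (G x)" by auto
        have "restricted_norm (\<Phi> q) (G x) \<le> restricted_norm (\<Phi> x) (G x) + norm (\<Phi> q - \<Phi> x)"
          using * sub by (intro restricted_norm_diff) auto
        then show "x \<in> ?L" using * by (simp add: norm_minus_commute)
      qed
    qed
    moreover have "?U \<in> sets ?R"
    proof (intro sets.countable_UN'' sets.Int)
      fix q s
      have "open {x. norm (\<Phi> x - \<Phi> q) < s}"
        by (intro open_Collect_less continuous_intros \<Phi>)
      then have "{x. norm (\<Phi> x - \<Phi> q) < s} \<in> sets M" by (simp add: sM)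
      moreover have "{x\<in>X0. norm (\<Phi> x - \<Phi> q) < s} = X0 \<inter> {x. norm (\<Phi> x - \<Phi> q) < s}" by auto
      ultimately show "{x\<in>X0. norm (\<Phi> x - \<Phi> q) < s} \<in> sets ?R"
        by (auto simp: sets_restrict_space)
      have "(\<lambda>x. restricted_norm (\<Phi> q) (G x)) \<in> borel_measurable ?R"
        by (rule measurable_compose[OF G restricted_norm_measurable])
      then have "{x\<in>space ?R. r + s < restricted_norm (\<Phi> q) (G x)} \<in> sets ?R" by measurable
      then show "{x\<in>X0. r + s < restricted_norm (\<Phi> q) (G x)} \<in> sets ?R" by (simp add: sp)
    qed (use D(1) countable_rat in auto)
    ultimately show "{x\<in>space ?R. r < restricted_norm (\<Phi> x) (G x)} \<in> sets ?R" by (simp add: sp)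
  qed
  then show ?thesis using X0 sets.sets_into_space[OF X0]
    by (subst (asm) borel_measurable_restrict_space_iff) (auto simp: Int_absorb2)
qed

section \<open>Splittings with finite-dimensional summands\<close>

context
  fixes I :: "'i set" and V :: "'i \<Rightarrow> 'b::real_vector set"
  assumes fin: "finite I" and split: "direct_splitting I V"
begin

lemma splitting_proj_spec:
  "restrict (\<lambda>i. splitting_proj I V i v) I \<in> Pi\<^sub>E I V \<and> (\<Sum>i\<in>I. splitting_proj I V i v) = v"
proof -
  let ?u = "THE u. u \<in> Pi\<^sub>E I V \<and> sum u I = v"
  have "\<exists>!u. u \<in> Pi\<^sub>E I V \<and> sum u I = v" using split by (auto simp: direct_splitting_def)
  then have u: "?u \<in> Pi\<^sub>E I V" "sum ?u I = v" using theI'[of "\<lambda>u. u \<in> Pi\<^sub>E I V \<and> sum u I = v"] by blast+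
  have "restrict (\<lambda>i. splitting_proj I V i v) I = ?u"
    using u(1) by (auto simp: splitting_proj_def PiE_restrict)
  moreover have "(\<Sum>i\<in>I. splitting_proj I V i v) = sum ?u I" by (simp add: splitting_proj_def)
  ultimately show ?thesis using u by simp
qed

lemma splitting_proj_mem: "i \<in> I \<Longrightarrow> splitting_proj I V i v \<in> V i"
  using splitting_proj_spec[of v] by (auto simp: PiE_iff)

lemma sum_splitting_proj: "(\<Sum>i\<in>I. splitting_proj I V i v) = v"
  using splitting_proj_spec[of v] by auto

lemma splitting_subspace: "i \<in> I \<Longrightarrow> subspace (V i)"
  using split by (auto simp: direct_splitting_def)

lemma splitting_proj_eqI:
  assumes "\<And>i. i \<in> I \<Longrightarrow> u i \<in> V i" "sum u I = v" "i \<in> I"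
  shows "splitting_proj I V i v = u i"
proof -
  have "(THE u. u \<in> Pi\<^sub>E I V \<and> sum u I = v) = restrict u I"
    using assms split by (intro the1_equality) (auto simp: direct_splitting_def)
  then show ?thesis using assms(3) by (simp add: splitting_proj_def)
qed

lemma splitting_proj_linear: "i \<in> I \<Longrightarrow> linear (splitting_proj I V i)"
proof (rule linearI)
  fix v w c assume i: "i \<in> I"
  show "splitting_proj I V i (v + w) = splitting_proj I V i v + splitting_proj I V i w"
    by (rule splitting_proj_eqI)
      (auto simp: i sum.distrib sum_splitting_proj intro!: subspace_add splitting_subspace splitting_proj_mem)
  show "splitting_proj I V i (c *\<^sub>R v) = c *\<^sub>R splitting_proj I V i v"
    by (rule splitting_proj_eqI)
      (auto simp: i scaleR_sum_right[symmetric] sum_splitting_proj intro!: subspace_scale splitting_subspace splitting_proj_mem)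
qed

lemma splitting_proj_on:
  assumes "i \<in> I" "j \<in> I" "v \<in> V j"
  shows "splitting_proj I V i v = (if i = j then v else 0)"
  by (rule splitting_proj_eqI)
    (use assms fin splitting_subspace in \<open>auto simp: subspace_0 if_distrib cong: if_cong\<close>)

end

text \<open>The coefficient of b is bounded by the norm of the vector divided by the distance from b
  to H. Hence a convergent sequence has Cauchy coefficients, and its H-components converge as
  well.\<close>

lemma closed_span_insert:
  fixes H :: "'b::real_normed_vector set"
  assumes H: "subspace H" "closed H"
  shows "closed (span (insert b H))"
proof (cases "b \<in> H")
  case True
  then show ?thesis using H by (simp add: insert_absorb span_eq_iff[THEN iffD2])
next
  case False
  define \<delta> where "\<delta> = infdist b H"
  have \<delta>: "\<delta> > 0"
    using in_closed_iff_infdist_zero[of H b] H False infdist_nonneg[of b H] subspace_0[OF H(1)]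
    by (auto simp: \<delta>_def less_le)
  have bound: "\<bar>c\<bar> * \<delta> \<le> norm (h + c *\<^sub>R b)" if "h \<in> H" for h c
  proof (cases "c = 0")
    case False
    have "- (h /\<^sub>R c) \<in> H" using H that by (intro subspace_neg subspace_scale)
    then have "\<delta> \<le> dist b (- (h /\<^sub>R c))" unfolding \<delta>_def by (rule infdist_le)
    also have "\<dots> = norm (b + h /\<^sub>R c)" by (simp add: dist_norm)
    finally have "\<bar>c\<bar> * \<delta> \<le> \<bar>c\<bar> * norm (b + h /\<^sub>R c)" by (intro mult_left_mono) auto
    also have "\<dots> = norm (c *\<^sub>R (b + h /\<^sub>R c))" by simp
    also have "c *\<^sub>R (b + h /\<^sub>R c) = h + c *\<^sub>R b" using False by (simp add: algebra_simps)
    finally show ?thesis .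
  qed simp
  show ?thesis
    unfolding closed_sequential_limits
  proof (intro allI impI)
    fix z l assume z: "(\<forall>n. z n \<in> span (insert b H)) \<and> z \<longlonglongrightarrow> l"
    then have "\<forall>n. \<exists>c. z n - c *\<^sub>R b \<in> H" using H(1) by (simp add: span_insert span_eq_iff[THEN iffD2])
    then obtain c where c: "\<And>n. z n - c n *\<^sub>R b \<in> H" by metis
    have "\<bar>c m - c n\<bar> * \<delta> \<le> dist (z m) (z n)" for m n
    proof -
      have "(z m - c m *\<^sub>R b) - (z n - c n *\<^sub>R b) \<in> H" by (rule subspace_diff[OF H(1) c c])
      from bound[OF this, of "c m - c n"] show ?thesis by (simp add: dist_norm algebra_simps)
    qed
    then have dc: "dist (c m) (c n) \<le> dist (z m) (z n) / \<delta>" for m n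
      using \<delta> by (simp add: dist_real_def field_simps)
    have "Cauchy c"
    proof (rule metric_CauchyI)
      fix e :: real assume "e > 0"
      moreover have "Cauchy z" using z by (auto intro: LIMSEQ_imp_Cauchy)
      ultimately obtain N where "\<And>m n. m \<ge> N \<Longrightarrow> n \<ge> N \<Longrightarrow> dist (z m) (z n) < e * \<delta>"
        using metric_CauchyD[of z "e * \<delta>"] \<delta> by auto
      then show "\<exists>N. \<forall>m\<ge>N. \<forall>n\<ge>N. dist (c m) (c n) < e"
        using \<delta> by (intro exI[of _ N] allI impI le_less_trans[OF dc]) (auto simp: divide_less_eq)
    qed
    then obtain c' where "c \<longlonglongrightarrow> c'" using convergent_eq_Cauchy by blast
    then have "(\<lambda>n. z n - c n *\<^sub>R b) \<longlonglongrightarrow> l - c' *\<^sub>R b" using z by (intro tendsto_intros) auto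
    then have "l - c' *\<^sub>R b \<in> H" by (rule closed_sequentially[OF H(2) c])
    then show "l \<in> span (insert b H)" using H(1) by (auto simp: span_insert span_eq_iff[THEN iffD2])
  qed
qed

lemma closed_span_Un_finite:
  fixes H :: "'b::real_normed_vector set"
  assumes H: "subspace H" "closed H" and "finite S"
  shows "closed (span (S \<union> H))"
  using \<open>finite S\<close>
proof induction
  case empty
  then show ?case using H by (simp add: span_eq_iff[THEN iffD2])
next
  case (insert b S)
  have "span (insert b (span (S \<union> H))) = span (insert b S \<union> H)"
    by (simp add: span_insert span_span)
  then show ?case using closed_span_insert[OF subspace_span insert.IH, of b] by simp
qed

text \<open>The coordinate along a basis vector \<open>b\<close> is bounded by the distance from \<open>b\<close> to the closed span
  of \<open>H\<close> and the other basis vectors.\<close>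

lemma coordinates_bounded:
  fixes H :: "'b::real_normed_vector set"
  assumes H: "subspace H" "closed H" and S: "finite S" "independent S" "span S \<inter> H = {0}"
  shows "\<exists>C\<ge>0. \<forall>h\<in>H. \<forall>c. \<forall>b\<in>S. \<bar>c b\<bar> \<le> C * norm ((\<Sum>b\<in>S. c b *\<^sub>R b) + h)"
proof -
  define K where "K b = span ((S - {b}) \<union> H)" for b
  define \<delta> where "\<delta> b = infdist b (K b)" for b
  have \<delta>: "\<delta> b > 0" if b: "b \<in> S" for b
  proof -
    have "b \<notin> K b"
    proof
      assume "b \<in> K b"
      then obtain s h where sh: "s \<in> span (S - {b})" "h \<in> H" "b = s + h"
        using H(1) by (auto simp: K_def span_Un span_eq_iff[THEN iffD2])
      then have "h \<in> span S" using b span_diff[of b S s] span_base[of b S] span_mono[of "S - {b}" S] by auto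
      then have "h = 0" using sh S(3) by auto
      then show False using sh S(2) b dependent_def by auto
    qed
    moreover have "closed (K b)" "K b \<noteq> {}" unfolding K_def using closed_span_Un_finite[OF H] S(1) span_zero by auto
    ultimately show ?thesis
      using in_closed_iff_infdist_zero[of "K b" b] infdist_nonneg[of b "K b"] by (auto simp: \<delta>_def less_le)
  qed
  have bound: "\<bar>c b\<bar> \<le> 1 / \<delta> b * norm ((\<Sum>b\<in>S. c b *\<^sub>R b) + h)" if b: "b \<in> S" and h: "h \<in> H" for b h c
  proof (cases "c b = 0")
    case True
    then show ?thesis using \<delta>[OF b] by (simp add: less_imp_le)
  next
    case False
    define w where "w = (\<Sum>b\<in>S - {b}. c b *\<^sub>R b) + h"
    have w: "w \<in> K b"
      unfolding w_def K_def using h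
      by (intro span_add span_sum span_scale) (auto intro: span_base)
    have eq: "(\<Sum>b\<in>S. c b *\<^sub>R b) + h = c b *\<^sub>R (b - (- (w /\<^sub>R c b)))"
      using False b S(1) by (simp add: w_def sum.remove[of S b] scaleR_diff_right scaleR_add_right)
    have "- (w /\<^sub>R c b) \<in> K b" using w unfolding K_def by (intro span_neg span_scale)
    then have "\<delta> b \<le> norm (b - (- (w /\<^sub>R c b)))" unfolding \<delta>_def by (metis infdist_le dist_norm)
    then have "\<bar>c b\<bar> * \<delta> b \<le> norm ((\<Sum>b\<in>S. c b *\<^sub>R b) + h)" unfolding eq norm_scaleR by (intro mult_left_mono) auto
    then show ?thesis using \<delta>[OF b] by (simp add: field_simps)
  qed
  show ?thesis
  proof (intro exI conjI ballI allI)
    show "0 \<le> (\<Sum>b\<in>S. 1 / \<delta> b)" using \<delta> by (intro sum_nonneg) (auto intro: less_imp_le)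
    fix h c b assume h: "h \<in> H" and b: "b \<in> S"
    have "1 / \<delta> b \<le> (\<Sum>b\<in>S. 1 / \<delta> b)" using \<delta> b S(1) by (intro member_le_sum) (auto intro: less_imp_le)
    then show "\<bar>c b\<bar> \<le> (\<Sum>b\<in>S. 1 / \<delta> b) * norm ((\<Sum>b\<in>S. c b *\<^sub>R b) + h)"
      by (intro order_trans[OF bound[OF b h]] mult_right_mono) auto
  qed
qed

text \<open>One constant serves all operators \<open>T\<close>: the whole forward orbit is controlled through its values
  on a basis.\<close>

lemma finite_dim_splitting_bound:
  fixes V :: "'i \<Rightarrow> 'b::real_normed_vector set"
  assumes I: "finite I" and split: "direct_splitting I V"
    and fd: "\<And>j. j \<in> J \<Longrightarrow> finite_dim (V j)" and J: "J \<subseteq> I"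
    and cl: "\<And>j. j \<in> I - J \<Longrightarrow> closed (V j)" and single: "card (I - J) \<le> 1"
    and i: "i \<in> J"
  shows "\<exists>S C. finite S \<and> S \<subseteq> V i - {0} \<and> 0 \<le> C \<and>
    (\<forall>T::'b \<Rightarrow>\<^sub>L 'c::real_normed_vector. \<forall>v.
      norm (blinfun_apply T (splitting_proj I V i v)) \<le> C * (\<Sum>b\<in>S. norm (blinfun_apply T b)) * norm v)"
proof -
  note sub = splitting_subspace[OF I split] and pmem = splitting_proj_mem[OF I split]
  \<comment> \<open>Boundedness of the projection is to be proved. Its kernel H turns out closed,
    being the sum of the one possibly infinite-dimensional summand, which is closed, and a
    finite-dimensional space; then \<open>coordinates_bounded\<close> applies.\<close>
  define H where "H = {v. splitting_proj I V i v = 0}"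
  have iI: "i \<in> I" using i J by auto
  interpret p: linear "splitting_proj I V i" by (rule splitting_proj_linear[OF I split iI])
  have subH: "subspace H" unfolding H_def
    by (auto simp: subspace_def p.add p.scaleR)
  \<comment> \<open>F is the single summand outside J, or {0} if all summands are
    finite-dimensional.\<close>
  obtain F where F: "subspace F" "closed F" "\<And>j. j \<in> I - J \<Longrightarrow> V j = F" "F \<subseteq> H"
  proof (cases "I - J = {}")
    case True
    show ?thesis by (rule that[of "{0}"]) (use True subspace_0[OF subH] in auto)
  next
    case False
    then have "card (I - J) = 1" using single I by (simp add: le_Suc_eq)
    then obtain j where j: "I - J = {j}" by (auto simp: card_1_singleton_iff)
    have "V j \<subseteq> H"
      using j i splitting_proj_on[OF I split iI, of j] by (fastforce simp: H_def)
    then show ?thesis using j cl sub by (intro that[of "V j"]) auto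
  qed
  have "\<forall>j\<in>J. \<exists>S. finite S \<and> independent S \<and> S \<subseteq> V j \<and> V j = span S"
  proof
    fix j assume j: "j \<in> J"
    obtain S where S: "S \<subseteq> V j" "independent S" "V j \<subseteq> span S" using basis_exists[of "V j"] by metis
    obtain S' where S': "finite S'" "V j \<subseteq> span S'" using fd[OF j] by (auto simp: finite_dim_def)
    have "finite S" using independent_span_bound[OF S'(1) S(2)] S S' by blast
    moreover have "span S \<subseteq> V j" using S(1) sub j J by (intro span_minimal) auto
    ultimately show "\<exists>S. finite S \<and> independent S \<and> S \<subseteq> V j \<and> V j = span S" using S by blast
  qed
  then obtain S where S: "\<And>j. j \<in> J \<Longrightarrow> finite (S j)" "\<And>j. j \<in> J \<Longrightarrow> independent (S j)"
    "\<And>j. j \<in> J \<Longrightarrow> S j \<subseteq> V j" "\<And>j. j \<in> J \<Longrightarrow> V j = span (S j)" by metis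
  define R where "R = (\<Union>j\<in>J - {i}. S j)"
  have finR: "finite R" using S(1) J I by (auto simp: R_def intro: finite_subset)
  have "R \<subseteq> H"
  proof
    fix b assume "b \<in> R"
    then obtain j where "j \<in> J" "j \<noteq> i" "b \<in> V j" using S(3) by (auto simp: R_def)
    then show "b \<in> H" using splitting_proj_on[OF I split iI, of j b] J by (auto simp: H_def)
  qed
  then have "span (R \<union> F) \<subseteq> H" using F(4) subH by (intro span_minimal) auto
  moreover have "H \<subseteq> span (R \<union> F)"
  proof
    fix v assume "v \<in> H"
    then have "v = (\<Sum>j\<in>I - {i}. splitting_proj I V j v)"
      using sum_splitting_proj[OF I split, of v] iI I by (simp add: sum.remove[of I i] H_def)
    also have "\<dots> \<in> span (R \<union> F)"
    proof (rule span_sum)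
      fix j assume j: "j \<in> I - {i}"
      show "splitting_proj I V j v \<in> span (R \<union> F)"
      proof (cases "j \<in> J")
        case True
        have "splitting_proj I V j v \<in> span (S j)" using pmem j S(4)[OF True] by auto
        moreover have "span (S j) \<subseteq> span (R \<union> F)" using True j by (intro span_mono) (auto simp: R_def)
        ultimately show ?thesis by auto
      next
        case False
        then show ?thesis using pmem[of j v] j F(3)[of j] by (auto intro: span_base)
      qed
    qed
    finally show "v \<in> span (R \<union> F)" .
  qed
  ultimately have "closed H" using closed_span_Un_finite[OF F(1,2) finR] by simp
  have inter: "span (S i) \<inter> H = {0}"
    using S(4)[OF i] splitting_proj_on[OF I split iI iI] subspace_0[OF subH] span_zero[of "S i"] by (auto simp: H_def)
  obtain C where C: "C \<ge> 0" "\<And>h c b. h \<in> H \<Longrightarrow> b \<in> S i \<Longrightarrow> \<bar>c b\<bar> \<le> C * norm ((\<Sum>b\<in>S i. c b *\<^sub>R b) + h)"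
    using coordinates_bounded[OF subH \<open>closed H\<close> S(1)[OF i] S(2)[OF i] inter] by metis
  show ?thesis
  proof (intro exI[of _ "S i"] exI[of _ C] conjI allI)
    show "S i \<subseteq> V i - {0}" using S(2,3)[OF i] dependent_zero by auto
    fix T :: "'b \<Rightarrow>\<^sub>L 'c" and v
    have "splitting_proj I V i v \<in> span (S i)" using pmem[OF iI] S(4)[OF i] by auto
    then obtain c where c: "splitting_proj I V i v = (\<Sum>b\<in>S i. c b *\<^sub>R b)"
      using span_finite[OF S(1)[OF i]] by auto
    define h where "h = v - splitting_proj I V i v"
    have "h \<in> H" using splitting_proj_on[OF I split iI iI pmem[OF iI]]
      by (simp add: H_def h_def p.diff)
    have v: "v = (\<Sum>b\<in>S i. c b *\<^sub>R b) + h" by (simp add: h_def c)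
    have "norm (blinfun_apply T (splitting_proj I V i v)) \<le> (\<Sum>b\<in>S i. norm (c b *\<^sub>R blinfun_apply T b))"
      unfolding c blinfun.sum_right blinfun.scaleR_right by (rule norm_sum)
    also have "\<dots> \<le> (\<Sum>b\<in>S i. (C * norm v) * norm (blinfun_apply T b))"
      using C(2)[OF \<open>h \<in> H\<close>] v by (intro sum_mono) (auto intro!: mult_right_mono)
    finally show "norm (blinfun_apply T (splitting_proj I V i v)) \<le> C * (\<Sum>b\<in>S i. norm (blinfun_apply T b)) * norm v"
      by (simp add: sum_distrib_left sum_distrib_right mult_ac)
  qed (use C(1) S(1)[OF i] in auto)
qed

section \<open>Cocycles\<close>

text \<open>Covers both time directions: T = f with generator A, and T = inv f with the inverse
  generator. Each estimate is then proved once and applied twice.\<close>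

primrec product_cocycle :: "('x \<Rightarrow> 'x) \<Rightarrow> ('x \<Rightarrow> ('b::real_normed_vector \<Rightarrow>\<^sub>L 'b)) \<Rightarrow> 'x \<Rightarrow> nat \<Rightarrow> ('b \<Rightarrow>\<^sub>L 'b)"
  where
  "product_cocycle T A x 0 = id_blinfun"
| "product_cocycle T A x (Suc n) = A ((T ^^ n) x) o\<^sub>L product_cocycle T A x n"

lemma product_cocycle_add:
  "product_cocycle T A x (m + n) = product_cocycle T A ((T ^^ m) x) n o\<^sub>L product_cocycle T A x m"
proof (induction n)
  case 0
  show ?case by (rule blinfun_eqI) simp
next
  case (Suc n)
  have "(T ^^ n) ((T ^^ m) x) = (T ^^ (m + n)) x" by (metis add.commute comp_apply funpow_add)
  then show ?case using Suc by (intro blinfun_eqI) simp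
qed

lemma product_cocycle_inverse:
  assumes "\<And>x. T (S x) = x" and "\<And>x v. blinfun_apply (A (S x)) (blinfun_apply (B x) v) = v"
  shows "blinfun_apply (product_cocycle T A ((S ^^ n) x) n) (blinfun_apply (product_cocycle S B x n) v) = v"
proof (induction n)
  case (Suc n)
  have "product_cocycle T A ((S ^^ Suc n) x) (Suc n)
      = product_cocycle T A ((S ^^ n) x) n o\<^sub>L A ((S ^^ Suc n) x)"
    using product_cocycle_add[of T A "(S ^^ Suc n) x" 1 n] by (intro blinfun_eqI) (simp add: assms(1))
  then show ?case using Suc assms(2)[of "(S ^^ n) x"] by simp
qed simp

lemma product_cocycle_image:
  assumes "\<And>x. x \<in> X0 \<Longrightarrow> blinfun_apply (A x) ` G x = G (T x)" and "T ` X0 \<subseteq> X0" and "x \<in> X0"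
  shows "blinfun_apply (product_cocycle T A x n) ` G x = G ((T ^^ n) x)"
proof (induction n)
  case (Suc n)
  have "(T ^^ n) x \<in> X0" using assms(2,3) by (induction n) auto
  then have "blinfun_apply (A ((T ^^ n) x)) ` blinfun_apply (product_cocycle T A x n) ` G x = G ((T ^^ Suc n) x)"
    using Suc assms(1) by simp
  then show ?case by (simp add: image_image)
qed simp

lemma funpow_lipschitz:
  fixes T :: "'x::metric_space \<Rightarrow> 'x"
  assumes "L-lipschitz_on UNIV T"
  shows "dist ((T ^^ n) x) ((T ^^ n) y) \<le> L ^ n * dist x y"
proof (induction n)
  case (Suc n)
  have "dist ((T ^^ Suc n) x) ((T ^^ Suc n) y) \<le> L * dist ((T ^^ n) x) ((T ^^ n) y)"
    using lipschitz_onD[OF assms, of "(T ^^ n) x" "(T ^^ n) y"] by simp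
  also have "\<dots> \<le> L * (L ^ n * dist x y)"
    using Suc lipschitz_on_nonneg[OF assms] by (intro mult_left_mono)
  finally show ?case by (simp add: mult_ac)
qed simp

text \<open>Telescoping one factor at a time: the new factors differ by at most K (L^n
  d(x,y))^\<nu>, the old product has norm at most a^n. With c denoting the stated base, c is at
  least a + K, so (a + K) c^n is at most c^(n+1) and the induction closes.\<close>

lemma product_cocycle_bounds:
  fixes T :: "'x::metric_space \<Rightarrow> 'x" and A :: "'x \<Rightarrow> ('b::real_normed_vector \<Rightarrow>\<^sub>L 'b)"
  assumes T: "L-lipschitz_on UNIV T" and L: "1 \<le> L"
    and A: "\<And>x. norm (A x) \<le> a" and a: "1 \<le> a"
    and H: "\<And>x y. norm (A x - A y) \<le> K * dist x y powr \<nu>" and K: "0 \<le> K" and \<nu>: "0 < \<nu>"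
  shows "norm (product_cocycle T A x n) \<le> ((a + K) * L powr \<nu>) ^ n"
    and "norm (product_cocycle T A x n - product_cocycle T A y n) \<le> ((a + K) * L powr \<nu>) ^ n * dist x y powr \<nu>"
proof -
  define c where "c = (a + K) * L powr \<nu>"
  have L1: "1 \<le> L powr \<nu>" using L \<nu> by (simp add: ge_one_powr_ge_zero)
  have c: "a + K \<le> c" using a K L1 mult_left_mono[of 1 "L powr \<nu>" "a + K"] by (simp add: c_def)
  have na: "norm (product_cocycle T A x n) \<le> a ^ n" for x n
  proof (induction n)
    case 0
    show ?case by (simp add: norm_blinfun_id_le)
  next
    case (Suc n)
    have "norm (product_cocycle T A x (Suc n)) \<le> norm (A ((T ^^ n) x)) * norm (product_cocycle T A x n)"
      by (simp add: norm_blinfun_compose)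
    also have "\<dots> \<le> a * a ^ n" using A Suc a by (intro mult_mono) auto
    finally show ?case by simp
  qed
  have "a ^ n \<le> c ^ n" for n using a K c by (intro power_mono) auto
  then show "norm (product_cocycle T A x n) \<le> ((a + K) * L powr \<nu>) ^ n"
    using na[of x n] c_def by (metis order_trans)
  show "norm (product_cocycle T A x n - product_cocycle T A y n) \<le> ((a + K) * L powr \<nu>) ^ n * dist x y powr \<nu>"
    unfolding c_def[symmetric]
  proof (induction n)
    case (Suc n)
    let ?P = "\<lambda>x. product_cocycle T A x n" and ?A = "\<lambda>x. A ((T ^^ n) x)"
    have "product_cocycle T A x (Suc n) - product_cocycle T A y (Suc n)
        = (?A x o\<^sub>L (?P x - ?P y)) + ((?A x - ?A y) o\<^sub>L ?P y)"
      by (rule blinfun_eqI) (simp add: blinfun.diff_left blinfun.diff_right blinfun.add_left)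
    then have "norm (product_cocycle T A x (Suc n) - product_cocycle T A y (Suc n))
        \<le> norm (?A x o\<^sub>L (?P x - ?P y)) + norm ((?A x - ?A y) o\<^sub>L ?P y)"
      by (metis norm_triangle_ineq)
    also have "\<dots> \<le> norm (?A x) * norm (?P x - ?P y) + norm (?A x - ?A y) * norm (?P y)"
      by (intro add_mono norm_blinfun_compose)
    also have "\<dots> \<le> a * (c ^ n * dist x y powr \<nu>) + (K * ((L powr \<nu>) ^ n * dist x y powr \<nu>)) * a ^ n"
    proof (intro add_mono mult_mono)
      have "norm (?A x - ?A y) \<le> K * dist ((T ^^ n) x) ((T ^^ n) y) powr \<nu>" by (rule H)
      also have "\<dots> \<le> K * (L ^ n * dist x y) powr \<nu>"
        using K \<nu> by (intro mult_left_mono powr_mono2 funpow_lipschitz[OF T]) auto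
      also have "(L ^ n * dist x y) powr \<nu> = (L powr \<nu>) ^ n * dist x y powr \<nu>"
        using L by (simp add: powr_mult powr_realpow[symmetric] powr_powr mult.commute)
      finally show "norm (?A x - ?A y) \<le> K * ((L powr \<nu>) ^ n * dist x y powr \<nu>)" .
    qed (use A Suc a K na in auto)
    also have "\<dots> = (a * c ^ n + K * (a * L powr \<nu>) ^ n) * dist x y powr \<nu>"
      by (simp add: algebra_simps power_mult_distrib)
    also have "\<dots> \<le> (a * c ^ n + K * c ^ n) * dist x y powr \<nu>"
      using a K L1 by (intro mult_right_mono add_mono mult_left_mono power_mono)
        (auto simp: c_def intro!: mult_right_mono)
    also have "\<dots> \<le> c ^ Suc n * dist x y powr \<nu>"
      using c a K mult_right_mono[OF c, of "c ^ n"] by (intro mult_right_mono) (auto simp: algebra_simps)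
    finally show ?case .
  qed simp
qed

lemma op_inv_compose:
  assumes "T \<in> GL"
  shows "op_inv T o\<^sub>L T = id_blinfun" "T o\<^sub>L op_inv T = id_blinfun"
proof -
  obtain S where S: "S o\<^sub>L T = id_blinfun" "T o\<^sub>L S = id_blinfun" using assms by (auto simp: GL_def)
  have "op_inv T = S" unfolding op_inv_def
  proof (rule the_equality)
    fix R assume R: "R o\<^sub>L T = id_blinfun \<and> T o\<^sub>L R = id_blinfun"
    have id_right: "U o\<^sub>L id_blinfun = U" and id_left: "id_blinfun o\<^sub>L U = U" for U :: "'a \<Rightarrow>\<^sub>L 'a"
      by (rule blinfun_eqI, simp)+
    have "R = R o\<^sub>L (T o\<^sub>L S)" by (simp only: S id_right)
    also have "\<dots> = (R o\<^sub>L T) o\<^sub>L S" by (rule blinfun_eqI) simp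
    also have "\<dots> = S" using R by (simp only: id_left)
    finally show "R = S" .
  qed (use S in auto)
  then show "op_inv T o\<^sub>L T = id_blinfun" "T o\<^sub>L op_inv T = id_blinfun" using S by auto
qed

lemma op_inv_apply:
  assumes "T \<in> GL"
  shows "blinfun_apply (op_inv T) (blinfun_apply T v) = v" "blinfun_apply T (blinfun_apply (op_inv T) v) = v"
  using arg_cong[OF op_inv_compose(1)[OF assms], of "\<lambda>U. blinfun_apply U v"]
    arg_cong[OF op_inv_compose(2)[OF assms], of "\<lambda>U. blinfun_apply U v"] by simp_all

text \<open>The evaluation at \<open>inv f x\<close> absorbs the index shift of
  \<open>cocycle_bwd\<close>, whose first factor already sits at time -1, whereas
  \<open>product_cocycle\<close> starts at time 0.\<close>

definition backward_generator ::
    "('x \<Rightarrow> 'x) \<Rightarrow> ('x \<Rightarrow> ('b::real_normed_vector \<Rightarrow>\<^sub>L 'b)) \<Rightarrow> 'x \<Rightarrow> ('b \<Rightarrow>\<^sub>L 'b)" where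
  "backward_generator f A x = op_inv (A (inv f x))"

lemma cocycle_eq_product_cocycle:
  "cocycle f A x (int n) = product_cocycle f A x n"
  "cocycle f A x (- int n) = product_cocycle (inv f) (backward_generator f A) x n"
proof -
  have "cocycle_fwd f A x n = product_cocycle f A x n"
    by (induction n) (auto simp: int_iterate_def)
  then show "cocycle f A x (int n) = product_cocycle f A x n" by (simp add: cocycle_def)
  have it: "int_iterate f (- int (Suc n)) x = inv f ((inv f ^^ n) x)" for n
    by (simp add: int_iterate_def del: of_nat_Suc)
  have "cocycle_bwd f A x n = product_cocycle (inv f) (backward_generator f A) x n"
    by (induction n) (auto simp: it backward_generator_def simp del: of_nat_Suc)
  then show "cocycle f A x (- int n) = product_cocycle (inv f) (backward_generator f A) x n"
    by (cases "n = 0") (simp_all add: cocycle_def)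
qed

lemma GL_holder_cocycle_bounds:
  fixes f :: "'x::metric_space \<Rightarrow> 'x" and A :: "'x \<Rightarrow> ('b::real_normed_vector \<Rightarrow>\<^sub>L 'b)"
  assumes cpt: "compact (UNIV :: 'x set)" and f: "bi_lipschitz_homeo f"
    and \<nu>: "\<nu> > 0" and A: "GL_holder \<nu> A"
  shows "\<exists>a\<ge>1. \<forall>x y n.
     norm (cocycle f A x (int n)) \<le> a ^ n \<and>
     norm (cocycle f A x (- int n)) \<le> a ^ n \<and>
     norm (cocycle f A x (int n) - cocycle f A y (int n)) \<le> a ^ n * dist x y powr \<nu> \<and>
     norm (cocycle f A x (- int n) - cocycle f A y (- int n)) \<le> a ^ n * dist x y powr \<nu>"
proof -
  obtain L1 L2 where L12: "L1-lipschitz_on UNIV f" "L2-lipschitz_on UNIV (inv f)"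
    using f by (auto simp: bi_lipschitz_homeo_def)
  define L where "L = max 1 (max L1 L2)"
  have L: "L-lipschitz_on UNIV f" "L-lipschitz_on UNIV (inv f)" "1 \<le> L"
    using L12 by (auto simp: L_def intro: lipschitz_on_le)
  obtain K0 where K0: "\<And>x y. GL_dist (A x) (A y) \<le> K0 * dist x y powr \<nu>"
    using A by (auto simp: GL_holder_def)
  define K where "K = \<bar>K0\<bar>"
  have K: "K \<ge> 0" "norm (A x - A y) \<le> K * dist x y powr \<nu>"
    "norm (op_inv (A x) - op_inv (A y)) \<le> K * dist x y powr \<nu>" for x y
  proof -
    have "K0 * dist x y powr \<nu> \<le> K * dist x y powr \<nu>" unfolding K_def by (intro mult_right_mono) auto
    then have le: "norm (A x - A y) + norm (op_inv (A x) - op_inv (A y)) \<le> K * dist x y powr \<nu>"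
      using K0[of x y] by (simp add: GL_dist_def)
    show "norm (A x - A y) \<le> K * dist x y powr \<nu>"
      by (rule order_trans[OF _ le]) simp
    show "norm (op_inv (A x) - op_inv (A y)) \<le> K * dist x y powr \<nu>"
      by (rule order_trans[OF _ le]) simp
  qed (simp add: K_def)
  obtain x0 :: 'x and D where D: "\<And>x. dist x x0 \<le> D"
    using compact_imp_bounded[OF cpt] by (auto simp: bounded_def dist_commute)
  have D0: "D \<ge> 0" using D[of x0] by simp
  define a where "a = max 1 (max (norm (A x0)) (norm (op_inv (A x0))) + K * D powr \<nu>)"
  have KD: "K * dist x x0 powr \<nu> \<le> K * D powr \<nu>" for x
    using K(1) D[of x] \<nu> by (intro mult_left_mono powr_mono2) auto
  have na: "norm (A x) \<le> a" "norm (op_inv (A x)) \<le> a" for x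
    using norm_triangle_sub[of "A x" "A x0"] norm_triangle_sub[of "op_inv (A x)" "op_inv (A x0)"]
      K(2,3)[of x x0] KD[of x] by (auto simp: a_def)
  \<comment> \<open>The backward generator evaluates A at \<open>inv f x\<close>, so its Hoelder
    constant grows by the factor \<open>L powr \<nu>\<close>; K' serves both generators.\<close>
  define K' where "K' = K * L powr \<nu>"
  have LK: "1 \<le> L powr \<nu>" using L \<nu> by (simp add: ge_one_powr_ge_zero)
  have KK': "K \<le> K'" using mult_left_mono[OF LK K(1)] by (simp add: K'_def)
  have K'0: "0 \<le> K'" using K(1) KK' by simp
  have HA: "norm (A x - A y) \<le> K' * dist x y powr \<nu>" for x y
    using K(2)[of x y] mult_right_mono[OF KK', of "dist x y powr \<nu>"] by simp
  have HB: "norm (backward_generator f A x - backward_generator f A y) \<le> K' * dist x y powr \<nu>" for x y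
  proof -
    have "norm (backward_generator f A x - backward_generator f A y) \<le> K * dist (inv f x) (inv f y) powr \<nu>"
      unfolding backward_generator_def by (rule K)
    also have "\<dots> \<le> K * (L * dist x y) powr \<nu>"
      using K(1) \<nu> lipschitz_onD[OF L(2)] by (intro mult_left_mono powr_mono2) auto
    finally show ?thesis using L(3) by (simp add: K'_def powr_mult mult_ac)
  qed
  define c where "c = (a + K') * L powr \<nu>"
  have a1: "1 \<le> a" by (simp add: a_def)
  have "1 * 1 \<le> (a + K') * L powr \<nu>" using a1 K'0 LK by (intro mult_mono) auto
  then have "c \<ge> 1" by (simp add: c_def)
  have "norm (backward_generator f A x) \<le> a" for x by (simp add: backward_generator_def na)
  note fwd = product_cocycle_bounds[OF L(1,3) na(1) a1 HA K'0 \<nu>, folded c_def]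
    and bwd = product_cocycle_bounds[OF L(2,3) this a1 HB K'0 \<nu>, folded c_def]
  show ?thesis
    unfolding cocycle_eq_product_cocycle
    by (intro exI[of _ c] conjI allI fwd bwd \<open>c \<ge> 1\<close>)
qed

section \<open>From growth rates to exponential bounds for all times\<close>

lemma eventually_exp_bound:
  fixes u :: "nat \<Rightarrow> real"
  assumes "\<forall>\<^sub>F n in sequentially. u n \<le> exp (real n * b)"
  shows "\<exists>C\<ge>0. \<forall>n. u n \<le> C * exp (real n * b)"
proof -
  obtain N where N: "\<And>n. n \<ge> N \<Longrightarrow> u n \<le> exp (real n * b)"
    using assms by (auto simp: eventually_sequentially)
  define C where "C = 1 + (\<Sum>i<N. \<bar>u i\<bar> * exp (- (real i * b)))"
  have s0: "0 \<le> (\<Sum>i<N. \<bar>u i\<bar> * exp (- (real i * b)))" by (intro sum_nonneg) auto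
  have "u n \<le> C * exp (real n * b)" for n
  proof (cases "n < N")
    case True
    have "\<bar>u n\<bar> * exp (- (real n * b)) \<le> (\<Sum>i<N. \<bar>u i\<bar> * exp (- (real i * b)))"
      using True by (intro member_le_sum) auto
    then have "\<bar>u n\<bar> * exp (- (real n * b)) * exp (real n * b) \<le> C * exp (real n * b)"
      by (intro mult_right_mono) (auto simp: C_def)
    also have "\<bar>u n\<bar> * exp (- (real n * b)) * exp (real n * b) = \<bar>u n\<bar>"
      by (simp only: mult.assoc exp_add[symmetric]) simp
    finally show ?thesis by simp
  next
    case False
    have "1 * exp (real n * b) \<le> C * exp (real n * b)" using s0 by (intro mult_right_mono) (auto simp: C_def)
    then have "exp (real n * b) \<le> C * exp (real n * b)" by (simp only: mult_1_left)
    then show ?thesis using N[of n] False by (meson not_less order_trans)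
  qed
  moreover have "C \<ge> 0" using s0 by (simp add: C_def)
  ultimately show ?thesis by blast
qed

lemma rate_imp_exp_bound:
  fixes u :: "nat \<Rightarrow> real"
  assumes "\<And>n. 0 \<le> u n" and "\<forall>\<^sub>F n in sequentially. ln (u n) / real n \<le> b"
  shows "\<exists>C\<ge>0. \<forall>n. u n \<le> C * exp (real n * b)"
proof (rule eventually_exp_bound)
  show "\<forall>\<^sub>F n in sequentially. u n \<le> exp (real n * b)"
    using assms(2) eventually_gt_at_top[of 0]
  proof eventually_elim
    case (elim n)
    \<comment> \<open>Since \<open>ln 0 = 0\<close>, the rate says nothing about n with u n = 0, but
      there the bound is trivial.\<close>
    show ?case
    proof (cases "u n = 0")
      case False
      then have "u n > 0" using assms(1)[of n] by simp
      moreover have "ln (u n) \<le> real n * b" using elim by (simp add: field_simps)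
      ultimately show ?thesis by (metis exp_le_cancel_iff exp_ln)
    qed simp
  qed
qed

lemma limit_rate_imp_exp_bound:
  fixes u :: "nat \<Rightarrow> real"
  assumes "\<And>n. 0 \<le> u n" and "(\<lambda>n. ln (u n) / real n) \<longlonglongrightarrow> l" and "l < b"
  shows "\<exists>C\<ge>0. \<forall>n. u n \<le> C * exp (real n * b)"
  using order_tendstoD(2)[OF assms(2,3)]
  by (intro rate_imp_exp_bound assms(1)) (auto elim: eventually_mono)

lemma splitting_proj_equivariant:
  assumes I: "finite I" "direct_splitting I V" "direct_splitting I W" and i: "i \<in> I"
    and T: "linear T" "\<And>j. j \<in> I \<Longrightarrow> T ` V j \<subseteq> W j"
  shows "splitting_proj I W i (T v) = T (splitting_proj I V i v)"
proof (rule splitting_proj_eqI[OF I(1,3) _ _ i])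
  show "T (splitting_proj I V j v) \<in> W j" if "j \<in> I" for j
    using T(2)[OF that] splitting_proj_mem[OF I(1,2) that] by blast
  show "(\<Sum>j\<in>I. T (splitting_proj I V j v)) = T v"
    by (simp add: linear_sum[OF T(1), symmetric] sum_splitting_proj[OF I(1,2)])
qed

text \<open>The T-cocycle over n steps from \<open>(S ^^ n) x\<close> inverts the S-cocycle over n
  steps from x. A lower bound for the latter on G x is therefore an upper bound for the former on G
  at the end point, which \<open>submultiplicative_transfer\<close> supplies from the growth at x at
  the price of \<epsilon>.\<close>

lemma AE_expansion_along_bundle:
  fixes T S :: "'x::metric_space \<Rightarrow> 'x" and A B :: "'x \<Rightarrow> ('b::real_normed_vector \<Rightarrow>\<^sub>L 'b)"
  assumes cpt: "compact (UNIV :: 'x set)" and M: "prob_space M" "sets M = sets borel"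
    and S: "S \<in> M \<rightarrow>\<^sub>M M" "distr M M S = M" and TS: "\<And>x. T (S x) = x"
    and X0: "X0 \<in> sets M" "T ` X0 \<subseteq> X0" "S ` X0 \<subseteq> X0"
    and G: "G \<in> restrict_space M X0 \<rightarrow>\<^sub>M grassmannian_borel"
    and AG: "\<And>x. x \<in> X0 \<Longrightarrow> blinfun_apply (A x) ` G x = G (T x)"
    and BG: "\<And>x. x \<in> X0 \<Longrightarrow> blinfun_apply (B x) ` G x = G (S x)"
    and AB: "\<And>x v. blinfun_apply (A (S x)) (blinfun_apply (B x) v) = v"
    and cont: "\<And>n. continuous_on UNIV (\<lambda>x. product_cocycle T A x n)"
    and bnd: "\<And>n x. norm (product_cocycle T A x n) \<le> a ^ n" and a: "1 \<le> a"
    and growth: "\<And>x. x \<in> X0 \<Longrightarrow>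
      \<exists>C. \<forall>n. \<forall>v\<in>G x. norm (blinfun_apply (product_cocycle T A x n) v) \<le> C * exp (real n * b) * norm v"
    and \<epsilon>: "\<epsilon> > 0"
  shows "AE x in M. x \<in> X0 \<longrightarrow> (\<exists>C\<ge>0. \<forall>n. \<forall>v\<in>G x.
    norm v \<le> C * exp (real n * (b + \<epsilon>)) * norm (blinfun_apply (product_cocycle S B x n) v))"
proof -
  interpret prob_space M by fact
  have space: "space M = UNIV" using M(2) sets_eq_imp_space_eq by fastforce
  have sub: "subspace (G x)" if "x \<in> X0" for x
    using measurable_space[OF G, of x] that
    by (auto simp: space_grassmannian_borel grassmannian_def space_restrict_space space)
  have Tn: "(T ^^ n) x \<in> X0" if "x \<in> X0" for x n using that X0(2) by (induction n) auto
  have Sn: "(S ^^ n) x \<in> X0" if "x \<in> X0" for x n using that X0(3) by (induction n) auto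
  \<comment> \<open>The transfer lemma wants its hypotheses at every point; the indicator makes r
    vanish off X0, where G x need not even be a subspace.\<close>
  define r where "r n x = indicator X0 x * restricted_norm (product_cocycle T A x n) (G x)" for n x
  have r0: "0 \<le> r n x" for n x
    using sub[of x] by (auto simp: r_def indicator_def intro!: restricted_norm_nonneg subspace_0)
  have "AE x in M. \<exists>C. \<forall>n. r n ((S ^^ n) x) \<le> C * exp (real n * (b + \<epsilon>))"
  proof (rule submultiplicative_transfer[OF S TS space _ r0 _ _ a _ \<epsilon>])
    show "r n \<in> borel_measurable M" for n
      unfolding r_def by (rule restricted_norm_bundle_measurable[OF cpt M(2) X0(1) G cont])
    show "r (m + n) x \<le> r n ((T ^^ m) x) * r m x" for m n x
    proof (cases "x \<in> X0")
      case True
      have "restricted_norm (product_cocycle T A ((T ^^ m) x) n o\<^sub>L product_cocycle T A x m) (G x)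
        \<le> restricted_norm (product_cocycle T A ((T ^^ m) x) n) (G ((T ^^ m) x)) * restricted_norm (product_cocycle T A x m) (G x)"
        using product_cocycle_image[of X0 A G T x m] AG X0(2) True
        by (intro restricted_norm_compose sub Tn) auto
      then show ?thesis using True Tn[OF True, of m] by (simp add: r_def product_cocycle_add)
    qed (simp add: r_def)
    show "r n x \<le> a ^ n" for n x
      using restricted_norm_le_norm[of "G x" "product_cocycle T A x n"] bnd[where n=n and x=x] a sub[of x]
      by (auto simp: r_def indicator_def subspace_0)
    show "\<exists>C. \<forall>n. r n x \<le> C * exp (real n * b)" for x
    proof (cases "x \<in> X0")
      case True
      obtain C where C: "\<And>n v. v \<in> G x \<Longrightarrow>
          norm (blinfun_apply (product_cocycle T A x n) v) \<le> C * exp (real n * b) * norm v"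
        using growth[OF True] by blast
      have "r n x \<le> \<bar>C\<bar> * exp (real n * b)" for n
      proof -
        have "restricted_norm (product_cocycle T A x n) (G x) \<le> \<bar>C\<bar> * exp (real n * b)"
        proof (rule restricted_norm_least)
          fix v assume "v \<in> G x"
          then have "norm (blinfun_apply (product_cocycle T A x n) v) \<le> C * exp (real n * b) * norm v" by (rule C)
          also have "\<dots> \<le> \<bar>C\<bar> * exp (real n * b) * norm v" by (intro mult_right_mono) auto
          finally show "norm (blinfun_apply (product_cocycle T A x n) v) \<le> \<bar>C\<bar> * exp (real n * b) * norm v" .
        qed (use sub[OF True] subspace_0 in auto)
        then show ?thesis using True by (simp add: r_def)
      qed
      then show ?thesis by blast
    qed (auto simp: r_def intro!: exI[of _ 0])
  qed
  then show ?thesis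
  proof (rule AE_mp, intro AE_I2 impI)
    fix x assume "\<exists>C. \<forall>n. r n ((S ^^ n) x) \<le> C * exp (real n * (b + \<epsilon>))" and x: "x \<in> X0"
    then obtain C where C: "\<And>n. r n ((S ^^ n) x) \<le> C * exp (real n * (b + \<epsilon>))" by blast
    have "C \<ge> 0" using order_trans[OF r0 C[of 0]] by simp
    moreover have "norm v \<le> C * exp (real n * (b + \<epsilon>)) * norm (blinfun_apply (product_cocycle S B x n) v)"
      if v: "v \<in> G x" for n v
    proof -
      let ?w = "blinfun_apply (product_cocycle S B x n) v"
      have w: "?w \<in> G ((S ^^ n) x)"
        using product_cocycle_image[of X0 B G S x n] BG X0(3) x v by auto
      have "v = blinfun_apply (product_cocycle T A ((S ^^ n) x) n) ?w"
        by (rule product_cocycle_inverse[where T=T and S=S and A=A and B=B, OF TS AB, symmetric])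
      then have "norm v = norm (blinfun_apply (product_cocycle T A ((S ^^ n) x) n) ?w)" by simp
      also have "\<dots> \<le> restricted_norm (product_cocycle T A ((S ^^ n) x) n) (G ((S ^^ n) x)) * norm ?w"
        using w sub Sn[OF x] by (intro restricted_norm_upper) auto
      also have "\<dots> = r n ((S ^^ n) x) * norm ?w" using Sn[OF x] by (simp add: r_def)
      also have "\<dots> \<le> C * exp (real n * (b + \<epsilon>)) * norm ?w" by (intro mult_right_mono C) auto
      finally show ?thesis .
    qed
    ultimately show "\<exists>C\<ge>0. \<forall>n. \<forall>v\<in>G x.
      norm v \<le> C * exp (real n * (b + \<epsilon>)) * norm (blinfun_apply (product_cocycle S B x n) v)" by blast
  qed
qed

text \<open>The optimal \<open>n\<close> is the largest one with \<open>(Q / q) ^ n * s \<le> 1\<close>.\<close>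

lemma geometric_balance:
  fixes q Q s t :: real
  assumes q: "0 < q" "q < 1" and Q: "1 < Q" and s: "0 < s" "s \<le> 1" and c: "0 \<le> c"
    and t: "\<And>n. t \<le> c * (q ^ n + Q ^ n * s)"
  shows "t \<le> 2 * c / q * s powr (ln q / (ln q - ln Q))"
proof -
  define d where "d = ln Q - ln q"
  have d: "d > 0" using q Q by (simp add: d_def)
  \<comment> \<open>The real solution of (Q/q)^y s = 1. Rounding it down to n costs one factor
    1/q.\<close>
  define y where "y = - ln s / d"
  have y0: "y \<ge> 0" using s d by (simp add: y_def divide_nonpos_pos)
  define n where "n = nat \<lfloor>y\<rfloor>"
  have n: "real n \<le> y" "y < real n + 1" using y0 by (auto simp: n_def)
  have qn: "q ^ n = exp (real n * ln q)" using q by (simp add: exp_of_nat_mult)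
  have Qn: "Q ^ n = exp (real n * ln Q)" using Q by (simp add: exp_of_nat_mult)
  have "Q ^ n * s = exp (real n * ln Q + ln s)" using s by (simp add: Qn exp_add)
  also have "\<dots> \<le> exp (real n * ln q)"
  proof -
    have "real n * d \<le> - ln s" using n(1) d by (simp add: y_def field_simps)
    then show ?thesis by (simp add: d_def algebra_simps)
  qed
  finally have 1: "Q ^ n * s \<le> q ^ n" by (simp add: qn)
  have "real n * ln q \<le> (y - 1) * ln q"
    using n q by (intro mult_right_mono_neg) auto
  then have "q ^ n \<le> exp ((y - 1) * ln q)" by (simp add: qn)
  also have "\<dots> = exp (y * ln q) / q" using q by (simp add: algebra_simps exp_diff)
  also have "y * ln q = (ln q / (ln q - ln Q)) * ln s"
    using d by (simp add: y_def d_def field_simps)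
  also have "exp \<dots> = s powr (ln q / (ln q - ln Q))" using s by (simp add: powr_def)
  finally have 2: "q ^ n \<le> s powr (ln q / (ln q - ln Q)) / q" .
  have "t \<le> c * (q ^ n + Q ^ n * s)" by (rule t)
  also have "\<dots> \<le> c * (2 * (s powr (ln q / (ln q - ln Q)) / q))"
    using 1 2 c by (intro mult_left_mono) auto
  finally show ?thesis by (simp add: mult_ac)
qed

text \<open>The approximating vector w need not be a unit vector. Rescaling moves it by the
  difference between its norm and 1, which is at most \<eta>, so the error at most doubles; \<eta>
  below 1 guarantees that w is nonzero.\<close>

lemma hat_d_le:
  fixes V W :: "'b::real_normed_vector set"
  assumes V: "subspace V" "V \<noteq> {0}" and W: "subspace W" "W \<noteq> {0}" and \<eta>: "0 \<le> \<eta>" "\<eta> \<le> 1/2"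
    and VW: "\<And>v. v \<in> V \<Longrightarrow> norm v = 1 \<Longrightarrow> \<exists>w\<in>W. norm (v - w) \<le> \<eta>"
    and WV: "\<And>w. w \<in> W \<Longrightarrow> norm w = 1 \<Longrightarrow> \<exists>v\<in>V. norm (w - v) \<le> \<eta>"
  shows "hat_d V W \<le> 2 * \<eta>"
proof -
  have *: "infdist v (unit_sphere W) \<le> 2 * \<eta>"
    if v: "v \<in> unit_sphere V" and W: "subspace W"
      and VW: "\<And>v. v \<in> V \<Longrightarrow> norm v = 1 \<Longrightarrow> \<exists>w\<in>W. norm (v - w) \<le> \<eta>" for v and V W :: "'b set"
  proof -
    have v1: "norm v = 1" using v by (simp add: unit_sphere_def)
    obtain w where w: "w \<in> W" "norm (v - w) \<le> \<eta>" using VW v by (auto simp: unit_sphere_def)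
    have nw: "\<bar>1 - norm w\<bar> \<le> \<eta>" using norm_triangle_ineq3[of v w] w v1 by simp
    then have w0: "w \<noteq> 0" using \<eta> by auto
    have "dist v (w /\<^sub>R norm w) \<le> norm (v - w) + norm (w - w /\<^sub>R norm w)"
      using norm_triangle_ineq[of "v - w" "w - w /\<^sub>R norm w"] by (simp add: dist_norm)
    also have "w - w /\<^sub>R norm w = (1 - 1 / norm w) *\<^sub>R w" by (simp add: algebra_simps divide_inverse)
    also have "norm \<dots> = \<bar>1 - norm w\<bar>"
    proof -
      have "norm ((1 - 1 / norm w) *\<^sub>R w) = \<bar>(1 - 1 / norm w) * norm w\<bar>" by (simp add: abs_mult)
      also have "(1 - 1 / norm w) * norm w = norm w - 1" using w0 by (simp add: algebra_simps)
      finally show ?thesis by simp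
    qed
    finally have "dist v (w /\<^sub>R norm w) \<le> 2 * \<eta>" using w nw by simp
    moreover have "w /\<^sub>R norm w \<in> unit_sphere W"
      using w w0 W by (simp add: unit_sphere_def subspace_scale)
    ultimately show ?thesis by (metis infdist_le2)
  qed
  show ?thesis unfolding hat_d_def
    using unit_sphere_nonempty V W VW WV by (intro max.boundedI cSUP_least *[of _ V W] *[of _ W V]) auto
qed

section \<open>Regular points of an Oseledets splitting\<close>

text \<open>Taking \<open>lam (Suc k)\<close> as the growth bound on F treats both cases of the
  multiplicative ergodic theorem together. The constant a is a parameter, so it can be fixed before
  any splitting is chosen.\<close>

locale oseledets_bundle =
  fixes f :: "'x::metric_space \<Rightarrow> 'x"
    and M :: "'x measure"
    and A :: "'x \<Rightarrow> ('b::banach \<Rightarrow>\<^sub>L 'b)"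
    and X0 :: "'x set" and k :: nat and lam :: "nat \<Rightarrow> real"
    and E :: "nat \<Rightarrow> 'x \<Rightarrow> 'b set" and F :: "'x \<Rightarrow> 'b set"
    and a \<nu> :: real
  assumes cpt: "compact (UNIV :: 'x set)" and lip: "bi_lipschitz_homeo f"
    and prob: "prob_space M" and sets_M: "sets M = sets borel" and invM: "invariant_measure M f"
    and infdim: "\<not> finite_dim (UNIV :: 'b set)"
    and GL: "range A \<subseteq> GL" and \<nu>: "0 < \<nu>"
    and full: "invariant_full_set M f X0"
    and splitting: "splitting_properties M f A X0 k lam E F (lam (Suc k))"
    and a: "1 \<le> a"
    and cocycle_norm: "\<And>x n. norm (cocycle f A x (int n)) \<le> a ^ n" "\<And>x n. norm (cocycle f A x (- int n)) \<le> a ^ n"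
    and cocycle_holder:
      "\<And>x y n. norm (cocycle f A x (int n) - cocycle f A y (int n)) \<le> a ^ n * dist x y powr \<nu>"
      "\<And>x y n. norm (cocycle f A x (- int n) - cocycle f A y (- int n)) \<le> a ^ n * dist x y powr \<nu>"
begin

abbreviation "I \<equiv> {1..Suc k}"
abbreviation "fwd x n \<equiv> blinfun_apply (cocycle f A x (int n))"
abbreviation "bwd x n \<equiv> blinfun_apply (cocycle f A x (- int n))"
abbreviation "V \<equiv> summands k E F"
abbreviation "p x \<equiv> splitting_proj I (V x)"
abbreviation "B \<equiv> backward_generator f A"

lemma bij_f: "bij f" using lip by (simp add: bi_lipschitz_homeo_def)

lemma f_inv: "f (inv f x) = x" "inv f (f x) = x"
  using bij_f by (simp_all add: bij_is_surj surj_f_inv_f bij_is_inj)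

lemma cont_f: "continuous_on UNIV f" "continuous_on UNIV (inv f)"
  using lip by (auto simp: bi_lipschitz_homeo_def intro: lipschitz_on_continuous_on)

lemma space_M: "space M = UNIV"
  using sets_M sets_eq_imp_space_eq by fastforce

lemma f_measure_preserving: "f \<in> M \<rightarrow>\<^sub>M M" "distr M M f = M" "inv f \<in> M \<rightarrow>\<^sub>M M" "distr M M (inv f) = M"
proof -
  show f: "f \<in> M \<rightarrow>\<^sub>M M" "distr M M f = M" using invM by (auto simp: invariant_measure_def)
  have "inv f \<in> borel \<rightarrow>\<^sub>M borel" using cont_f(2) by (rule borel_measurable_continuous_onI)
  then show g: "inv f \<in> M \<rightarrow>\<^sub>M M" using measurable_cong_sets[OF sets_M sets_M] by blast
  have "distr M M (inv f) = distr (distr M M f) M (inv f)" by (simp add: f)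
  also have "\<dots> = distr M M (inv f \<circ> f)" by (rule distr_distr[OF g f(1)])
  also have "inv f \<circ> f = id" by (auto simp: f_inv)
  finally show "distr M M (inv f) = M" by (simp add: distr_id2 id_def)
qed

lemma X0_measurable: "X0 \<in> sets M" and X0_full: "measure M X0 = 1" and f_X0: "f ` X0 = X0"
  using full by (auto simp: invariant_full_set_def)

lemma inv_f_X0: "inv f ` X0 = X0"
  using f_X0 f_inv by (metis bij_f bij_is_inj image_inv_f_f)

lemma funpow_X0: "x \<in> X0 \<Longrightarrow> (f ^^ n) x \<in> X0" "x \<in> X0 \<Longrightarrow> (inv f ^^ n) x \<in> X0"
proof -
  have "f y \<in> X0" "inv f y \<in> X0" if "y \<in> X0" for y
    using imageI[OF that, of f] imageI[OF that, of "inv f"] by (simp_all only: f_X0 inv_f_X0)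
  then show "x \<in> X0 \<Longrightarrow> (f ^^ n) x \<in> X0" "x \<in> X0 \<Longrightarrow> (inv f ^^ n) x \<in> X0"
    by (induction n) simp_all
qed

lemmas splitting_unfolded = splitting[unfolded splitting_properties_def]

lemmas split = splitting_unfolded[THEN conjunct1, THEN bspec]
  and E_properties = splitting_unfolded[THEN conjunct2, THEN conjunct1, THEN bspec]
  and F_properties = splitting_unfolded[THEN conjunct2, THEN conjunct2, THEN conjunct1, THEN bspec]
  and F_measurable = splitting_unfolded[THEN conjunct2, THEN conjunct2, THEN conjunct2]

lemmas E_dim = E_properties[THEN conjunct1]
  and A_E = E_properties[THEN conjunct2, THEN conjunct1, THEN bspec]
  and E_growth = E_properties[THEN conjunct2, THEN conjunct2, THEN conjunct1, THEN bspec, THEN bspec]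
  and E_measurable = E_properties[THEN conjunct2, THEN conjunct2, THEN conjunct2, THEN conjunct1]
  and E_tempered = E_properties[THEN conjunct2, THEN conjunct2, THEN conjunct2, THEN conjunct2,
    THEN bspec, THEN bspec]

lemmas F_closed = F_properties[THEN conjunct1]
  and F_finite_codim = F_properties[THEN conjunct2, THEN conjunct1]
  and A_F = F_properties[THEN conjunct2, THEN conjunct2, THEN conjunct1]
  and F_growth = F_properties[THEN conjunct2, THEN conjunct2, THEN conjunct2]

lemma E_finite_dim: "l \<in> {1..k} \<Longrightarrow> x \<in> X0 \<Longrightarrow> finite_dim (E l x)"
  using E_dim by blast

lemma V_E: "l \<in> {1..k} \<Longrightarrow> V x l = E l x" and V_F: "V x (Suc k) = F x"
  by (auto simp: summands_def)

lemma I_cases: "l \<in> I \<Longrightarrow> (l \<in> {1..k} \<Longrightarrow> P) \<Longrightarrow> (l = Suc k \<Longrightarrow> P) \<Longrightarrow> P"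
  by (cases "l = Suc k") auto

lemma A_image: assumes x: "x \<in> X0" and l: "l \<in> I" shows "blinfun_apply (A x) ` V x l = V (f x) l"
  using l
proof (rule I_cases)
  assume l: "l \<in> {1..k}"
  then show ?thesis using A_E[OF l x] by (simp add: V_E)
next
  assume l: "l = Suc k"
  then show ?thesis using A_F[OF x] by (simp add: V_F)
qed

lemma B_A: "blinfun_apply (B x) (blinfun_apply (A (inv f x)) v) = v"
  and A_B: "blinfun_apply (A (inv f x)) (blinfun_apply (B x) v) = v"
  using GL by (auto simp: backward_generator_def intro!: op_inv_apply)

lemma B_image: assumes x: "x \<in> X0" and l: "l \<in> I" shows "blinfun_apply (B x) ` V x l = V (inv f x) l"
proof -
  have "inv f x \<in> X0" using funpow_X0(2)[OF x, of 1] by simp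
  from A_image[OF this l] have "V x l = blinfun_apply (A (inv f x)) ` V (inv f x) l" by (simp add: f_inv)
  then show ?thesis by (simp add: image_image B_A)
qed

lemma fwd_proj: assumes x: "x \<in> X0" and l: "l \<in> I" shows "fwd x n (p x l v) = p ((f ^^ n) x) l (fwd x n v)"
  unfolding cocycle_eq_product_cocycle
proof (rule splitting_proj_equivariant[symmetric])
  show "blinfun_apply (product_cocycle f A x n) ` V x j \<subseteq> V ((f ^^ n) x) j" if "j \<in> I" for j
    using product_cocycle_image[of X0 A "\<lambda>x. V x j" f x n] A_image that f_X0 x by auto
qed (simp, rule split[OF x], rule split[OF funpow_X0(1)[OF x]], rule l,
    rule bounded_linear.linear[OF blinfun.bounded_linear_right])

lemma bwd_proj: assumes x: "x \<in> X0" and l: "l \<in> I" shows "bwd x n (p x l v) = p ((inv f ^^ n) x) l (bwd x n v)"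
  unfolding cocycle_eq_product_cocycle
proof (rule splitting_proj_equivariant[symmetric])
  show "blinfun_apply (product_cocycle (inv f) B x n) ` V x j \<subseteq> V ((inv f ^^ n) x) j" if "j \<in> I" for j
    using product_cocycle_image[of X0 B "\<lambda>x. V x j" "inv f" x n] B_image that inv_f_X0 x by auto
qed (simp, rule split[OF x], rule split[OF funpow_X0(2)[OF x]], rule l,
    rule bounded_linear.linear[OF blinfun.bounded_linear_right])

text \<open>\<open>hat_d\<close> needs nonempty unit spheres. For F this is where the infinite
  dimension of the space enters: a subspace of finite codimension cannot be trivial.\<close>

lemma V_nonzero: assumes x: "x \<in> X0" and l: "l \<in> I" shows "V x l \<noteq> {0}"
  using l
proof (rule I_cases)
  assume l: "l \<in> {1..k}"
  obtain m where "m > 0" "dim (E l x) = m" using E_dim[OF l] x by blast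
  moreover have "dim ({0} :: 'b set) = 0"
    by (metis card.empty dim_eq_card_independent dim_span independent_empty span_empty)
  ultimately show ?thesis using V_E[OF l, of x] by auto
next
  assume l: "l = Suc k"
  obtain S where S: "finite S" "span (F x \<union> S) = UNIV" using F_finite_codim[OF x] by (auto simp: finite_codim_def)
  show ?thesis
  proof
    assume "V x l = {0}"
    then have "span (insert 0 S) = UNIV" using S l by (simp add: V_F)
    then show False using infdim S(1) by (auto simp: finite_dim_def)
  qed
qed

section \<open>Bounds for the projections and the growth of their images\<close>

lemma proj_operator_bound:
  assumes x: "x \<in> X0" and l: "l \<in> {1..k}"
  shows "\<exists>S C. finite S \<and> S \<subseteq> E l x - {0} \<and> 0 \<le> C \<and>
    (\<forall>T::'b \<Rightarrow>\<^sub>L 'b. \<forall>v. norm (blinfun_apply T (p x l v)) \<le> C * (\<Sum>b\<in>S. norm (blinfun_apply T b)) * norm v)"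
proof -
  have "I - {1..k} = {Suc k}" by auto
  then show ?thesis
    using finite_dim_splitting_bound[OF _ split[OF x], of "{1..k}" l] l E_finite_dim[OF _ x] F_closed[OF x]
    by (auto simp: V_E V_F)
qed

lemma proj_bounded:
  assumes x: "x \<in> X0" and l: "l \<in> I"
  shows "\<exists>C\<ge>0. \<forall>v. norm (p x l v) \<le> C * norm v"
proof -
  have E: "\<exists>C\<ge>0. \<forall>v. norm (p x l v) \<le> C * norm v" if l: "l \<in> {1..k}" for l
  proof -
    obtain S C where "0 \<le> C" "\<And>T v. norm (blinfun_apply (T::'b \<Rightarrow>\<^sub>L 'b) (p x l v)) \<le> C * (\<Sum>b\<in>S. norm (blinfun_apply T b)) * norm v"
      using proj_operator_bound[OF x l] by blast
    from this(1) this(2)[of id_blinfun] show ?thesis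
      by (intro exI[of _ "C * (\<Sum>b\<in>S. norm b)"]) (auto intro!: mult_nonneg_nonneg sum_nonneg)
  qed
  from l show ?thesis
  proof (rule I_cases)
    \<comment> \<open>The projection onto F is the identity minus the projections onto the
      finite-dimensional summands.\<close>
    assume l: "l = Suc k"
    obtain C where C: "\<And>j. j \<in> {1..k} \<Longrightarrow> C j \<ge> 0 \<and> (\<forall>v. norm (p x j v) \<le> C j * norm v)"
      using E by metis
    have "norm (p x l v) \<le> (1 + (\<Sum>j=1..k. C j)) * norm v" for v
    proof -
      have "(\<Sum>j\<in>I. p x j v) = v" by (rule sum_splitting_proj[OF _ split[OF x]]) simp
      then have "p x l v = v - (\<Sum>j=1..k. p x j v)" by (simp add: l algebra_simps)
      then have "norm (p x l v) \<le> norm v + norm (\<Sum>j=1..k. p x j v)" by (metis norm_triangle_ineq4)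
      also have "norm (\<Sum>j=1..k. p x j v) \<le> (\<Sum>j=1..k. C j * norm v)"
        using C by (intro order_trans[OF norm_sum] sum_mono) auto
      finally show ?thesis by (simp add: distrib_right sum_distrib_right)
    qed
    moreover have "0 \<le> 1 + (\<Sum>j=1..k. C j)" using C by (intro add_nonneg_nonneg sum_nonneg) auto
    ultimately show ?thesis by blast
  qed (rule E)
qed

lemma proj_bounded_linear:
  assumes x: "x \<in> X0" and l: "l \<in> I" shows "bounded_linear (p x l)"
proof -
  obtain C where "\<And>v. norm (p x l v) \<le> C * norm v" using proj_bounded[OF x l] by blast
  moreover have "linear (p x l)" using splitting_proj_linear[OF _ split[OF x] l] by simp
  ultimately show ?thesis
    by (intro bounded_linear_intro[where K=C]) (auto simp: linear_add linear_scale mult.commute)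
qed

text \<open>The exponents are given vector by vector, with constants depending on the vector. Only
  finitely many basis vectors have to be followed, which makes the constant uniform in v. The
  sequence \<Phi> stands for either time direction.\<close>

lemma proj_growth_E:
  assumes x: "x \<in> X0" and l: "l \<in> {1..k}" and b: "c < b"
    and lim: "\<And>v. v \<in> E l x - {0} \<Longrightarrow> (\<lambda>n. ln (norm (blinfun_apply (\<Phi> n) v)) / real n) \<longlonglongrightarrow> c"
  shows "\<exists>C\<ge>0. \<forall>n v. norm (blinfun_apply (\<Phi> n :: 'b \<Rightarrow>\<^sub>L 'b) (p x l v)) \<le> C * exp (real n * b) * norm v"
proof -
  obtain S C where S: "finite S" "S \<subseteq> E l x - {0}" and C: "0 \<le> C"
    "\<And>T v. norm (blinfun_apply (T::'b \<Rightarrow>\<^sub>L 'b) (p x l v)) \<le> C * (\<Sum>b\<in>S. norm (blinfun_apply T b)) * norm v"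
    using proj_operator_bound[OF x l] by blast
  have "\<forall>s\<in>S. \<exists>D\<ge>0. \<forall>n. norm (blinfun_apply (\<Phi> n) s) \<le> D * exp (real n * b)"
    using S(2) by (intro ballI limit_rate_imp_exp_bound[OF _ lim b]) auto
  then obtain D where D: "\<And>s. s \<in> S \<Longrightarrow> D s \<ge> 0" "\<And>s n. s \<in> S \<Longrightarrow> norm (blinfun_apply (\<Phi> n) s) \<le> D s * exp (real n * b)"
    by metis
  show ?thesis
  proof (intro exI[of _ "C * (\<Sum>s\<in>S. D s)"] conjI allI)
    show "0 \<le> C * (\<Sum>s\<in>S. D s)" using C(1) D(1) by (intro mult_nonneg_nonneg sum_nonneg)
    fix n v
    have "norm (blinfun_apply (\<Phi> n) (p x l v)) \<le> C * (\<Sum>s\<in>S. norm (blinfun_apply (\<Phi> n) s)) * norm v" by (rule C)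
    also have "\<dots> \<le> C * (\<Sum>s\<in>S. D s * exp (real n * b)) * norm v"
      using C(1) D(2) by (intro mult_right_mono mult_left_mono sum_mono) auto
    finally show "norm (blinfun_apply (\<Phi> n) (p x l v)) \<le> C * (\<Sum>s\<in>S. D s) * exp (real n * b) * norm v"
      by (simp add: sum_distrib_right mult_ac)
  qed
qed

lemma fwd_growth:
  assumes x: "x \<in> X0" and l: "l \<in> I" and \<epsilon>: "\<epsilon> > 0"
  shows "\<exists>C\<ge>0. \<forall>n v. norm (fwd x n (p x l v)) \<le> C * exp (real n * (lam l + \<epsilon>)) * norm v"
  using l
proof (rule I_cases)
  assume l: "l \<in> {1..k}"
  show ?thesis
    by (rule proj_growth_E[OF x l, of "lam l"]) (use E_growth[OF l x] \<epsilon> in auto)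
next
  assume l': "l = Suc k"
  have subF: "subspace (F x)" using splitting_subspace[OF _ split[OF x], of "Suc k"] by (simp add: V_F)
  have "limsup (\<lambda>n. ereal (ln (restricted_norm (cocycle f A x (int n)) (F x)) / real n)) < ereal (lam (Suc k) + \<epsilon>)"
    by (rule le_less_trans[OF F_growth[OF x]]) (simp add: \<epsilon>)
  then have "\<forall>\<^sub>F n in sequentially. ln (restricted_norm (cocycle f A x (int n)) (F x)) / real n \<le> lam (Suc k) + \<epsilon>"
    by (rule Limsup_lessD[THEN eventually_mono]) auto
  then obtain C where C: "C \<ge> 0"
    "\<And>n. restricted_norm (cocycle f A x (int n)) (F x) \<le> C * exp (real n * (lam (Suc k) + \<epsilon>))"
    using rate_imp_exp_bound[of "\<lambda>n. restricted_norm (cocycle f A x (int n)) (F x)"]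
      restricted_norm_nonneg[OF subspace_0[OF subF]] by blast
  obtain D where D: "D \<ge> 0" "\<And>v. norm (p x l v) \<le> D * norm v" using proj_bounded[OF x l] by blast
  show ?thesis
  proof (intro exI[of _ "C * D"] conjI allI)
    fix n v
    have "p x l v \<in> F x" using splitting_proj_mem[OF _ split[OF x] l] by (simp add: l' V_F)
    then have "norm (fwd x n (p x l v)) \<le> restricted_norm (cocycle f A x (int n)) (F x) * norm (p x l v)"
      by (rule restricted_norm_upper[OF subF])
    also have "\<dots> \<le> (C * exp (real n * (lam (Suc k) + \<epsilon>))) * (D * norm v)"
      using C D by (intro mult_mono) auto
    finally show "norm (fwd x n (p x l v)) \<le> C * D * exp (real n * (lam l + \<epsilon>)) * norm v"
      by (simp add: l' mult_ac)
  qed (use C D in auto)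
qed

text \<open>Stops at k because the growth condition on F concerns forward time only.\<close>

lemma bwd_growth:
  assumes x: "x \<in> X0" and l: "l \<in> {1..k}" and \<epsilon>: "\<epsilon> > 0"
  shows "\<exists>C\<ge>0. \<forall>n v. norm (bwd x n (p x l v)) \<le> C * exp (real n * (- lam l + \<epsilon>)) * norm v"
  by (rule proj_growth_E[OF x l, of "- lam l"]) (use E_growth[OF l x] \<epsilon> in auto)

lemma proj_tempered:
  assumes x: "x \<in> X0" and l: "l \<in> I" and \<epsilon>: "\<epsilon> > 0"
  shows "\<exists>C\<ge>0. \<forall>n v. norm (p ((f ^^ n) x) l v) \<le> C * exp (real n * \<epsilon>) * norm v"
    and "\<exists>C\<ge>0. \<forall>n v. norm (p ((inv f ^^ n) x) l v) \<le> C * exp (real n * \<epsilon>) * norm v"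
proof -
  have gen: "\<exists>C\<ge>0. \<forall>n v. norm (p (z n) l v) \<le> C * exp (real n * \<epsilon>) * norm v"
    if z: "\<And>n. z n \<in> X0"
      and lim: "\<And>j. j \<in> {1..k} \<Longrightarrow> (\<lambda>n. ln (onorm (p (z n) j)) / real n) \<longlonglongrightarrow> 0" for z
  proof -
    have E: "\<exists>C\<ge>0. \<forall>n v. norm (p (z n) j v) \<le> C * exp (real n * \<epsilon>) * norm v" if j: "j \<in> {1..k}" for j
    proof -
      \<comment> \<open>\<open>onorm\<close> controls the projection only once the projection is
        known to be bounded.\<close>
      have bl: "bounded_linear (p (z n) j)" for n using proj_bounded_linear[OF z] j by simp
      obtain C where C: "C \<ge> 0" "\<And>n. onorm (p (z n) j) \<le> C * exp (real n * \<epsilon>)"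
        using limit_rate_imp_exp_bound[OF onorm_pos_le[OF bl] lim[OF j] \<epsilon>] by blast
      have "norm (p (z n) j v) \<le> C * exp (real n * \<epsilon>) * norm v" for n v
        using onorm[OF bl, of n v] mult_right_mono[OF C(2)[of n], of "norm v"] by simp
      then show ?thesis using C(1) by blast
    qed
    from l show ?thesis
    proof (rule I_cases)
      assume l: "l = Suc k"
      obtain C where C: "\<And>j. j \<in> {1..k} \<Longrightarrow> C j \<ge> 0 \<and> (\<forall>n v. norm (p (z n) j v) \<le> C j * exp (real n * \<epsilon>) * norm v)"
        using E by metis
      have "norm (p (z n) l v) \<le> (1 + (\<Sum>j=1..k. C j)) * exp (real n * \<epsilon>) * norm v" for n v
      proof -
        have "(\<Sum>j\<in>I. p (z n) j v) = v" by (rule sum_splitting_proj[OF _ split[OF z]]) simp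
        then have "p (z n) l v = v - (\<Sum>j=1..k. p (z n) j v)" by (simp add: l algebra_simps)
        then have "norm (p (z n) l v) \<le> norm v + norm (\<Sum>j=1..k. p (z n) j v)" by (metis norm_triangle_ineq4)
        also have "\<dots> \<le> exp (real n * \<epsilon>) * norm v + (\<Sum>j=1..k. C j * exp (real n * \<epsilon>) * norm v)"
        proof (rule add_mono)
          show "norm v \<le> exp (real n * \<epsilon>) * norm v"
            using \<epsilon> mult_right_mono[of 1 "exp (real n * \<epsilon>)" "norm v"] by simp
          show "norm (\<Sum>j=1..k. p (z n) j v) \<le> (\<Sum>j=1..k. C j * exp (real n * \<epsilon>) * norm v)"
            using C by (intro order_trans[OF norm_sum] sum_mono) auto
        qed
        finally show ?thesis by (simp add: distrib_right sum_distrib_right)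
      qed
      moreover have "0 \<le> 1 + (\<Sum>j=1..k. C j)" using C by (intro add_nonneg_nonneg sum_nonneg) auto
      ultimately show ?thesis by blast
    qed (rule E)
  qed
  have lim: "\<And>j. j \<in> {1..k} \<Longrightarrow>
      ((\<lambda>n. ln (onorm (p (int_iterate f n x) j)) / real_of_int n) \<longlongrightarrow> 0) at_top"
    "\<And>j. j \<in> {1..k} \<Longrightarrow>
      ((\<lambda>n. ln (onorm (p (int_iterate f n x) j)) / real_of_int n) \<longlongrightarrow> 0) at_bot"
    by (rule E_tempered[OF _ x], assumption, simp)+
  have it: "int_iterate f (int n) = f ^^ n" "int_iterate f (- int n) = inv f ^^ n" for n
    by (auto simp: int_iterate_def)
  show "\<exists>C\<ge>0. \<forall>n v. norm (p ((f ^^ n) x) l v) \<le> C * exp (real n * \<epsilon>) * norm v"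
  proof (rule gen)
    fix j assume "j \<in> {1..k}"
    from filterlim_compose[OF lim(1)[OF this] filterlim_int_sequentially]
    show "(\<lambda>n. ln (onorm (p ((f ^^ n) x) j)) / real n) \<longlonglongrightarrow> 0" by (simp add: it)
  qed (use funpow_X0 x in auto)
  show "\<exists>C\<ge>0. \<forall>n v. norm (p ((inv f ^^ n) x) l v) \<le> C * exp (real n * \<epsilon>) * norm v"
  proof (rule gen)
    fix j assume j: "j \<in> {1..k}"
    have "filterlim (\<lambda>n. - int n) at_bot sequentially"
      unfolding filterlim_at_bot
    proof
      fix Z
      show "\<forall>\<^sub>F n in sequentially. - int n \<le> Z"
        by (rule eventually_sequentiallyI[of "nat (- Z)"]) simp
    qed
    \<comment> \<open>In the limit at minus infinity the denominators are negative, hence the change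
      of sign.\<close>
    from tendsto_minus[OF filterlim_compose[OF lim(2)[OF j] this]]
    show "(\<lambda>n. ln (onorm (p ((inv f ^^ n) x) j)) / real n) \<longlonglongrightarrow> 0" by (simp add: it)
  qed (use funpow_X0 x in auto)
qed

lemma cocycle_continuous:
  "continuous_on UNIV (\<lambda>x. cocycle f A x (int n))" "continuous_on UNIV (\<lambda>x. cocycle f A x (- int n))"
proof -
  have gen: "continuous_on UNIV \<Phi>" if "\<And>x y. norm (\<Phi> x - \<Phi> y) \<le> c * dist x y powr \<nu>"
    for \<Phi> :: "'x \<Rightarrow> ('b \<Rightarrow>\<^sub>L 'b)" and c
    unfolding continuous_on_def
  proof
    fix x :: 'x
    have "((\<lambda>y. dist y x) \<longlongrightarrow> 0) (at x)"
      by (rule tendsto_eq_rhs[OF tendsto_dist[OF tendsto_ident_at tendsto_const]]) simp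
    then have "((\<lambda>y. dist y x powr \<nu>) \<longlongrightarrow> 0 powr \<nu>) (at x)"
      using \<nu> by (intro tendsto_powr') auto
    then have "((\<lambda>y. c * dist y x powr \<nu>) \<longlongrightarrow> 0) (at x)"
      using tendsto_mult[OF tendsto_const[of c]] by fastforce
    then have "((\<lambda>y. \<Phi> y - \<Phi> x) \<longlongrightarrow> 0) (at x)"
      by (rule Lim_null_comparison[rotated]) (simp add: that)
    then show "(\<Phi> \<longlongrightarrow> \<Phi> x) (at x)" by (simp add: LIM_zero_iff)
  qed
  show "continuous_on UNIV (\<lambda>x. cocycle f A x (int n))" "continuous_on UNIV (\<lambda>x. cocycle f A x (- int n))"
    by (rule gen, rule cocycle_holder)+
qed

section \<open>Two-sided exponential estimates at almost every point\<close>

lemma V_measurable: "l \<in> I \<Longrightarrow> (\<lambda>x. V x l) \<in> restrict_space M X0 \<rightarrow>\<^sub>M grassmannian_borel"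
proof (erule I_cases)
  assume l: "l \<in> {1..k}"
  then show ?thesis using E_measurable[OF l] by (simp add: V_E)
next
  assume l: "l = Suc k"
  then show ?thesis using F_measurable by (simp add: V_F)
qed

text \<open>Pesin-type estimates at \<open>x\<close>. The lower bounds hold for all \<open>v\<close>, not only for \<open>v \<in> V x l\<close>,
  because of the temperedness of the projections along the orbit.\<close>

definition regular :: "real \<Rightarrow> real \<Rightarrow> 'x \<Rightarrow> bool" where
  "regular \<epsilon> C x \<longleftrightarrow> (\<forall>n v. \<forall>l\<in>I.
     norm (fwd x n (p x l v)) \<le> C * exp (real n * (lam l + \<epsilon>)) * norm v \<and>
     norm (p x l v) \<le> C * exp (real n * (lam l + \<epsilon>)) * norm (bwd x n v) \<and>
     (l \<in> {1..k} \<longrightarrow>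
       norm (bwd x n (p x l v)) \<le> C * exp (real n * (- lam l + \<epsilon>)) * norm v \<and>
       norm (p x l v) \<le> C * exp (real n * (- lam l + \<epsilon>)) * norm (fwd x n v)))"

lemma regular_mono: "regular \<epsilon> C x \<Longrightarrow> C \<le> D \<Longrightarrow> regular \<epsilon> D x"
proof -
  assume *: "regular \<epsilon> C x" "C \<le> D"
  have "C * exp r * norm (u :: 'b) \<le> D * exp r * norm u" for r u
    using *(2) by (intro mult_right_mono) auto
  then show "regular \<epsilon> D x" using *(1) unfolding regular_def by (meson order_trans)
qed

text \<open>Two instances of \<open>AE_expansion_along_bundle\<close> with f and inv f exchanged.
  Backward expansion follows from forward growth, hence on every summand; forward expansion follows
  from backward growth, hence only on the finite-dimensional ones.\<close>

lemma AE_lower_bounds: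
  assumes \<epsilon>: "\<epsilon> > 0"
  shows "l \<in> I \<Longrightarrow> AE x in M. x \<in> X0 \<longrightarrow> (\<exists>C\<ge>0. \<forall>n. \<forall>v\<in>V x l. norm v \<le> C * exp (real n * (lam l + \<epsilon>)) * norm (bwd x n v))"
    and "l \<in> {1..k} \<Longrightarrow> AE x in M. x \<in> X0 \<longrightarrow> (\<exists>C\<ge>0. \<forall>n. \<forall>v\<in>V x l. norm v \<le> C * exp (real n * (- lam l + \<epsilon>)) * norm (fwd x n v))"
proof -
  have \<epsilon>2: "\<epsilon> / 2 > 0" using \<epsilon> by simp
  have half: "(c + \<epsilon> / 2) + \<epsilon> / 2 = c + \<epsilon>" for c by simp
  have fixed: "p x l v = v" if "x \<in> X0" "l \<in> I" "v \<in> V x l" for x l v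
    using splitting_proj_on[OF _ split[OF that(1)] that(2) that(2,3)] by simp
  show "AE x in M. x \<in> X0 \<longrightarrow> (\<exists>C\<ge>0. \<forall>n. \<forall>v\<in>V x l. norm v \<le> C * exp (real n * (lam l + \<epsilon>)) * norm (bwd x n v))"
    if l: "l \<in> I"
  proof -
    have "AE x in M. x \<in> X0 \<longrightarrow> (\<exists>C\<ge>0. \<forall>n. \<forall>v\<in>V x l.
      norm v \<le> C * exp (real n * ((lam l + \<epsilon> / 2) + \<epsilon> / 2)) * norm (blinfun_apply (product_cocycle (inv f) B x n) v))"
    proof (rule AE_expansion_along_bundle[OF cpt prob sets_M f_measure_preserving(3,4) f_inv(1)
          X0_measurable _ _ V_measurable[OF l] A_image[OF _ l] B_image[OF _ l] A_B _ _ a _ \<epsilon>2])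
      show "\<exists>C. \<forall>n. \<forall>v\<in>V x l. norm (blinfun_apply (product_cocycle f A x n) v) \<le> C * exp (real n * (lam l + \<epsilon> / 2)) * norm v"
        if x: "x \<in> X0" for x
      proof -
        obtain C where "\<And>n v. norm (fwd x n (p x l v)) \<le> C * exp (real n * (lam l + \<epsilon> / 2)) * norm v"
          using fwd_growth[OF x l \<epsilon>2] by blast
        from this[unfolded cocycle_eq_product_cocycle] fixed[OF x l]
        show ?thesis by (intro exI[of _ C] allI ballI) metis
      qed
    qed (use f_X0 inv_f_X0 cocycle_continuous cocycle_norm in \<open>simp_all only: cocycle_eq_product_cocycle order_refl\<close>)
    then show ?thesis unfolding half cocycle_eq_product_cocycle .
  qed
  show "AE x in M. x \<in> X0 \<longrightarrow> (\<exists>C\<ge>0. \<forall>n. \<forall>v\<in>V x l. norm v \<le> C * exp (real n * (- lam l + \<epsilon>)) * norm (fwd x n v))"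
    if l: "l \<in> {1..k}"
  proof -
    have lI: "l \<in> I" using l by auto
    have BA: "blinfun_apply (B (f x)) (blinfun_apply (A x) v) = v" for x v
      using B_A[of "f x" v] by (simp add: f_inv)
    have "AE x in M. x \<in> X0 \<longrightarrow> (\<exists>C\<ge>0. \<forall>n. \<forall>v\<in>V x l.
      norm v \<le> C * exp (real n * ((- lam l + \<epsilon> / 2) + \<epsilon> / 2)) * norm (blinfun_apply (product_cocycle f A x n) v))"
    proof (rule AE_expansion_along_bundle[OF cpt prob sets_M f_measure_preserving(1,2) f_inv(2)
          X0_measurable _ _ V_measurable[OF lI] B_image[OF _ lI] A_image[OF _ lI] BA _ _ a _ \<epsilon>2])
      show "\<exists>C. \<forall>n. \<forall>v\<in>V x l. norm (blinfun_apply (product_cocycle (inv f) B x n) v) \<le> C * exp (real n * (- lam l + \<epsilon> / 2)) * norm v"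
        if x: "x \<in> X0" for x
      proof -
        obtain C where "\<And>n v. norm (bwd x n (p x l v)) \<le> C * exp (real n * (- lam l + \<epsilon> / 2)) * norm v"
          using bwd_growth[OF x l \<epsilon>2] by blast
        from this[unfolded cocycle_eq_product_cocycle] fixed[OF x lI]
        show ?thesis by (intro exI[of _ C] allI ballI) metis
      qed
    qed (use f_X0 inv_f_X0 cocycle_continuous cocycle_norm in \<open>simp_all only: cocycle_eq_product_cocycle order_refl\<close>)
    then show ?thesis unfolding half cocycle_eq_product_cocycle .
  qed
qed

text \<open>Apply the lower bound on W to q v, move the projection to the far end of the orbit by
  equivariance, and bound it there by temperedness. Each of the two steps uses up
  \<epsilon>/2.\<close>

lemma proj_lower_bound:
  assumes p: "\<And>n v. T n (q v) = r n (T n v)" and mem: "\<And>v. q v \<in> W"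
    and lower: "\<exists>C\<ge>0. \<forall>n. \<forall>v\<in>W. norm v \<le> C * exp (real n * (b + \<epsilon> / 2)) * norm (T n v)"
    and tempered: "\<exists>C\<ge>0. \<forall>n v. norm (r n v) \<le> C * exp (real n * (\<epsilon> / 2)) * norm v"
  shows "\<exists>C\<ge>0. \<forall>n v. norm (q v) \<le> C * exp (real n * (b + \<epsilon>)) * norm (T n v)"
proof -
  obtain C D where C: "C \<ge> 0" "\<And>n v. v \<in> W \<Longrightarrow> norm v \<le> C * exp (real n * (b + \<epsilon> / 2)) * norm (T n v)"
    and D: "D \<ge> 0" "\<And>n v. norm (r n v) \<le> D * exp (real n * (\<epsilon> / 2)) * norm v"
    using lower tempered by blast
  have "norm (q v) \<le> C * D * exp (real n * (b + \<epsilon>)) * norm (T n v)" for n v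
  proof -
    have "norm (q v) \<le> C * exp (real n * (b + \<epsilon> / 2)) * norm (T n (q v))" by (rule C(2)[OF mem])
    also have "norm (T n (q v)) \<le> D * exp (real n * (\<epsilon> / 2)) * norm (T n v)" unfolding p by (rule D)
    also have "C * exp (real n * (b + \<epsilon> / 2)) * (D * exp (real n * (\<epsilon> / 2)) * norm (T n v))
        = C * D * (exp (real n * (b + \<epsilon> / 2)) * exp (real n * (\<epsilon> / 2))) * norm (T n v)" by (simp add: mult_ac)
    also have "exp (real n * (b + \<epsilon> / 2)) * exp (real n * (\<epsilon> / 2)) = exp (real n * (b + \<epsilon>))"
      by (simp add: exp_add[symmetric] algebra_simps)
    finally show ?thesis using C(1) by (simp add: mult_left_mono)
  qed
  then show ?thesis using C(1) D(1) by (intro exI[of _ "C * D"]) auto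
qed

lemma AE_regular:
  assumes \<epsilon>: "\<epsilon> > 0"
  shows "AE x in M. x \<in> X0 \<longrightarrow> (\<exists>C. regular \<epsilon> C x)"
proof -
  have \<epsilon>2: "\<epsilon> / 2 > 0" using \<epsilon> by simp
  have "AE x in M. \<forall>l\<in>I. x \<in> X0 \<longrightarrow> (\<exists>C\<ge>0. \<forall>n. \<forall>v\<in>V x l. norm v \<le> C * exp (real n * (lam l + \<epsilon> / 2)) * norm (bwd x n v))"
    using AE_lower_bounds(1)[OF \<epsilon>2] by (intro AE_finite_allI) auto
  moreover have "AE x in M. \<forall>l\<in>{1..k}. x \<in> X0 \<longrightarrow> (\<exists>C\<ge>0. \<forall>n. \<forall>v\<in>V x l. norm v \<le> C * exp (real n * (- lam l + \<epsilon> / 2)) * norm (fwd x n v))"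
    using AE_lower_bounds(2)[OF \<epsilon>2] by (intro AE_finite_allI) auto
  ultimately show ?thesis
  proof eventually_elim
    case (elim x)
    show ?case
    proof
      assume x: "x \<in> X0"
      have mem: "p x l v \<in> V x l" if "l \<in> I" for l v using splitting_proj_mem[OF _ split[OF x] that] by simp
      have 1: "\<exists>C\<ge>0. \<forall>n v. norm (fwd x n (p x l v)) \<le> C * exp (real n * (lam l + \<epsilon>)) * norm v" if l: "l \<in> I" for l
        by (rule fwd_growth[OF x l \<epsilon>])
      have 2: "\<exists>C\<ge>0. \<forall>n v. norm (p x l v) \<le> C * exp (real n * (lam l + \<epsilon>)) * norm (bwd x n v)" if l: "l \<in> I" for l
        by (rule proj_lower_bound[where T="bwd x" and q="p x l" and r="\<lambda>n. p ((inv f ^^ n) x) l" and W="V x l",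
             OF bwd_proj[OF x l] mem[OF l] _ proj_tempered(2)[OF x l \<epsilon>2]])
           (rule elim(1)[rule_format, OF l x])
      have 3: "\<exists>C\<ge>0. \<forall>n v. norm (bwd x n (p x l v)) \<le> C * exp (real n * (- lam l + \<epsilon>)) * norm v" if l: "l \<in> {1..k}" for l
        by (rule bwd_growth[OF x l \<epsilon>])
      have 4: "\<exists>C\<ge>0. \<forall>n v. norm (p x l v) \<le> C * exp (real n * (- lam l + \<epsilon>)) * norm (fwd x n v)" if l: "l \<in> {1..k}" for l
      proof -
        have lI: "l \<in> I" using l by auto
        show ?thesis
          by (rule proj_lower_bound[where T="fwd x" and q="p x l" and r="\<lambda>n. p ((f ^^ n) x) l" and W="V x l",
               OF fwd_proj[OF x lI] mem[OF lI] _ proj_tempered(1)[OF x lI \<epsilon>2]])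
             (rule elim(2)[rule_format, OF l x])
      qed
      obtain C1 where C1: "\<And>l. l \<in> I \<Longrightarrow> C1 l \<ge> 0 \<and> (\<forall>n v. norm (fwd x n (p x l v)) \<le> C1 l * exp (real n * (lam l + \<epsilon>)) * norm v)"
        using 1 by metis
      obtain C2 where C2: "\<And>l. l \<in> I \<Longrightarrow> C2 l \<ge> 0 \<and> (\<forall>n v. norm (p x l v) \<le> C2 l * exp (real n * (lam l + \<epsilon>)) * norm (bwd x n v))"
        using 2 by metis
      obtain C3 where C3: "\<And>l. l \<in> {1..k} \<Longrightarrow> C3 l \<ge> 0 \<and> (\<forall>n v. norm (bwd x n (p x l v)) \<le> C3 l * exp (real n * (- lam l + \<epsilon>)) * norm v)"
        using 3 by metis
      obtain C4 where C4: "\<And>l. l \<in> {1..k} \<Longrightarrow> C4 l \<ge> 0 \<and> (\<forall>n v. norm (p x l v) \<le> C4 l * exp (real n * (- lam l + \<epsilon>)) * norm (fwd x n v))"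
        using 4 by metis
      define C where "C = sum C1 I + sum C2 I + sum C3 {1..k} + sum C4 {1..k}"
      have s: "sum C1 I \<ge> 0" "sum C2 I \<ge> 0" "sum C3 {1..k} \<ge> 0" "sum C4 {1..k} \<ge> 0"
        by (rule sum_nonneg, rule conjunct1[OF C1] conjunct1[OF C2] conjunct1[OF C3] conjunct1[OF C4], assumption)+
      have mem_le: "c l \<le> sum c L" if "l \<in> L" "finite L" "\<And>j. j \<in> L \<Longrightarrow> 0 \<le> c j" for c :: "nat \<Rightarrow> real" and l L
        using that by (intro member_le_sum) auto
      note nonneg = conjunct1[OF C1] conjunct1[OF C2] conjunct1[OF C3] conjunct1[OF C4]
      have le: "C1 l \<le> C" "C2 l \<le> C" if l: "l \<in> I" for l
      proof -
        have "C1 l \<le> sum C1 I" "C2 l \<le> sum C2 I" by (rule mem_le[OF l finite_atLeastAtMost], rule nonneg, assumption)+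
        then show "C1 l \<le> C" "C2 l \<le> C" using s unfolding C_def by linarith+
      qed
      have le': "C3 l \<le> C" "C4 l \<le> C" if l: "l \<in> {1..k}" for l
      proof -
        have "C3 l \<le> sum C3 {1..k}" "C4 l \<le> sum C4 {1..k}" by (rule mem_le[OF l finite_atLeastAtMost], rule nonneg, assumption)+
        then show "C3 l \<le> C" "C4 l \<le> C" using s unfolding C_def by linarith+
      qed
      have mono: "c * exp r * norm (u :: 'b) \<le> C * exp r * norm u" if "c \<le> C" for c r u
        using that by (intro mult_right_mono) auto
      show "\<exists>C. regular \<epsilon> C x"
        unfolding regular_def
      proof (intro exI[of _ C] allI ballI conjI impI)
        fix n v l assume l: "l \<in> I"
        show "norm (fwd x n (p x l v)) \<le> C * exp (real n * (lam l + \<epsilon>)) * norm v"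
          using C1[OF l] mono[OF le(1)[OF l]] by (meson order_trans)
        show "norm (p x l v) \<le> C * exp (real n * (lam l + \<epsilon>)) * norm (bwd x n v)"
          using C2[OF l] mono[OF le(2)[OF l]] by (meson order_trans)
        assume l: "l \<in> {1..k}"
        show "norm (bwd x n (p x l v)) \<le> C * exp (real n * (- lam l + \<epsilon>)) * norm v"
          using C3[OF l] mono[OF le'(1)[OF l]] by (meson order_trans)
        show "norm (p x l v) \<le> C * exp (real n * (- lam l + \<epsilon>)) * norm (fwd x n v)"
          using C4[OF l] mono[OF le'(2)[OF l]] by (meson order_trans)
      qed
    qed
  qed
qed

end

section \<open>Hoelder continuity\<close>

text \<open>Regularity is used with \<epsilon> = \<Delta>/4: two rates at least \<Delta> apart, each
  off by \<Delta>/4, still leave decay by q = exp (-\<Delta>/2) per step. In Q, the factor a comes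
  from the distance between the cocycles and exp b from the rate in the lower bound. The value of
  \<omega> is the exponent delivered by \<open>geometric_balance\<close>.\<close>

locale oseledets_gap = oseledets_bundle f M A X0 k lam E F a \<nu>
  for f :: "'x::metric_space \<Rightarrow> 'x"
    and M :: "'x measure"
    and A :: "'x \<Rightarrow> ('b::banach \<Rightarrow>\<^sub>L 'b)"
    and X0 k lam E F a \<nu> +
  fixes \<Delta> b q Q \<omega> :: real
  assumes \<Delta>: "0 < \<Delta>" and gap: "\<And>l i. 1 \<le> l \<Longrightarrow> l < i \<Longrightarrow> i \<le> Suc k \<Longrightarrow> \<Delta> \<le> lam l - lam i"
    and b: "\<And>l. l \<in> {1..Suc k} \<Longrightarrow> \<bar>lam l\<bar> + \<Delta> / 4 \<le> b"
  defines "q \<equiv> exp (- \<Delta> / 2)" and "Q \<equiv> a * exp b" and "\<omega> \<equiv> ln q / (ln q - ln Q)"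
begin

abbreviation "reg \<equiv> regular (\<Delta> / 4)"

lemma q: "0 < q" "q < 1" and Q: "1 < Q" and \<omega>: "0 < \<omega>" "\<omega> < 1"
proof -
  show q: "0 < q" "q < 1" using \<Delta> by (auto simp: q_def)
  have "b > 0" using b[of 1] \<Delta> by auto
  then have "1 < 1 * exp b" by simp
  also have "1 * exp b \<le> a * exp b" using a by (intro mult_right_mono) auto
  finally show Q: "1 < Q" by (simp add: Q_def)
  have "ln Q > 0" "ln q < 0" using Q q by auto
  then show "0 < \<omega>" "\<omega> < 1" by (auto simp: \<omega>_def divide_simps)
qed

text \<open>Along the orbit of \<open>x\<close> the vector \<open>p y i v\<close> grows like \<open>lam i\<close>, up to the distance between the
  cocycles at \<open>x\<close> and \<open>y\<close>, while its component in \<open>V x l\<close> would grow like \<open>lam l\<close>.\<close>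

lemma cross_projection:
  assumes x: "reg C x" and y: "reg C y" and C: "0 \<le> C"
    and l: "l \<in> I" and i: "i \<in> I" and li: "l \<noteq> i" and xy: "0 < dist x y" "dist x y \<le> 1"
  shows "norm (p x l (p y i v)) \<le> 2 * C\<^sup>2 / q * dist x y powr (\<nu> * \<omega>) * norm v"
proof -
  let ?s = "dist x y powr \<nu>" and ?w = "p y i v"
  have s: "0 < ?s" "?s \<le> 1" using xy \<nu> by (auto simp: powr_le1)
  \<comment> \<open>The case n = 0 of regularity bounds the projection itself by C.\<close>
  have w: "norm ?w \<le> C * norm v"
    using y i unfolding regular_def by (metis cocycle_eq_product_cocycle(1) product_cocycle.simps(1)
      blinfun_apply_id_blinfun id_apply mult_zero_left exp_zero mult.right_neutral of_nat_0)
  \<comment> \<open>\<Phi> is the cocycle in either time direction; c and d are the rate in the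
    lower bound at x and the rate in the upper bound at y.\<close>
  have main: "norm (p x l ?w) \<le> (C\<^sup>2 * norm v) * (q ^ n + Q ^ n * ?s)"
    if lower: "norm (p x l ?w) \<le> C * exp (real n * (c + \<Delta> / 4)) * norm (blinfun_apply (\<Phi> x) ?w)"
      and upper: "norm (blinfun_apply (\<Phi> y) ?w) \<le> C * exp (real n * (d + \<Delta> / 4)) * norm v"
      and hol: "norm (\<Phi> x - \<Phi> y) \<le> a ^ n * ?s"
      and cd: "c + d \<le> - \<Delta>" and c: "c + \<Delta> / 4 \<le> b"
    for n c d and \<Phi> :: "'x \<Rightarrow> ('b \<Rightarrow>\<^sub>L 'b)"
  proof -
    have "blinfun_apply (\<Phi> x) ?w = blinfun_apply (\<Phi> y) ?w + blinfun_apply (\<Phi> x - \<Phi> y) ?w"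
      by (simp add: blinfun.diff_left)
    then have "norm (blinfun_apply (\<Phi> x) ?w) \<le> norm (blinfun_apply (\<Phi> y) ?w) + norm (blinfun_apply (\<Phi> x - \<Phi> y) ?w)"
      by (metis norm_triangle_ineq)
    also have "\<dots> \<le> C * exp (real n * (d + \<Delta> / 4)) * norm v + (a ^ n * ?s) * (C * norm v)"
    proof (intro add_mono upper)
      have "norm (blinfun_apply (\<Phi> x - \<Phi> y) ?w) \<le> norm (\<Phi> x - \<Phi> y) * norm ?w" by (rule norm_blinfun)
      also have "\<dots> \<le> (a ^ n * ?s) * (C * norm v)" using hol w a by (intro mult_mono) auto
      finally show "norm (blinfun_apply (\<Phi> x - \<Phi> y) ?w) \<le> (a ^ n * ?s) * (C * norm v)" .
    qed
    finally have 1: "norm (blinfun_apply (\<Phi> x) ?w) \<le> C * norm v * (exp (real n * (d + \<Delta> / 4)) + a ^ n * ?s)"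
      by (simp add: algebra_simps)
    have "norm (p x l ?w) \<le> C * exp (real n * (c + \<Delta> / 4)) * (C * norm v * (exp (real n * (d + \<Delta> / 4)) + a ^ n * ?s))"
      using C by (intro order_trans[OF lower] mult_left_mono 1) auto
    also have "\<dots> = (C\<^sup>2 * norm v) * (exp (real n * (c + \<Delta> / 4)) * exp (real n * (d + \<Delta> / 4)) +
        exp (real n * (c + \<Delta> / 4)) * a ^ n * ?s)"
      by (simp add: algebra_simps power2_eq_square)
    also have "\<dots> \<le> (C\<^sup>2 * norm v) * (q ^ n + Q ^ n * ?s)"
    proof (intro mult_left_mono add_mono mult_right_mono)
      have "real n * (c + \<Delta> / 4 + (d + \<Delta> / 4)) \<le> real n * (- \<Delta> / 2)"
        using cd by (intro mult_left_mono) auto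
      then have "real n * (c + \<Delta> / 4) + real n * (d + \<Delta> / 4) \<le> real n * (- \<Delta> / 2)"
        by (simp only: distrib_left)
      then show "exp (real n * (c + \<Delta> / 4)) * exp (real n * (d + \<Delta> / 4)) \<le> q ^ n"
        by (simp only: q_def exp_of_nat_mult[symmetric] exp_add[symmetric] exp_le_cancel_iff)
      have "real n * (c + \<Delta> / 4) \<le> real n * b" using c by (intro mult_left_mono) auto
      then have "exp (real n * (c + \<Delta> / 4)) * a ^ n \<le> exp (real n * b) * a ^ n"
        using a by (intro mult_right_mono) auto
      then show "exp (real n * (c + \<Delta> / 4)) * a ^ n \<le> Q ^ n"
        by (simp add: Q_def power_mult_distrib exp_of_nat_mult[symmetric] mult.commute)
    qed auto
    finally show ?thesis .
  qed
  \<comment> \<open>The time direction is the one in which V x l outgrows V y i. If i = Suc k this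
    is forward, so the backward growth of F is never called for; if l = Suc k it is backward, where
    regularity does include a lower bound for F.\<close>
  have "norm (p x l ?w) \<le> (C\<^sup>2 * norm v) * (q ^ n + Q ^ n * ?s)" for n
  proof (cases "l < i")
    case True
    then have l': "l \<in> {1..k}" using l i by auto
    show ?thesis
    proof (rule main[where c="- lam l" and d="lam i"])
      show "norm (p x l ?w) \<le> C * exp (real n * (- lam l + \<Delta> / 4)) * norm (fwd x n ?w)"
        using x l l' unfolding regular_def by blast
      show "norm (fwd y n ?w) \<le> C * exp (real n * (lam i + \<Delta> / 4)) * norm v"
        using y i unfolding regular_def by blast
      show "- lam l + lam i \<le> - \<Delta>" using gap[of l i] True l i by auto
      show "- lam l + \<Delta> / 4 \<le> b" using b[OF l] by auto
    qed (rule cocycle_holder)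
  next
    case False
    then have i': "i \<in> {1..k}" "i < l" using l i li by auto
    show ?thesis
    proof (rule main[where c="lam l" and d="- lam i"])
      show "norm (p x l ?w) \<le> C * exp (real n * (lam l + \<Delta> / 4)) * norm (bwd x n ?w)"
        using x l unfolding regular_def by blast
      show "norm (bwd y n ?w) \<le> C * exp (real n * (- lam i + \<Delta> / 4)) * norm v"
        using y i i' unfolding regular_def by blast
      show "lam l + - lam i \<le> - \<Delta>" using gap[of i l] i' l i by auto
      show "lam l + \<Delta> / 4 \<le> b" using b[OF l] by auto
    qed (rule cocycle_holder)
  qed
  then have "norm (p x l ?w) \<le> 2 * (C\<^sup>2 * norm v) / q * ?s powr (ln q / (ln q - ln Q))"
    by (intro geometric_balance q Q s) auto
  then show ?thesis by (simp add: powr_powr \<omega>_def[symmetric] mult_ac)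
qed

lemma proj_sum: "x \<in> X0 \<Longrightarrow> (\<Sum>l\<in>I. p x l v) = v"
  using sum_splitting_proj[OF _ split] by simp

lemma proj_linear: "x \<in> X0 \<Longrightarrow> l \<in> I \<Longrightarrow> linear (p x l)"
  using splitting_proj_linear[OF _ split] by simp

lemma cross_projection_sum:
  assumes x: "reg C x" and y: "reg C y" "y \<in> X0" and C: "0 \<le> C"
    and xy: "0 < dist x y" "dist x y \<le> 1" and i: "i \<in> I"
  shows "norm (\<Sum>l\<in>I - {i}. p x l (p y i v)) \<le> real k * (2 * C\<^sup>2 / q) * dist x y powr (\<nu> * \<omega>) * norm v"
proof -
  have "norm (\<Sum>l\<in>I - {i}. p x l (p y i v)) \<le> (\<Sum>l\<in>I - {i}. 2 * C\<^sup>2 / q * dist x y powr (\<nu> * \<omega>) * norm v)"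
    using i by (intro order_trans[OF norm_sum] sum_mono cross_projection[OF x y(1) C _ _ _ xy]) auto
  also have "\<dots> = real k * (2 * C\<^sup>2 / q) * dist x y powr (\<nu> * \<omega>) * norm v"
    using i by simp
  finally show ?thesis .
qed

text \<open>Expand v by the projections at y in the first term, and p y l v by those at x in the
  second. The diagonal terms \<open>p x l (p y l v)\<close> cancel and only cross projections
  remain. This yields continuity of the projections on regular sets.\<close>

lemma proj_diff:
  assumes x: "reg C x" "x \<in> X0" and y: "reg C y" "y \<in> X0" and C: "0 \<le> C"
    and xy: "0 < dist x y" "dist x y \<le> 1" and l: "l \<in> I"
  shows "norm (p x l v - p y l v) \<le> 2 * real k * (2 * C\<^sup>2 / q) * dist x y powr (\<nu> * \<omega>) * norm v"
proof -
  let ?K = "2 * C\<^sup>2 / q * dist x y powr (\<nu> * \<omega>) * norm v"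
  have "p x l v = (\<Sum>i\<in>I. p x l (p y i v))"
    using linear_sum[OF proj_linear[OF x(2) l], of "\<lambda>i. p y i v" I] proj_sum[OF y(2), of v] by simp
  moreover have "p y l v = (\<Sum>i\<in>I. p x i (p y l v))" by (rule proj_sum[OF x(2), symmetric])
  ultimately have "p x l v - p y l v = (\<Sum>i\<in>I. p x l (p y i v)) - (\<Sum>i\<in>I. p x i (p y l v))" by metis
  also have "\<dots> = (\<Sum>i\<in>I - {l}. p x l (p y i v)) - (\<Sum>i\<in>I - {l}. p x i (p y l v))"
    unfolding sum.remove[OF finite_atLeastAtMost l] by simp
  finally have eq: "p x l v - p y l v = (\<Sum>i\<in>I - {l}. p x l (p y i v)) - (\<Sum>i\<in>I - {l}. p x i (p y l v))" .
  have "norm (\<Sum>i\<in>I - {l}. p x l (p y i v)) \<le> (\<Sum>i\<in>I - {l}. ?K)"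
    using l by (intro order_trans[OF norm_sum] sum_mono cross_projection[OF x(1) y(1) C _ _ _ xy]) auto
  then have "norm (\<Sum>i\<in>I - {l}. p x l (p y i v)) \<le> real k * ?K" using l by simp
  moreover have "norm (\<Sum>i\<in>I - {l}. p x i (p y l v)) \<le> real k * ?K"
    using cross_projection_sum[OF x(1) y C xy l] by (simp add: mult_ac)
  ultimately have "norm (p x l v - p y l v) \<le> real k * ?K + real k * ?K"
    unfolding eq by (intro order_trans[OF norm_triangle_ineq4] add_mono)
  then show ?thesis by (simp add: algebra_simps)
qed

text \<open>Regularity of x with some constant D, however large, makes the projections converge
  along xs. The inequalities with the original constant C then pass to the limit, so x inherits
  C.\<close>

lemma regular_limit:
  assumes xs: "\<And>m. reg C (xs m)" "\<And>m. xs m \<in> X0" "xs \<longlonglongrightarrow> x" and x: "x \<in> X0" "reg D x"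
  shows "reg C x"
proof -
  \<comment> \<open>A common constant, to be used only for the convergence of the
    projections.\<close>
  define K where "K = max 0 (max C D)"
  have K: "0 \<le> K" "reg K x" "\<And>m. reg K (xs m)"
    using regular_mono[OF x(2), of K] regular_mono[OF xs(1), of K] by (auto simp: K_def)
  have dist0: "(\<lambda>m. dist (xs m) x) \<longlonglongrightarrow> 0" by (rule tendsto_dist_iff[THEN iffD1, OF xs(3)])
  have lim: "(\<lambda>m. p (xs m) l v) \<longlonglongrightarrow> p x l v" if l: "l \<in> I" for l v
  proof -
    let ?c = "2 * real k * (2 * K\<^sup>2 / q)"
    have "(\<lambda>m. dist (xs m) x powr (\<nu> * \<omega>)) \<longlonglongrightarrow> 0 powr (\<nu> * \<omega>)"
      using \<nu> \<omega> by (intro tendsto_powr' dist0 tendsto_const) auto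
    then have "(\<lambda>m. dist (xs m) x powr (\<nu> * \<omega>)) \<longlonglongrightarrow> 0" by simp
    then have z: "(\<lambda>m. ?c * dist (xs m) x powr (\<nu> * \<omega>) * norm v) \<longlonglongrightarrow> 0"
      by (intro tendsto_mult_left_zero tendsto_mult_right_zero)
    have "\<forall>\<^sub>F m in sequentially. dist (xs m) x < 1" using order_tendstoD(2)[OF dist0] by simp
    then have "\<forall>\<^sub>F m in sequentially. norm (p (xs m) l v - p x l v) \<le> ?c * dist (xs m) x powr (\<nu> * \<omega>) * norm v"
    proof eventually_elim
      case (elim m)
      show ?case
      proof (cases "xs m = x")
        case False
        then show ?thesis using elim by (intro proj_diff K xs x l) auto
      qed (use K q in simp)
    qed
    then have "(\<lambda>m. p (xs m) l v - p x l v) \<longlonglongrightarrow> 0" by (rule Lim_null_comparison[OF _ z])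
    then show ?thesis by (simp add: LIM_zero_iff)
  qed
  have fwd_lim: "(\<lambda>m. cocycle f A (xs m) (int n)) \<longlonglongrightarrow> cocycle f A x (int n)"
    and bwd_lim: "(\<lambda>m. cocycle f A (xs m) (- int n)) \<longlonglongrightarrow> cocycle f A x (- int n)" for n
    by (rule continuous_on_tendsto_compose[OF cocycle_continuous(1) xs(3)], simp, simp)
       (rule continuous_on_tendsto_compose[OF cocycle_continuous(2) xs(3)], simp, simp)
  show ?thesis
    unfolding regular_def
  proof (intro allI ballI conjI impI)
    fix n v l assume l: "l \<in> I"
    note tend = tendsto_norm tendsto_mult_left lim[OF l] fwd_lim bwd_lim blinfun.tendsto tendsto_const
    have T: "(\<lambda>m. norm (fwd (xs m) n (p (xs m) l v))) \<longlonglongrightarrow> norm (fwd x n (p x l v))"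
      "(\<lambda>m. norm (bwd (xs m) n (p (xs m) l v))) \<longlonglongrightarrow> norm (bwd x n (p x l v))"
      "(\<lambda>m. norm (p (xs m) l v)) \<longlonglongrightarrow> norm (p x l v)"
      "\<And>c. (\<lambda>m. c * norm (fwd (xs m) n v)) \<longlonglongrightarrow> c * norm (fwd x n v)"
      "\<And>c. (\<lambda>m. c * norm (bwd (xs m) n v)) \<longlonglongrightarrow> c * norm (bwd x n v)"
      by (intro tend)+
    have R: "norm (fwd (xs m) n (p (xs m) l v)) \<le> C * exp (real n * (lam l + \<Delta> / 4)) * norm v"
      "norm (p (xs m) l v) \<le> C * exp (real n * (lam l + \<Delta> / 4)) * norm (bwd (xs m) n v)" for m
      using xs(1)[of m] l unfolding regular_def by blast+
    show "norm (fwd x n (p x l v)) \<le> C * exp (real n * (lam l + \<Delta> / 4)) * norm v"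
      by (rule LIMSEQ_le_const2[OF T(1)]) (intro exI allI impI R)
    show "norm (p x l v) \<le> C * exp (real n * (lam l + \<Delta> / 4)) * norm (bwd x n v)"
      by (rule LIMSEQ_le[OF T(3) T(5)]) (intro exI allI impI R)
    assume l': "l \<in> {1..k}"
    have S: "norm (bwd (xs m) n (p (xs m) l v)) \<le> C * exp (real n * (- lam l + \<Delta> / 4)) * norm v"
      "norm (p (xs m) l v) \<le> C * exp (real n * (- lam l + \<Delta> / 4)) * norm (fwd (xs m) n v)" for m
      using xs(1)[of m] l l' unfolding regular_def by blast+
    show "norm (bwd x n (p x l v)) \<le> C * exp (real n * (- lam l + \<Delta> / 4)) * norm v"
      by (rule LIMSEQ_le_const2[OF T(2)]) (intro exI allI impI S)
    show "norm (p x l v) \<le> C * exp (real n * (- lam l + \<Delta> / 4)) * norm (fwd x n v)"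
      by (rule LIMSEQ_le[OF T(3) T(4)]) (intro exI allI impI S)
  qed
qed

text \<open>By \<open>regular_limit\<close> the regularity sets are relatively closed in a set of full measure, which
  makes them measurable without any joint measurability of the subspaces.\<close>

lemma regular_compact:
  assumes \<gamma>: "\<gamma> > 0"
  shows "\<exists>\<Lambda> C. compact \<Lambda> \<and> \<Lambda> \<subseteq> X0 \<and> measure M \<Lambda> > 1 - \<gamma> \<and> 0 \<le> C \<and> (\<forall>x\<in>\<Lambda>. reg C x)"
proof -
  interpret prob_space M by (rule prob)
  have "AE x in M. x \<in> X0 \<longrightarrow> (\<exists>C. reg C x)" using AE_regular \<Delta> by simp
  then obtain N where N: "N \<in> null_sets M" "{x\<in>space M. \<not> (x \<in> X0 \<longrightarrow> (\<exists>C. reg C x))} \<subseteq> N"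
    by (auto simp: eventually_ae_filter)
  have N2: "\<exists>C. reg C x" if "x \<in> X0" "x \<notin> N" for x using N(2) that space_M by blast
  \<comment> \<open>Every point of X1 is regular with some constant, which is what
    \<open>regular_limit\<close> demands of the limit point.\<close>
  define X1 where "X1 = X0 - N"
  have X1: "X1 \<in> sets M" using X0_measurable N(1) by (auto simp: X1_def)
  have "measure M X1 = 1"
    using X0_full measure_Diff_null_set[OF X0_measurable N(1)] by (simp add: X1_def)
  define R where "R m = {x\<in>X1. reg (real m) x}" for m :: nat
  have "R m = X1 \<inter> closure (R m)" for m
  proof
    show "R m \<subseteq> X1 \<inter> closure (R m)" using closure_subset[of "R m"] by (auto simp: R_def)
    show "X1 \<inter> closure (R m) \<subseteq> R m"
    proof
      fix x assume x: "x \<in> X1 \<inter> closure (R m)"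
      then obtain xs where xs: "\<And>j. xs j \<in> R m" "xs \<longlonglongrightarrow> x" by (auto simp: closure_sequential)
      obtain D where "reg D x" using x N2 by (auto simp: X1_def)
      then have "reg (real m) x"
        using xs x by (intro regular_limit[of "real m" xs x D]) (auto simp: R_def X1_def)
      then show "x \<in> R m" using x by (simp add: R_def)
    qed
  qed
  moreover have "X1 \<inter> closure (R m) \<in> sets M" for m
    using X1 by (intro sets.Int) (auto simp: sets_M)
  ultimately have Rm: "R m \<in> sets M" for m by metis
  have "incseq R" unfolding R_def incseq_def using regular_mono by fastforce
  then have "(\<lambda>m. measure M (R m)) \<longlonglongrightarrow> measure M (\<Union>m. R m)"
    using Rm by (intro finite_Lim_measure_incseq) auto
  moreover have "(\<Union>m. R m) = X1"
  proof
    show "X1 \<subseteq> (\<Union>m. R m)"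
    proof
      fix x assume x: "x \<in> X1"
      then obtain C where "reg C x" using N2 by (auto simp: X1_def)
      then have "reg (real (nat \<lceil>C\<rceil>)) x" by (rule regular_mono) linarith
      then show "x \<in> (\<Union>m. R m)" using x by (auto simp: R_def)
    qed
  qed (auto simp: R_def)
  ultimately have "(\<lambda>m. measure M (R m)) \<longlonglongrightarrow> 1" using \<open>measure M X1 = 1\<close> by simp
  then have "\<forall>\<^sub>F m in sequentially. 1 - \<gamma> / 2 < measure M (R m)"
    using \<gamma> by (intro order_tendstoD(1)) auto
  then obtain m where m: "1 - \<gamma> / 2 < measure M (R m)" by (auto simp: eventually_sequentially)
  \<comment> \<open>Half of \<gamma> went into the choice of m; the other half pays for passing to a
    closed subset.\<close>
  obtain \<Lambda> U where \<Lambda>: "closed \<Lambda>" "open U" "\<Lambda> \<subseteq> R m" "R m \<subseteq> U" "measure M (U - \<Lambda>) < \<gamma> / 2"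
    using borel_closed_open_approximation[OF finite_measure_axioms sets_M Rm, of "\<gamma> / 2" m] \<gamma> by auto
  have L: "\<Lambda> \<in> sets M" "U \<in> sets M" using \<Lambda> by (auto simp: sets_M)
  have "measure M (R m) \<le> measure M (\<Lambda> \<union> (U - \<Lambda>))"
    using \<Lambda> L by (intro finite_measure_mono) auto
  also have "\<dots> \<le> measure M \<Lambda> + measure M (U - \<Lambda>)" using L by (intro measure_Un_le) auto
  finally have "measure M \<Lambda> > 1 - \<gamma>" using m \<Lambda>(5) by simp
  moreover have "compact \<Lambda>" using compact_Int_closed[OF cpt \<Lambda>(1)] by simp
  ultimately show ?thesis using \<Lambda>(3) by (intro exI[of _ \<Lambda>] exI[of _ "real m"]) (auto simp: R_def X1_def)
qed

lemma hat_d_holder: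
  assumes \<Lambda>: "\<Lambda> \<subseteq> X0" "\<And>x. x \<in> \<Lambda> \<Longrightarrow> reg C x" and C: "0 \<le> C"
  shows "\<exists>K \<delta>. K > 0 \<and> \<delta> > 0 \<and> (\<forall>x\<in>\<Lambda>. \<forall>y\<in>\<Lambda>. dist x y < \<delta> \<longrightarrow>
    (\<forall>i\<in>I. hat_d (V x i) (V y i) \<le> K * dist x y powr (\<nu> * \<omega>)))"
proof -
  \<comment> \<open>The bound of \<open>cross_projection_sum\<close>, increased by 1 so that it is
    positive even for C = 0.\<close>
  define H where "H = real k * (2 * C\<^sup>2 / q) + 1"
  have H: "H > 0" using q by (auto simp: H_def intro!: add_nonneg_pos)
  have \<nu>\<omega>: "\<nu> * \<omega> > 0" using \<nu> \<omega> by simp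
  \<comment> \<open>The bound 1 is required for cross projections; the power makes H
    d(x,y)^(\<nu>\<omega>) at most 1/2, as \<open>hat_d_le\<close> demands.\<close>
  define \<delta> where "\<delta> = min 1 ((1 / (2 * H)) powr (1 / (\<nu> * \<omega>)))"
  have \<delta>: "\<delta> > 0" using H by (simp add: \<delta>_def)
  have close: "\<exists>w\<in>V y i. norm (v - w) \<le> H * dist x y powr (\<nu> * \<omega>)"
    if x: "x \<in> \<Lambda>" and y: "y \<in> \<Lambda>" and d: "dist x y < \<delta>" and i: "i \<in> I" and v: "v \<in> V x i" "norm v = 1"
    for x y i v
  proof (cases "x = y")
    case True
    then show ?thesis using v by (intro bexI[of _ v]) auto
  next
    case False
    have X: "x \<in> X0" "y \<in> X0" "reg C x" "reg C y" using x y \<Lambda> by auto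
    have pv: "p x i v = v" using splitting_proj_on[OF _ split[OF X(1)] i i v(1)] by simp
    \<comment> \<open>The nearby vector is the projection of v at y: since v = p x i v, the
      difference v - p y i v consists of cross projections only.\<close>
    show ?thesis
    proof (rule bexI[of _ "p y i v"])
      show "p y i v \<in> V y i" using splitting_proj_mem[OF _ split[OF X(2)] i] by simp
      have "v - p y i v = (\<Sum>l\<in>I - {i}. p y l v)"
        using proj_sum[OF X(2), of v] unfolding sum.remove[OF finite_atLeastAtMost i] by (simp add: algebra_simps)
      then have "norm (v - p y i v) = norm (\<Sum>l\<in>I - {i}. p y l (p x i v))" by (simp only: pv)
      also have "\<dots> \<le> real k * (2 * C\<^sup>2 / q) * dist y x powr (\<nu> * \<omega>) * norm v"
        using False d by (intro cross_projection_sum X C i) (auto simp: dist_commute \<delta>_def)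
      also have "\<dots> \<le> H * dist x y powr (\<nu> * \<omega>)"
        unfolding v(2) H_def dist_commute[of y x] mult_1_right by (intro mult_right_mono) auto
      finally show "norm (v - p y i v) \<le> H * dist x y powr (\<nu> * \<omega>)" .
    qed
  qed
  show ?thesis
  proof (rule exI[of _ "2 * H"], rule exI[of _ \<delta>], intro conjI ballI impI)
    fix x y i assume x: "x \<in> \<Lambda>" and y: "y \<in> \<Lambda>" and d: "dist x y < \<delta>" and i: "i \<in> I"
    have X: "x \<in> X0" "y \<in> X0" using x y \<Lambda> by auto
    have "dist x y powr (\<nu> * \<omega>) \<le> ((1 / (2 * H)) powr (1 / (\<nu> * \<omega>))) powr (\<nu> * \<omega>)"
      using d \<nu>\<omega> by (intro powr_mono2) (auto simp: \<delta>_def)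
    also have "\<dots> = 1 / (2 * H)" using H \<nu> \<omega> by (simp add: powr_powr)
    finally have "H * dist x y powr (\<nu> * \<omega>) \<le> H * (1 / (2 * H))" using H by (intro mult_left_mono) auto
    then have half: "H * dist x y powr (\<nu> * \<omega>) \<le> 1 / 2" using H by simp
    have sub: "subspace (V x i)" "subspace (V y i)"
      using splitting_subspace[OF _ split[OF X(1)] i] splitting_subspace[OF _ split[OF X(2)] i] by simp_all
    have "hat_d (V x i) (V y i) \<le> 2 * (H * dist x y powr (\<nu> * \<omega>))"
    proof (rule hat_d_le[OF sub(1) V_nonzero[OF X(1) i] sub(2) V_nonzero[OF X(2) i] _ half])
      show "\<exists>w\<in>V y i. norm (v - w) \<le> H * dist x y powr (\<nu> * \<omega>)" if "v \<in> V x i" "norm v = 1" for v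
        by (rule close[OF x y d i that])
      show "\<exists>v\<in>V x i. norm (w - v) \<le> H * dist x y powr (\<nu> * \<omega>)" if "w \<in> V y i" "norm w = 1" for w
        using close[OF y x _ i that] d by (simp add: dist_commute)
    qed (use H in simp)
    then show "hat_d (V x i) (V y i) \<le> 2 * H * dist x y powr (\<nu> * \<omega>)" by (simp add: mult_ac)
  qed (use H \<delta> in auto)
qed

lemma holder_conclusion:
  assumes "\<gamma> > 0"
  shows "\<exists>\<Lambda> C \<delta>. compact \<Lambda> \<and> \<Lambda> \<subseteq> X0 \<and> measure M \<Lambda> > 1 - \<gamma> \<and> C > 0 \<and> \<delta> > 0 \<and>
    (\<forall>x\<in>\<Lambda>. \<forall>y\<in>\<Lambda>. dist x y < \<delta> \<longrightarrow>
      (\<forall>i\<in>{1..k}. hat_d (E i x) (E i y) \<le> C * dist x y powr (\<nu> * \<omega>)) \<and>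
      hat_d (F x) (F y) \<le> C * dist x y powr (\<nu> * \<omega>))"
proof -
  obtain \<Lambda> C where \<Lambda>: "compact \<Lambda>" "\<Lambda> \<subseteq> X0" "measure M \<Lambda> > 1 - \<gamma>" "0 \<le> C" "\<And>x. x \<in> \<Lambda> \<Longrightarrow> reg C x"
    using regular_compact[OF assms] by blast
  obtain K \<delta> where K: "K > 0" "\<delta> > 0" "\<And>x y i. x \<in> \<Lambda> \<Longrightarrow> y \<in> \<Lambda> \<Longrightarrow> dist x y < \<delta> \<Longrightarrow> i \<in> I \<Longrightarrow>
      hat_d (V x i) (V y i) \<le> K * dist x y powr (\<nu> * \<omega>)"
    using hat_d_holder[OF \<Lambda>(2,5,4)] by blast
  have "hat_d (E i x) (E i y) \<le> K * dist x y powr (\<nu> * \<omega>)"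
    if "x \<in> \<Lambda>" "y \<in> \<Lambda>" "dist x y < \<delta>" "i \<in> {1..k}" for x y i
    using K(3)[OF that(1-3), of i] that(4) V_E[OF that(4)] by simp
  moreover have "hat_d (F x) (F y) \<le> K * dist x y powr (\<nu> * \<omega>)"
    if "x \<in> \<Lambda>" "y \<in> \<Lambda>" "dist x y < \<delta>" for x y
    using K(3)[OF that, of "Suc k"] by (simp add: V_F)
  ultimately show ?thesis using \<Lambda>(1-3) K(1,2) by blast
qed

end

section \<open>Uniform choice of the exponents and conclusion\<close>

lemma oseledets_splittingD:
  assumes "oseledets_splitting M f A X0 k lam E F"
  shows "1 \<le> k" and "invariant_full_set M f X0"
    and "splitting_properties M f A X0 k lam E F (lam (Suc k))"
    and "\<And>l i. 1 \<le> l \<Longrightarrow> l < i \<Longrightarrow> i \<le> Suc k \<Longrightarrow> lam i < lam l"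
proof -
  have *: "1 \<le> k \<and> invariant_full_set M f X0 \<and> splitting_properties M f A X0 k lam E F (lam (Suc k)) \<and>
    (\<forall>i\<in>{1..k}. lam (Suc i) < lam i)"
    using assms unfolding oseledets_splitting_def
  proof (elim disjE conjE exE)
    assume "oseledets_case1 M f A X0 k lam E F" and last: "lam (Suc k) = alpha_exponent M f A"
    then have c: "1 \<le> k" "invariant_full_set M f X0" "\<forall>i\<in>{1..<k}. lam i > lam (Suc i)"
      "lam k > alpha_exponent M f A" "splitting_properties M f A X0 k lam E F (alpha_exponent M f A)"
      unfolding oseledets_case1_def by simp_all
    moreover have "lam (Suc i) < lam i" if "i \<in> {1..k}" for i
      using c(3,4) last that by (cases "i = k") auto
    ultimately show ?thesis using last by simp
  next
    fix Fs assume k: "1 \<le> k" and "oseledets_case2 M f A X0 lam E Fs" "F = Fs (Suc k)"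
    then show ?thesis unfolding oseledets_case2_def by simp
  qed
  then show "1 \<le> k" "invariant_full_set M f X0" "splitting_properties M f A X0 k lam E F (lam (Suc k))"
    by simp_all
  fix l i :: nat assume l: "1 \<le> l" and "l < i" "i \<le> Suc k"
  have "Suc l \<le> i" using \<open>l < i\<close> by simp
  then have "i \<le> Suc k \<longrightarrow> lam i < lam l"
  proof (induction i rule: dec_induct)
    case base
    then show ?case using * l by auto
  next
    case (step n)
    then show ?case using * l by (auto intro: less_trans[of _ "lam n"])
  qed
  then show "lam i < lam l" using \<open>i \<le> Suc k\<close> by simp
qed

theorem theorem2p2:
  fixes f :: "'x::metric_space \<Rightarrow> 'x"
    and M :: "'x measure"
    and A :: "'x \<Rightarrow> ('b::banach \<Rightarrow>\<^sub>L 'b)"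
    and \<nu> :: real
  assumes "compact (UNIV :: 'x set)"
    and "bi_lipschitz_homeo f"
    and "prob_space M" and "sets M = sets borel"
    and "invariant_measure M f" and "ergodic_measure M f"
    and "\<not> finite_dim (UNIV :: 'b set)"
    and "\<nu> > 0" and "GL_holder \<nu> A"
    and "quasi_compact M f A"
  shows "\<exists>\<omega> :: real list \<Rightarrow> nat \<Rightarrow> real.
    \<forall>k lam X0 E F. oseledets_splitting M f A X0 k lam E F \<longrightarrow>
      (\<forall>i\<in>{1..Suc k}. 0 < \<omega> (map lam [1..<k+2]) i \<and> \<omega> (map lam [1..<k+2]) i < 1) \<and>
      (\<forall>\<gamma>>0. \<exists>\<Lambda> C \<delta>. compact \<Lambda> \<and> \<Lambda> \<subseteq> X0 \<and> measure M \<Lambda> > 1 - \<gamma> \<and> C > 0 \<and> \<delta> > 0 \<and>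
        (\<forall>x\<in>\<Lambda>. \<forall>y\<in>\<Lambda>. dist x y < \<delta> \<longrightarrow>
          (\<forall>i\<in>{1..k}.
             hat_d (E i x) (E i y) \<le> C * dist x y powr (\<nu> * \<omega> (map lam [1..<k+2]) i)) \<and>
          hat_d (F x) (F y) \<le> C * dist x y powr (\<nu> * \<omega> (map lam [1..<k+2]) (Suc k))))"
proof -
  obtain a where a: "1 \<le> a"
    "\<And>x n. norm (cocycle f A x (int n)) \<le> a ^ n"
    "\<And>x n. norm (cocycle f A x (- int n)) \<le> a ^ n"
    "\<And>x y n. norm (cocycle f A x (int n) - cocycle f A y (int n)) \<le> a ^ n * dist x y powr \<nu>"
    "\<And>x y n. norm (cocycle f A x (- int n) - cocycle f A y (- int n)) \<le> a ^ n * dist x y powr \<nu>"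
    using GL_holder_cocycle_bounds[OF assms(1,2,8,9)] by blast
  have GL: "range A \<subseteq> GL" using assms(9) by (simp add: GL_holder_def)
  define concl where "concl w k X0 E F \<longleftrightarrow> (\<forall>\<gamma>>0. \<exists>\<Lambda> C \<delta>. compact \<Lambda> \<and> \<Lambda> \<subseteq> X0 \<and>
      measure M \<Lambda> > 1 - \<gamma> \<and> C > 0 \<and> \<delta> > 0 \<and>
      (\<forall>x\<in>\<Lambda>. \<forall>y\<in>\<Lambda>. dist x y < \<delta> \<longrightarrow>
        (\<forall>i\<in>{1..k}. hat_d (E i x) (E i y) \<le> C * dist x y powr (\<nu> * w)) \<and>
        hat_d (F x) (F y) \<le> C * dist x y powr (\<nu> * w)))"
    for w k X0 and E :: "nat \<Rightarrow> 'x \<Rightarrow> 'b set" and F :: "'x \<Rightarrow> 'b set"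
  \<comment> \<open>The exponent must be a function of the list L of exponents alone, so w is found
    for each L before k, lam, X0, E and F are fixed.\<close>
  have "\<exists>w. 0 < w \<and> w < 1 \<and> (\<forall>k lam X0 E F. oseledets_splitting M f A X0 k lam E F \<longrightarrow>
      L = map lam [1..<k+2] \<longrightarrow> concl w k X0 E F)" for L
  proof (cases "\<exists>k lam X0 E F. oseledets_splitting M f A X0 k lam E F \<and> L = map lam [1..<k+2]")
    case False
    \<comment> \<open>No splitting has this list of exponents, so any value in (0,1) will
      do.\<close>
    have "0 < (1/2 :: real)" "(1/2 :: real) < 1" by simp_all
    then show ?thesis using False by blast
  next
    case True
    then obtain k0 lam0 X1 E1 F1 where os0: "oseledets_splitting M f A X1 k0 lam0 E1 F1"
      and L0: "L = map lam0 [1..<k0+2]" by blast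
    define P where "P = {(l, i). 1 \<le> l \<and> l < i \<and> i \<le> Suc k0}"
    \<comment> \<open>The smallest gap, computed from one representative splitting with list L. All
      others with this list share k and the exponents with indices 1 to k + 1, hence these
      constants.\<close>
    define \<Delta> where "\<Delta> = Min ((\<lambda>(l, i). lam0 l - lam0 i) ` P)"
    define b where "b = (\<Sum>l\<in>{1..Suc k0}. \<bar>lam0 l\<bar>) + \<Delta> / 4"
    have finP: "finite P"
      by (rule finite_subset[of _ "{..Suc k0} \<times> {..Suc k0}"]) (auto simp: P_def)
    have "(1, 2) \<in> P" using oseledets_splittingD(1)[OF os0] by (auto simp: P_def)
    then have neP: "P \<noteq> {}" by auto
    have \<Delta>: "0 < \<Delta>"
      unfolding \<Delta>_def using finP neP oseledets_splittingD(4)[OF os0]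
      by (subst Min_gr_iff) (auto simp: P_def)
    have gap: "\<Delta> \<le> lam0 l - lam0 i" if "1 \<le> l" "l < i" "i \<le> Suc k0" for l i
      unfolding \<Delta>_def using finP that by (intro Min_le) (auto simp: P_def image_iff)
    have b: "\<bar>lam0 l\<bar> + \<Delta> / 4 \<le> b" if "l \<in> {1..Suc k0}" for l
      using member_le_sum[OF that, of "\<lambda>l. \<bar>lam0 l\<bar>"] by (simp add: b_def)
    define q Q where "q = exp (- \<Delta> / 2)" and "Q = a * exp b"
    define w where "w = ln q / (ln q - ln Q)"
    have main: "0 < w \<and> w < 1 \<and> concl w k X0 E F"
      if os: "oseledets_splitting M f A X0 k lam E F" and L: "L = map lam [1..<k+2]" for k lam X0 E F
    proof -
      \<comment> \<open>The list has length k + 1, so it determines k.\<close>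
      have k: "k = k0" using arg_cong[OF L, of length] arg_cong[OF L0, of length]
        by (simp add: length_upt del: upt_Suc add_2_eq_Suc add_2_eq_Suc')
      have lam: "lam l = lam0 l" if "l \<in> {1..Suc k}" for l
        using L L0 that unfolding k by (auto simp del: upt_Suc)
      interpret oseledets_gap f M A X0 k lam E F a \<nu> \<Delta> b q Q w
      proof (intro oseledets_gap.intro oseledets_bundle.intro oseledets_gap_axioms.intro)
        show "\<Delta> \<le> lam l - lam i" if "1 \<le> l" "l < i" "i \<le> Suc k" for l i
          using gap[of l i] lam[of l] lam[of i] that k by auto
        show "\<bar>lam l\<bar> + \<Delta> / 4 \<le> b" if "l \<in> {1..Suc k}" for l
          using b[of l] lam[OF that] that k by auto
      qed (rule assms a GL \<Delta> oseledets_splittingD(2,3)[OF os]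
          eq_reflection[OF q_def] eq_reflection[OF Q_def] eq_reflection[OF w_def])+
      show ?thesis unfolding concl_def by (intro conjI allI impI \<omega> holder_conclusion)
    qed
    then show ?thesis using os0 L0 by blast
  qed
  then obtain w where w: "\<And>L. 0 < w L" "\<And>L. w L < 1"
    "\<And>k lam X0 E F. oseledets_splitting M f A X0 k lam E F \<Longrightarrow> concl (w (map lam [1..<k+2])) k X0 E F"
    by metis
  \<comment> \<open>All summands get the same exponent, since \<omega> was built from the smallest
    gap and the largest rate.\<close>
  show ?thesis
  proof (intro exI[of _ "\<lambda>L i. w L"] allI impI conjI)
    fix k lam X0 E F assume os: "oseledets_splitting M f A X0 k lam E F"
    show "\<forall>i\<in>{1..Suc k}. 0 < w (map lam [1..<k+2]) \<and> w (map lam [1..<k+2]) < 1" using w(1,2) by simp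
    fix \<gamma> :: real assume "\<gamma> > 0"
    then show "\<exists>\<Lambda> C \<delta>. compact \<Lambda> \<and> \<Lambda> \<subseteq> X0 \<and> measure M \<Lambda> > 1 - \<gamma> \<and> C > 0 \<and> \<delta> > 0 \<and>
        (\<forall>x\<in>\<Lambda>. \<forall>y\<in>\<Lambda>. dist x y < \<delta> \<longrightarrow>
          (\<forall>i\<in>{1..k}. hat_d (E i x) (E i y) \<le> C * dist x y powr (\<nu> * w (map lam [1..<k+2]))) \<and>
          hat_d (F x) (F y) \<le> C * dist x y powr (\<nu> * w (map lam [1..<k+2])))"
      using w(3)[OF os] unfolding concl_def by blast
  qed
qed

end
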